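(* Let $F\in\mathbb{Z}[x,y]$ be a binary form of degree $d\ge1$ and $m$ a positive integer. Fix $\beta>\kappa(m,F)$. Then for all $X\ge3$, \[\frac1{X^{\frac{m+1}{md}}}\#\left\{(a,b)\in\mathbb{Z}^2: |a|\le X^{1/d},\ |b|\le X^{1/(md)},\ \operatorname{rad}(F(a,b^m))^\beta\le X\right\}\ll\frac{(\log\log X)^2}{(\log X)^{1/2}},\] where the implied constant depends at most on $\beta,F,m$. Moreover, $\operatorname{rad}(F(a,b^m))^{\lambda(m,F)}\ll X$ for all $(a,b)\in\mathbb{Z}^2$ with $|a|\le X^{1/d}$, $|b|\le X^{1/(md)}$, where the implied constant depends only on $F$ and $m$.
   Context: $\operatorname{rad}(n)=\prod_{p\mid n}p$. Write $F=c_0F_0^{e_0}F_1^{e_1}\cdots F_\psi^{e_\psi}$ with $F_0(x,y)=y$, $e_0\ge0$, $e_1,\dots,e_\psi\ge1$, $c_0\in\mathbb{Q}$, and $F_0,F_1,\dots,F_\psi\in\mathbb{Z}[x,y]$ pairwise coprime homogeneous polynomials irreducible over $\mathbb{Q}$. Let $\delta_0=1$ if $e_0\ge1$ and $\delta_0=0$ otherwise, and $\delta_i=m\deg F_i$ for $1\le i\le\psi$. Let $w_i=\max\{1,\delta_i-2\}$ if $x\nmid F_i(x,y)$ and $w_i=1$ if $x\mid F_i(x,y)$ ($0\le i\le\psi$). Define $\kappa(m,F)=\dfrac{md}{\delta_0/w_0+\cdots+\delta_\psi/w_\psi}$ and $\lambda(m,F)=\dfrac{md}{\delta_0+\cdots+\delta_\psi}$.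 *)

theory Defs
  imports Complex_Main "HOL-Computational_Algebra.Computational_Algebra"
begin

text \<open>
  A polynomial in two variables over a ring \<open>R\<close> is an element of \<open>R poly poly\<close>, read as
  \<open>R[x][y]\<close>: the coefficient of \<open>x^i y^j\<close> in \<open>F\<close> is \<open>coeff (coeff F j) i\<close>.
\<close>

definition var_x :: "int poly poly" where
  "var_x = [:[:0, 1:]:]"

definition var_y :: "int poly poly" where
  "var_y = [:0, 1:]"

definition eval_xy :: "int poly poly \<Rightarrow> int \<Rightarrow> int \<Rightarrow> int" where
  "eval_xy F a b = poly (poly F [:b:]) a"

definition binary_form :: "nat \<Rightarrow> int poly poly \<Rightarrow> bool" where
  "binary_form d F \<longleftrightarrow> F \<noteq> 0 \<and> (\<forall>i j. coeff (coeff F j) i \<noteq> 0 \<longrightarrow> i + j = d)"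

text \<open>The total degree (meaningful for \<open>F \<noteq> 0\<close> only).\<close>

definition total_degree :: "int poly poly \<Rightarrow> nat" where
  "total_degree F = Max {i + j | i j. coeff (coeff F j) i \<noteq> 0}"

definition over_rat :: "int poly poly \<Rightarrow> rat poly poly" where
  "over_rat F = map_poly (map_poly of_int) F"

text \<open>
  \<open>F = c\<^sub>0 F\<^sub>0^{e\<^sub>0} \<dots> F\<^sub>\<psi>^{e\<^sub>\<psi>}\<close> with \<open>F\<^sub>0 = y\<close>. Irreducibility and coprimality are those of
  \<open>\<rat>[x,y]\<close>, so the \<open>F\<^sub>i\<close> need not be primitive. Values of \<open>Fs\<close> and \<open>e\<close> beyond \<open>\<psi>\<close> are irrelevant.
\<close>

definition form_factorization ::
    "int poly poly \<Rightarrow> rat \<Rightarrow> nat \<Rightarrow> (nat \<Rightarrow> int poly poly) \<Rightarrow> (nat \<Rightarrow> nat) \<Rightarrow> bool" where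
  "form_factorization F c0 \<psi> Fs e \<longleftrightarrow>
     over_rat F = [:[:c0:]:] * (\<Prod>i\<le>\<psi>. over_rat (Fs i) ^ e i) \<and>
     Fs 0 = var_y \<and>
     (\<forall>i\<in>{1..\<psi>}. e i \<ge> 1) \<and>
     (\<forall>i\<le>\<psi>. (\<exists>k. binary_form k (Fs i)) \<and> irreducible (over_rat (Fs i))) \<and>
     (\<forall>i\<le>\<psi>. \<forall>j\<le>\<psi>. i \<noteq> j \<longrightarrow> coprime (over_rat (Fs i)) (over_rat (Fs j)))"

definition delta :: "nat \<Rightarrow> (nat \<Rightarrow> int poly poly) \<Rightarrow> (nat \<Rightarrow> nat) \<Rightarrow> nat \<Rightarrow> real" where
  "delta m Fs e i =
     (if i = 0 then (if e 0 \<ge> 1 then 1 else 0) else real (m * total_degree (Fs i)))"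

definition weight :: "nat \<Rightarrow> (nat \<Rightarrow> int poly poly) \<Rightarrow> (nat \<Rightarrow> nat) \<Rightarrow> nat \<Rightarrow> real" where
  "weight m Fs e i = (if var_x dvd Fs i then 1 else max 1 (delta m Fs e i - 2))"

definition kappa :: "nat \<Rightarrow> nat \<Rightarrow> nat \<Rightarrow> (nat \<Rightarrow> int poly poly) \<Rightarrow> (nat \<Rightarrow> nat) \<Rightarrow> real" where
  "kappa m d \<psi> Fs e = real (m * d) / (\<Sum>i\<le>\<psi>. delta m Fs e i / weight m Fs e i)"

definition lambda :: "nat \<Rightarrow> nat \<Rightarrow> nat \<Rightarrow> (nat \<Rightarrow> int poly poly) \<Rightarrow> (nat \<Rightarrow> nat) \<Rightarrow> real" where
  "lambda m d \<psi> Fs e = real (m * d) / (\<Sum>i\<le>\<psi>. delta m Fs e i)"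

text \<open>
  The product of the positive primes dividing \<open>n\<close>. Here \<open>rad 0 = 1\<close>, as \<open>prime_factors 0 = {}\<close>;
  in particular pairs \<open>(a, b)\<close> with \<open>F(a, b^m) = 0\<close> satisfy \<open>rad(F(a, b^m))^\<beta> \<le> X\<close> for \<open>X \<ge> 1\<close>.
\<close>

definition rad :: "int \<Rightarrow> int" where
  "rad n = (\<Prod>p\<in>prime_factors n. p)"

end

theory Submission
  imports
    Defs
    "HOL-Computational_Algebra.Field_as_Ring"
    "HOL-Library.Landau_Symbols"
    "HOL-Number_Theory.Cong"
    "HOL-Real_Asymp.Real_Asymp"
begin

text \<open>
  Put \<open>B = X\<^bsup>1/(md)\<^esup>\<close>, \<open>A = B\<^sup>m\<close> and \<open>z = sqrt (ln B)\<close>, and let \<open>G = f(a, b\<^sup>m)\<close> for one irreducible factor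
  \<open>f\<close> of degree \<open>k\<close>. Outside \<open>O(A B / z)\<close> pairs, \<open>|G|\<close> is at least \<open>A\<^sup>k B\<^bsup>-\<epsilon>\<^esup>\<close>, its \<open>z\<close>-smooth part is at most
  \<open>B\<^bsup>\<epsilon>\<^esup>\<close>, no prime above \<open>z\<close> divides both \<open>a\<close> and \<open>b\<close>, and no square of a prime \<open>p\<close> with \<open>z < p \<le> c A\<close>
  divides \<open>G\<close>: modulo \<open>p\<^sup>2\<close> the condition leaves at most \<open>k\<close> classes for \<open>a / b\<^sup>m\<close>, and the error terms
  are controlled by Chebyshev's bound for the number of primes. If \<open>m = 1\<close>, primes \<open>2 B < p \<le> B\<^bsup>2-\<eta>\<^esup>\<close> are
  excluded too, because the pairs of one class modulo \<open>p\<^sup>2\<close> then lie on a line through the origin.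
  So either the part of \<open>G\<close> composed of the primes above \<open>z\<close> is squarefree, and the radical of \<open>G\<close> has the
  size of \<open>G\<close>, or \<open>G\<close> has a prime factor above \<open>c A\<close> (above \<open>B\<^bsup>2-\<eta>\<^esup>\<close> if \<open>m = 1\<close>), which can only happen if
  \<open>k \<ge> 3\<close> and \<open>m k \<ge> 4\<close>; such a prime alone exceeds the required \<open>B\<^sup>\<tau>\<close> with \<open>\<tau> < \<delta> / w\<close>. Distinct factors have no
  common prime above \<open>z\<close>, so their contributions to the radical multiply. The bound obtained is
  \<open>O(1 / sqrt (ln X))\<close>, without the factor \<open>(ln (ln X))\<^sup>2\<close>.
\<close>

section \<open>Roots modulo prime powers and small values\<close>

text \<open>The size of \<open>z\<close> is forced from both sides. Squares of primes above
  \<open>z\<close> cost a proportion of order 1 / z of the pairs, so \<open>z\<close> must reach the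
  order of sqrt (ln B). The smooth part consists of at most \<open>z\<close> prime powers, and the
  exceptions are rare only if each of these is allowed a size like exp (\<epsilon> z); the product
  is then about exp (\<epsilon> z^2), which is a small power of \<open>B\<close> only while z^2
  stays of the order of ln B.

  The obstacle is a square of a prime well beyond \<open>A\<close>. A residue class modulo p^2 can
  then still contain one \<open>a\<close> for each \<open>b\<close>, and there are too many such
  primes to pay for them one by one. Hence they are not excluded but used: in the cases where they
  survive, \<delta> / w = \<delta> / (\<delta> - 2) is at most \<open>m\<close>, or at most 2 if
  \<open>m = 1\<close>, which is what a single prime of this size can supply. In the remaining
  cases, degree at most 2 or \<open>m = 1\<close> with degree 3, the square of such a prime is
  already larger than |G|.

  All constants attached to the form (leading coefficients, Bezout constants, the denominator of
  \<open>c0\<close>) are fixed while \<open>z\<close> tends to infinity, so a prime above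
  \<open>z\<close> eventually divides none of them.\<close>

lemma poly_factor_out:
  fixes f :: "'a::idom poly"
  assumes "degree f = Suc n"
  obtains h where "degree h = n" "lead_coeff h = lead_coeff f"
    "\<And>x. poly f x = poly f a + (x - a) * poly h x"
proof
  let ?h = "synthetic_div f a"
  have *: "[:-a, 1:] * ?h + [:poly f a:] = f"
    by (rule synthetic_div_correct')
  show d: "degree ?h = n"
    using assms by (simp add: degree_synthetic_div)
  show "poly f x = poly f a + (x - a) * poly ?h x" for x
    by (subst *[symmetric]) (simp add: algebra_simps)
  have h0: "?h \<noteq> 0"
    using assms by (auto simp: synthetic_div_eq_0_iff)
  have "lead_coeff f = coeff ([:-a, 1:] * ?h + [:poly f a:]) (Suc n)"
    using assms * by simp
  also have "\<dots> = coeff ([:-a, 1:] * ?h) (Suc n)"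
    by simp
  also have "Suc n = degree ([:-a, 1:] * ?h)"
    using h0 d by (subst degree_mult_eq) auto
  finally show "lead_coeff ?h = lead_coeff f"
    by (simp add: lead_coeff_mult del: mult_pCons_left)
qed

lemma poly_diff_dvd:
  fixes f :: "'a::comm_ring_1 poly"
  shows "x - y dvd poly f x - poly f y"
proof -
  have "[:-y, 1:] * synthetic_div f y + [:poly f y:] = f"
    by (rule synthetic_div_correct')
  then have "poly f x = (x - y) * poly (synthetic_div f y) x + poly f y"
    by (metis (no_types, lifting) poly_add poly_mult poly_pCons poly_0 add.commute mult.right_neutral mult_zero_right add_0 diff_conv_add_uminus)
  then show ?thesis by simp
qed

lemma prime_power_dvd_factor:
  fixes p :: int
  assumes "prime p" "p ^ (t + u) dvd x * y" "\<not> p ^ Suc t dvd x"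
  shows "p ^ u dvd y"
  using assms(2,3)
proof (induction t arbitrary: x)
  case 0
  then have "coprime (p ^ u) x"
    using assms(1) by (simp add: prime_imp_coprime)
  with 0 show ?case by (simp add: coprime_dvd_mult_right_iff)
next
  case (Suc t)
  show ?case
  proof (cases "p dvd x")
    case True
    then obtain x' where x: "x = p * x'" by blast
    have "p \<noteq> 0" using assms(1) by auto
    then show ?thesis
      using Suc x by (simp add: mult.assoc)
  next
    case False
    then have "coprime (p ^ (Suc t + u)) x"
      using assms(1) by (simp add: prime_imp_coprime)
    then have "p ^ (Suc t + u) dvd y"
      using Suc.prems(1) by (simp only: coprime_dvd_mult_right_iff)
    then show ?thesis
      by (meson dvd_trans le_add2 le_imp_power_dvd)
  qed
qed

text \<open>Fix one solution \<open>a\<close> and write f(x) = f(a) + (x - a) h(x). For another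
  solution \<open>x\<close>, either p^(s+1) divides x - a, or x - a absorbs at most \<open>s\<close>
  factors \<open>p\<close> and h(x) keeps the exponent r + n s. As \<open>h\<close> has the same
  leading coefficient, induction on the degree applies; the constant left at the end is the leading
  coefficient, which p^r does not divide. Nothing is asked of the roots to be simple, so small
  primes are covered as well.\<close>

lemma prime_power_roots_cover:
  fixes f :: "int poly"
  assumes "prime p" "\<not> p ^ r dvd lead_coeff f"
  shows "\<exists>R. finite R \<and> card R \<le> degree f \<and>
    (\<forall>x. p ^ (r + degree f * s) dvd poly f x \<longrightarrow> (\<exists>y\<in>R. p ^ Suc s dvd x - y))"
  using assms(2)
proof (induction "degree f" arbitrary: f)
  case 0
  then obtain c where "f = [:c:]"
    using degree_eq_zeroE by metis
  with 0 show ?case by (intro exI[of _ "{}"]) auto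
next
  case (Suc n)
  show ?case
  proof (cases "\<exists>x. p ^ (r + degree f * s) dvd poly f x")
    case True
    then obtain a where a: "p ^ (r + degree f * s) dvd poly f a" by blast
    obtain h where h: "degree h = n" "lead_coeff h = lead_coeff f"
      "\<And>x. poly f x = poly f a + (x - a) * poly h x"
      using poly_factor_out[of f n a] Suc by metis
    obtain R where R: "finite R" "card R \<le> n"
      "\<And>x. p ^ (r + n * s) dvd poly h x \<Longrightarrow> \<exists>y\<in>R. p ^ Suc s dvd x - y"
      using Suc.hyps(1)[of h] h Suc.prems by auto
    have "\<exists>y\<in>insert a R. p ^ Suc s dvd x - y"
      if x: "p ^ (r + degree f * s) dvd poly f x" for x
    proof (cases "p ^ Suc s dvd x - a")
      case False
      have "p ^ (r + degree f * s) dvd (x - a) * poly h x"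
        using x a h(3)[of x] by (simp add: dvd_add_right_iff)
      then have "p ^ (s + (r + n * s)) dvd (x - a) * poly h x"
        using Suc(2) by (metis add.left_commute mult_Suc)
      then have "p ^ (r + n * s) dvd poly h x"
        using False assms(1) prime_power_dvd_factor by blast
      then show ?thesis using R by blast
    qed auto
    moreover have "card (insert a R) \<le> degree f"
      using R Suc(2) card_insert_le_m1[of "Suc n" R a] by simp
    ultimately show ?thesis
      using R(1) by (intro exI[of _ "insert a R"]) auto
  qed (intro exI[of _ "{}"], auto)
qed

text \<open>Hensel uniqueness: \<open>f\<close> has at most \<open>degree f\<close> roots modulo
  \<open>p\<close>, and each lifts to at most one class modulo p^2, because the certificate makes
  the derivative invertible at the roots. \<open>D\<close> takes the place of the
  discriminant.\<close>

lemma prime_square_roots_cover: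
  fixes f U V :: "int poly"
  assumes "prime p" "\<not> p dvd lead_coeff f" "U * f + V * pderiv f = [:D:]" "\<not> p dvd D"
  shows "\<exists>R. finite R \<and> card R \<le> degree f \<and>
    (\<forall>x. p\<^sup>2 dvd poly f x \<longrightarrow> (\<exists>y\<in>R. p\<^sup>2 dvd x - y))"
proof -
  obtain R where R: "finite R" "card R \<le> degree f"
    "\<And>x. p dvd poly f x \<Longrightarrow> \<exists>y\<in>R. p dvd x - y"
    using prime_power_roots_cover[of p 1 f 0] assms by auto
  define S where "S = {x. p\<^sup>2 dvd poly f x}"
  \<comment> \<open>The elements of \<open>R\<close> only represent roots modulo \<open>p\<close>;
    \<open>g y\<close> replaces \<open>y\<close> by a root modulo p^2 above it, whenever there is
    one.\<close>
  define g where "g y = (SOME x. x \<in> S \<and> p dvd x - y)" for y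
  have "\<exists>y\<in>g ` R. p\<^sup>2 dvd x - y" if x: "p\<^sup>2 dvd poly f x" for x
  proof -
    have px: "p dvd poly f x"
      using x by (meson dvd_power dvd_trans pos2)
    then obtain y where y: "y \<in> R" "p dvd x - y" using R by blast
    then have "x \<in> S \<and> p dvd x - y" using x by (simp add: S_def)
    then have z: "g y \<in> S" "p dvd g y - y"
      unfolding g_def by (metis (mono_tags, lifting) someI_ex)+
    define z where "z = g y"
    have zx: "p dvd z - x"
      using z(2) y(2) by (metis z_def dvd_diff_commute dvd_diff diff_diff_eq2 diff_add_cancel add.commute)
    obtain h where h: "poly f z = poly f x + (z - x) * poly h z" "poly h x = poly (pderiv f) x"
      "p dvd poly h z - poly h x"
    proof -
      let ?h = "synthetic_div f x"
      have *: "[:-x, 1:] * ?h + [:poly f x:] = f"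
        by (rule synthetic_div_correct')
      have 1: "poly f z = poly f x + (z - x) * poly ?h z"
        by (subst *[symmetric]) (simp add: algebra_simps)
      have "poly (pderiv f) x = poly ?h x"
        by (subst *[symmetric]) (simp add: pderiv_add pderiv_mult pderiv_pCons del: mult_pCons_left)
      moreover have "p dvd poly ?h z - poly ?h x"
        using zx poly_diff_dvd by (metis dvd_trans)
      ultimately show ?thesis using 1 that by metis
    qed
    \<comment> \<open>A common prime divisor \<open>p\<close> of f(x) and f'(x) would divide
      \<open>D\<close>.\<close>
    have "poly (U * f + V * pderiv f) x = D"
      using assms(3) by simp
    then have nd: "\<not> p dvd poly (pderiv f) x"
      using px assms(4) by (metis dvd_add dvd_mult poly_add poly_mult)
    then have nh: "\<not> p dvd poly h z"
      using h(2,3) by (metis dvd_diff_right_iff dvd_diff_commute diff_diff_eq2 dvd_diffD)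
    have "p\<^sup>2 dvd (z - x) * poly h z"
      using h(1) x z(1) by (simp add: S_def z_def dvd_add_right_iff)
    moreover have "coprime (p\<^sup>2) (poly h z)"
      using nh assms(1) by (simp add: prime_imp_coprime)
    ultimately have "p\<^sup>2 dvd z - x"
      by (simp add: coprime_dvd_mult_left_iff)
    then show ?thesis
      using y(1) z_def dvd_diff_commute by blast
  qed
  moreover have "card (g ` R) \<le> degree f"
    using R card_image_le le_trans by blast
  ultimately show ?thesis
    using R(1) by (intro exI[of _ "g ` R"]) auto
qed

text \<open>The condition is \<open>u - 1 \<le> v\<close> and not \<open>u \<le> v\<close>, so that
  \<open>u = 1\<close> is admissible with any \<open>v \<ge> 0\<close>; the count of primes up to
  \<open>y < 1\<close> relies on it.\<close>

lemma card_int_interval_le: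
  fixes u v :: real
  assumes "u - 1 \<le> v"
  shows "finite {t::int. u \<le> t \<and> t \<le> v}" "card {t::int. u \<le> t \<and> t \<le> v} \<le> v - u + 1"
proof -
  have *: "{t::int. u \<le> t \<and> t \<le> v} = {\<lceil>u\<rceil>..\<lfloor>v\<rfloor>}"
    by (auto simp: ceiling_le_iff le_floor_iff)
  then show "finite {t::int. u \<le> t \<and> t \<le> v}" by simp
  show "card {t::int. u \<le> t \<and> t \<le> v} \<le> v - u + 1"
    unfolding * using assms by (simp, linarith)
qed

lemma card_residue_class_le:
  fixes A :: real and n y :: int
  assumes "A \<ge> 0" "n > 0"
  shows "finite {x::int. \<bar>real_of_int x\<bar> \<le> A \<and> n dvd x - y}"
    "card {x::int. \<bar>real_of_int x\<bar> \<le> A \<and> n dvd x - y} \<le> 2 * A / n + 1"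
proof -
  define u v where "u = (-A - y) / n" and "v = (A - y) / n"
  have uv: "v - u = 2 * A / n"
    by (simp add: u_def v_def diff_divide_distrib[symmetric])
  have "2 * A / n \<ge> 0" using assms by simp
  then have u1: "u - 1 \<le> v" using uv by linarith
  have sub: "{x::int. \<bar>real_of_int x\<bar> \<le> A \<and> n dvd x - y} \<subseteq> (\<lambda>t. y + n * t) ` {t::int. u \<le> t \<and> t \<le> v}"
  proof safe
    fix x :: int assume x: "\<bar>real_of_int x\<bar> \<le> A" "n dvd x - y"
    then obtain t where t: "x - y = n * t" by blast
    then have x': "real_of_int x = y + n * t"
      by (metis add.commute diff_add_cancel of_int_add of_int_mult)
    have "u \<le> t" "t \<le> v"
      using x(1) assms(2) unfolding u_def v_def x' by (auto simp: field_simps abs_le_iff)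
    then show "x \<in> (\<lambda>t. y + n * t) ` {t::int. u \<le> t \<and> t \<le> v}"
      using t by (auto simp: image_iff algebra_simps intro!: exI[of _ t])
  qed
  note fin = card_int_interval_le[OF u1]
  then show "finite {x::int. \<bar>real_of_int x\<bar> \<le> A \<and> n dvd x - y}"
    using sub finite_subset by blast
  have "card {x::int. \<bar>real_of_int x\<bar> \<le> A \<and> n dvd x - y} \<le> card {t::int. u \<le> t \<and> t \<le> v}"
    using sub fin(1) by (rule surj_card_le[rotated])
  with fin(2) uv show "card {x::int. \<bar>real_of_int x\<bar> \<le> A \<and> n dvd x - y} \<le> 2 * A / n + 1"
    by linarith
qed

text \<open>No real roots are needed. If |f(a)| and |f(x)| are at most \<open>T\<close>, then |x -
  a| |h(x)| is at most 2 T, so \<open>x\<close> lies within \<open>s\<close> of \<open>a\<close> or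
  |h(x)| is at most 2 T / s. Passing from (f, T) to (h, 2 T / s) divides both sides of the
  hypothesis by \<open>s\<close>, so it survives down to degree 0, where it says that the constant
  exceeds \<open>T\<close>.\<close>

lemma card_small_values_le:
  fixes f :: "int poly" and T s :: real
  assumes "2 ^ degree f * T < \<bar>lead_coeff f\<bar> * s ^ degree f" "s > 0"
  shows "finite {x. \<bar>real_of_int (poly f x)\<bar> \<le> T} \<and>
    card {x. \<bar>real_of_int (poly f x)\<bar> \<le> T} \<le> degree f * (2 * s + 1)"
  using assms(1)
proof (induction "degree f" arbitrary: f T)
  case 0
  then obtain c where "f = [:c:]"
    using degree_eq_zeroE by metis
  with 0 have "{x. \<bar>real_of_int (poly f x)\<bar> \<le> T} = {}" by auto
  then show ?case using assms(2) by (simp only:) simp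
next
  case (Suc n)
  show ?case
  proof (cases "{x. \<bar>real_of_int (poly f x)\<bar> \<le> T} = {}")
    case True
    then show ?thesis using assms(2) by (simp only:) simp
  next
    case False
    then obtain a where a: "\<bar>real_of_int (poly f a)\<bar> \<le> T" by auto
    obtain h where h: "degree h = n" "lead_coeff h = lead_coeff f"
      "\<And>x. poly f x = poly f a + (x - a) * poly h x"
      using poly_factor_out[of f n a] Suc by metis
    have "2 ^ degree h * (2 * T / s) < \<bar>lead_coeff h\<bar> * s ^ degree h"
      using Suc.prems Suc(2)[symmetric] assms(2) h(1,2) by (simp add: field_simps)
    then have IH: "finite {x. \<bar>real_of_int (poly h x)\<bar> \<le> 2 * T / s}"
      "card {x. \<bar>real_of_int (poly h x)\<bar> \<le> 2 * T / s} \<le> n * (2 * s + 1)"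
      using Suc(1)[of h "2 * T / s"] h(1) by auto
    let ?I = "{x::int. a - s \<le> x \<and> x \<le> a + s}"
    have I: "finite ?I" "card ?I \<le> 2 * s + 1"
      using card_int_interval_le[of "a - s" "a + s"] assms(2) by auto
    have sub: "{x. \<bar>real_of_int (poly f x)\<bar> \<le> T} \<subseteq> ?I \<union> {x. \<bar>real_of_int (poly h x)\<bar> \<le> 2 * T / s}"
    proof safe
      fix x :: int assume x: "\<bar>real_of_int (poly f x)\<bar> \<le> T"
        and nh: "\<not> \<bar>real_of_int (poly h x)\<bar> \<le> 2 * T / s"
      have "real_of_int (poly f x) - real_of_int (poly f a) = real_of_int (x - a) * real_of_int (poly h x)"
        using h(3)[of x] by (metis add_diff_cancel_left' of_int_diff of_int_mult)
      then have "\<bar>real_of_int (x - a)\<bar> * \<bar>real_of_int (poly h x)\<bar> \<le> 2 * T"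
        using x a by (simp add: abs_mult[symmetric])
      moreover have "\<bar>real_of_int (x - a)\<bar> * (2 * T / s) \<le> \<bar>real_of_int (x - a)\<bar> * \<bar>real_of_int (poly h x)\<bar>"
        using nh by (intro mult_left_mono) auto
      moreover have "\<bar>real_of_int (x - a)\<bar> * \<bar>real_of_int (poly h x)\<bar> > s * (2 * T / s)"
        if "\<bar>real_of_int (x - a)\<bar> > s"
        using that nh a assms(2) by (intro mult_strict_mono) auto
      ultimately have "\<bar>real_of_int (x - a)\<bar> \<le> s"
        using assms(2) by force
      then show "a - s \<le> x" "x \<le> a + s" by auto
    qed
    then have "card {x. \<bar>real_of_int (poly f x)\<bar> \<le> T} \<le> card ?I + card {x. \<bar>real_of_int (poly h x)\<bar> \<le> 2 * T / s}"
      using IH(1) I(1) by (meson card_mono card_Un_le finite_UnI le_trans)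
    then have "card {x. \<bar>real_of_int (poly f x)\<bar> \<le> T} \<le> (2 * s + 1) + n * (2 * s + 1)"
      using I(2) IH(2) by linarith
    moreover have "real (degree f) = real n + 1" using Suc(2) by simp
    ultimately show ?thesis
      using sub IH(1) I(1) by (auto simp: algebra_simps intro: finite_subset)
  qed
qed

section \<open>Chebyshev's upper bound\<close>

lemma prod_primes_dvd:
  fixes n :: nat
  assumes "finite S" "\<And>p. p \<in> S \<Longrightarrow> prime p" "\<And>p. p \<in> S \<Longrightarrow> p dvd n"
  shows "\<Prod>S dvd n"
  using assms
proof (induction S)
  case (insert p S)
  have "coprime p (\<Prod>S)"
    by (rule prod_coprime_right) (use insert in \<open>metis insertCI primes_coprime\<close>)
  with insert show ?case
    by (simp add: divides_mult)
qed auto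

lemma central_binomial_le: "(2 * m + 1) choose m \<le> 4 ^ m"
proof -
  have "2 * ((2 * m + 1) choose m) = ((2 * m + 1) choose m) + ((2 * m + 1) choose (m + 1))"
    using binomial_symmetric[of m "2 * m + 1"] by simp
  also have "\<dots> = (\<Sum>k\<in>{m, m + 1}. (2 * m + 1) choose k)"
    by simp
  also have "\<dots> \<le> (\<Sum>k\<le>2 * m + 1. (2 * m + 1) choose k)"
    by (rule sum_mono2) auto
  also have "\<dots> = 2 * 4 ^ m"
    using choose_row_sum[of "2 * m + 1"] by (simp add: power_mult)
  finally show ?thesis by simp
qed

text \<open>Erdos's induction: for n = 2 m + 1 the primes in (m + 1, n] all divide the binomial
  coefficient of \<open>n\<close> over \<open>m\<close>, which is at most 4^m, and the smaller
  primes contribute at most 4^(m+1).\<close>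

lemma primorial_le: "\<Prod>{p::nat. prime p \<and> p \<le> n} \<le> 4 ^ n"
proof (induction n rule: less_induct)
  case (less n)
  consider "n \<le> 1" | "n = 2" | "n > 2" "even n" | "n > 1" "odd n"
    by linarith
  then show ?case
  proof cases
    case 1
    then have "{p::nat. prime p \<and> p \<le> n} = {}"
      by (auto dest: prime_gt_1_nat)
    then show ?thesis by (simp only:) simp
  next
    case 2
    then have "{p::nat. prime p \<and> p \<le> n} = {2}"
      by (auto dest: prime_ge_2_nat)
    then show ?thesis using 2 by (simp only:) simp
  next
    case 3
    then have "\<not> prime n"
      using prime_odd_nat by blast
    then have "p \<le> n - 1" if "prime p" "p \<le> n" for p
      using that by (cases "p = n") auto
    then have "{p::nat. prime p \<and> p \<le> n} = {p::nat. prime p \<and> p \<le> n - 1}"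
      by auto
    then have "\<Prod>{p::nat. prime p \<and> p \<le> n} \<le> 4 ^ (n - 1)"
      using less[of "n - 1"] 3 by simp
    also have "\<dots> \<le> 4 ^ n" by (rule power_increasing) auto
    finally show ?thesis .
  next
    case odd: 4
    then obtain m where "n = 2 * m + 1" by (elim oddE)
    with odd have 4: "n = 2 * m + 1" "m \<ge> 1" by auto
    let ?S = "{p::nat. prime p \<and> m + 1 < p \<and> p \<le> n}"
    have "p dvd n choose m" if "p \<in> ?S" for p
    proof -
      have "p dvd fact n"
        using that by (simp add: prime_dvd_fact_iff)
      also have "fact n = fact m * fact (m + 1) * (n choose m)"
        using binomial_fact_lemma[of m n] 4 by (simp del: fact_Suc)
      finally show ?thesis
        using that by (auto simp: prime_dvd_mult_iff prime_dvd_fact_iff simp del: fact_Suc)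
    qed
    then have "\<Prod>?S dvd n choose m"
      by (intro prod_primes_dvd) auto
    then have "\<Prod>?S \<le> n choose m"
      by (rule dvd_imp_le) (use 4 in simp)
    also have "\<dots> \<le> 4 ^ m"
      using central_binomial_le 4 by simp
    finally have "\<Prod>?S \<le> 4 ^ m" .
    moreover have "{p::nat. prime p \<and> p \<le> n} = {p. prime p \<and> p \<le> m + 1} \<union> ?S"
      using 4 by auto
    then have "\<Prod>{p::nat. prime p \<and> p \<le> n} = \<Prod>{p. prime p \<and> p \<le> m + 1} * \<Prod>?S"
      by (simp only:) (intro prod.union_disjoint, auto)
    moreover have "\<Prod>{p. prime p \<and> p \<le> m + 1} \<le> 4 ^ (m + 1)"
      using 4 by (intro less) auto
    ultimately have "\<Prod>{p::nat. prime p \<and> p \<le> n} \<le> 4 ^ (m + 1) * 4 ^ m"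
      by (simp only: mult_le_mono)
    also have "\<dots> = 4 ^ n"
      using 4 by (simp add: power_add[symmetric] mult_2)
    finally show ?thesis .
  qed
qed

definition primes_upto :: "real \<Rightarrow> int set" where
  "primes_upto y = {p. prime p \<and> real_of_int p \<le> y}"

lemma finite_primes_upto [simp]: "finite (primes_upto y)"
proof (rule finite_subset)
  show "primes_upto y \<subseteq> {0..\<lfloor>y\<rfloor>}"
    by (auto simp: primes_upto_def le_floor_iff prime_ge_0_int)
qed auto

lemma card_primes_upto_le:
  fixes y :: real
  assumes "y \<ge> 0"
  shows "card (primes_upto y) \<le> y"
proof -
  have "primes_upto y \<subseteq> {t. 1 \<le> real_of_int t \<and> real_of_int t \<le> y}"
    by (auto simp: primes_upto_def dest: prime_gt_1_int)
  then have "card (primes_upto y) \<le> card {t. 1 \<le> real_of_int t \<and> real_of_int t \<le> y}"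
    using assms by (intro card_mono card_int_interval_le) auto
  then show ?thesis
    using card_int_interval_le(2)[of 1 y] assms by simp
qed

text \<open>Each prime above sqrt y contributes at least (ln y) / 2 to the logarithm of the
  primorial, which is at most y ln 4; the primes up to sqrt y are counted trivially.\<close>

lemma card_primes_upto_le_log:
  assumes "y > 1"
  shows "card (primes_upto y) \<le> sqrt y + 2 * ln 4 * y / ln y"
proof -
  define S where "S = {p \<in> primes_upto y. real_of_int p > sqrt y}"
  have "real (card S) * ln (sqrt y) \<le> (\<Sum>p\<in>S. ln (real_of_int p))"
  proof -
    have "(\<Sum>p\<in>S. ln (sqrt y)) \<le> (\<Sum>p\<in>S. ln (real_of_int p))"
      using assms by (intro sum_mono) (auto simp: S_def intro!: ln_mono)
    then show ?thesis by simp
  qed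
  also have "\<dots> \<le> (\<Sum>p\<in>primes_upto y. ln (real_of_int p))"
    using finite_primes_upto
    by (rule sum_mono2) (auto simp: S_def primes_upto_def dest: prime_gt_1_int)
  also have "\<dots> = ln (\<Prod>p\<in>primes_upto y. real_of_int p)"
  proof (rule ln_prod[symmetric])
    fix p assume "p \<in> primes_upto y"
    then show "real_of_int p \<noteq> 0" by (auto simp: primes_upto_def)
  qed (rule finite_primes_upto)
  also have "(\<Prod>p\<in>primes_upto y. real_of_int p) = real (\<Prod>{p::nat. prime p \<and> p \<le> nat \<lfloor>y\<rfloor>})"
  proof -
    have "primes_upto y = int ` {p::nat. prime p \<and> p \<le> nat \<lfloor>y\<rfloor>}"
    proof safe
      fix p assume p: "p \<in> primes_upto y"
      then have "p \<ge> 0" "prime p" "p \<le> \<lfloor>y\<rfloor>"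
        by (simp_all add: primes_upto_def prime_ge_0_int le_floor_iff)
      moreover from this have "p = int (nat p)" by simp
      moreover have "prime (nat p)"
        using \<open>prime p\<close> by (simp only: prime_int_nat_transfer)
      moreover have "nat p \<le> nat \<lfloor>y\<rfloor>"
        using \<open>p \<le> \<lfloor>y\<rfloor>\<close> by (rule nat_mono)
      ultimately show "p \<in> int ` {p::nat. prime p \<and> p \<le> nat \<lfloor>y\<rfloor>}" by blast
    next
      fix p :: nat assume p: "prime p" "p \<le> nat \<lfloor>y\<rfloor>"
      then have "int p \<le> \<lfloor>y\<rfloor>" using assms by linarith
      with p show "int p \<in> primes_upto y"
        by (auto simp: primes_upto_def le_floor_iff)
    qed
    then have "(\<Prod>p\<in>primes_upto y. real_of_int p) = (\<Prod>p | prime p \<and> p \<le> nat \<lfloor>y\<rfloor>. real p)"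
      by (simp add: prod.reindex)
    then show ?thesis by simp
  qed
  also have "ln \<dots> \<le> ln (4 ^ nat \<lfloor>y\<rfloor>)"
  proof (rule ln_mono)
    show "0 < real (\<Prod>{p::nat. prime p \<and> p \<le> nat \<lfloor>y\<rfloor>})"
      by (auto intro!: prod_pos dest: prime_gt_0_nat)
    show "real (\<Prod>{p::nat. prime p \<and> p \<le> nat \<lfloor>y\<rfloor>}) \<le> 4 ^ nat \<lfloor>y\<rfloor>"
      using primorial_le[of "nat \<lfloor>y\<rfloor>"] by (metis of_nat_le_iff of_nat_numeral of_nat_power)
  qed
  also have "\<dots> \<le> y * ln 4"
    using assms by (simp add: ln_realpow mult_right_mono)
  finally have "real (card S) \<le> y * ln 4 / ln (sqrt y)"
    using assms by (simp add: field_simps)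
  also have "\<dots> = 2 * ln 4 * y / ln y"
    using assms by (simp add: ln_sqrt)
  finally have 1: "real (card S) \<le> 2 * ln 4 * y / ln y" .
  have "primes_upto y = primes_upto (sqrt y) \<union> S"
  proof -
    have "sqrt y * 1 \<le> sqrt y * sqrt y"
      using assms by (intro mult_left_mono) auto
    then have "sqrt y \<le> y" using assms by simp
    then show ?thesis by (auto simp: S_def primes_upto_def)
  qed
  then have "card (primes_upto y) \<le> card (primes_upto (sqrt y)) + card S"
    by (simp only: card_Un_le)
  with 1 card_primes_upto_le[of "sqrt y"] assms show ?thesis by simp
qed

text \<open>Telescoping with 1 / n^2 \<le> 1 / (n - 1) - 1 / n bounds the sum by 1 /
  \<lfloor>t\<rfloor>, and \<lfloor>t\<rfloor> \<ge> t / 2 for t \<ge> 1 is the source of the factor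
  2.\<close>

lemma sum_inverse_squares_tail_le:
  fixes t :: real and S :: "int set"
  assumes "t \<ge> 1" "finite S" "\<And>n. n \<in> S \<Longrightarrow> real_of_int n > t"
  shows "(\<Sum>n\<in>S. 1 / (real_of_int n)\<^sup>2) \<le> 2 / t"
proof -
  define N where "N = \<lfloor>t\<rfloor> + 1"
  have "\<lfloor>t\<rfloor> \<ge> 1" using assms(1) by simp
  moreover have "\<lfloor>t\<rfloor> + 1 > t" by linarith
  ultimately have N: "real_of_int N > t" "N \<ge> 2" "real_of_int N - 1 \<ge> t / 2"
    using assms(1) unfolding N_def by linarith+
  have tail: "(\<Sum>n\<in>{N..<N + int k}. 1 / (real_of_int n)\<^sup>2) \<le> 1 / (N - 1) - 1 / (N + real k - 1)" for k
  proof (induction k)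
    case (Suc k)
    have e: "{N..<N + int (Suc k)} = insert (N + int k) {N..<N + int k}" by auto
    define u where "u = real_of_int N + real k"
    have u: "u \<ge> 2" using N(2) by (simp add: u_def)
    have "1 / u\<^sup>2 \<le> 1 / (u - 1) - 1 / u"
      using u by (simp add: field_simps power2_eq_square)
    then show ?case
      using Suc unfolding e by (simp add: u_def algebra_simps)
  qed simp
  obtain M where M: "\<And>n. n \<in> S \<Longrightarrow> n < M"
    using assms(2) Max_ge by (meson less_add_one order_le_less_trans)
  have sub: "S \<subseteq> {N..<N + int (nat (M - N))}"
  proof
    fix n assume n: "n \<in> S"
    then have "n \<ge> N" using assms(3)[of n] unfolding N_def by linarith
    with M[OF n] show "n \<in> {N..<N + int (nat (M - N))}" by auto
  qed
  have "(\<Sum>n\<in>S. 1 / (real_of_int n)\<^sup>2) \<le> (\<Sum>n\<in>{N..<N + int (nat (M - N))}. 1 / (real_of_int n)\<^sup>2)"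
    by (rule sum_mono2) (use sub in auto)
  also have "\<dots> \<le> 1 / (N - 1) - 1 / (N + real (nat (M - N)) - 1)"
    by (rule tail)
  also have "\<dots> \<le> 1 / (N - 1)"
    using N(2) by simp
  also have "\<dots> \<le> 1 / (t / 2)"
    using N assms(1) by (intro divide_left_mono) auto
  finally show ?thesis by simp
qed

section \<open>Negligible sets of pairs\<close>

text \<open>With \<open>B = X\<^bsup>1/(md)\<^esup>\<close> the pairs counted in the theorem lie in \<open>form_box m B\<close>.\<close>

definition form_box :: "nat \<Rightarrow> real \<Rightarrow> (int \<times> int) set" where
  "form_box m B = {(a, b). \<bar>real_of_int a\<bar> \<le> B ^ m \<and> \<bar>real_of_int b\<bar> \<le> B}"

text \<open>B^(m+1) is the order of the number of pairs in the box. The property \<open>P\<close>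
  receives \<open>B\<close>, since the thresholds \<open>sqrt (ln B)\<close> and
  \<open>B powr \<tau>\<close> grow with the box.\<close>

definition negligible_pairs :: "nat \<Rightarrow> (real \<Rightarrow> int \<Rightarrow> int \<Rightarrow> bool) \<Rightarrow> bool" where
  "negligible_pairs m P \<longleftrightarrow>
     (\<lambda>B. real (card {(a, b) \<in> form_box m B. P B a b})) \<in> O(\<lambda>B. B ^ (m + 1) / sqrt (ln B))"

lemma card_abs_le:
  fixes A :: real
  assumes "A \<ge> 0"
  shows "finite {a::int. \<bar>real_of_int a\<bar> \<le> A}" "card {a::int. \<bar>real_of_int a\<bar> \<le> A} \<le> 2 * A + 1"
  using card_residue_class_le[of A 1 0] assms by simp_all

lemma finite_form_box [simp]: "finite (form_box m B)"
proof (cases "B \<ge> 0")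
  case True
  have "form_box m B = {a. \<bar>real_of_int a\<bar> \<le> B ^ m} \<times> {b. \<bar>real_of_int b\<bar> \<le> B}"
    by (auto simp: form_box_def)
  then show ?thesis using True card_abs_le by simp
next
  case False
  then have "form_box m B = {}" by (auto simp: form_box_def)
  then show ?thesis by simp
qed

lemma finite_form_box_filter [simp]: "finite {(a, b). (a, b) \<in> form_box m B \<and> P a b}"
  by (rule finite_subset[of _ "form_box m B"]) auto

lemma card_form_box_le:
  fixes B :: real
  assumes "B \<ge> 1"
  shows "card (form_box m B) \<le> 9 * B ^ (m + 1)"
proof -
  have e: "form_box m B = {a. \<bar>real_of_int a\<bar> \<le> B ^ m} \<times> {b. \<bar>real_of_int b\<bar> \<le> B}"
    by (auto simp: form_box_def)
  have "B ^ m \<ge> 1" using assms by simp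
  have "real (card (form_box m B)) \<le> (2 * B ^ m + 1) * (2 * B + 1)"
    unfolding e card_cartesian_product of_nat_mult
    using assms by (intro mult_mono card_abs_le) auto
  also have "\<dots> \<le> (3 * B ^ m) * (3 * B)"
    using assms \<open>B ^ m \<ge> 1\<close> by (intro mult_mono) auto
  finally show ?thesis by (simp add: mult_ac)
qed

lemma negligible_pairs_mono:
  assumes "negligible_pairs m Q"
    "\<forall>\<^sub>F B in at_top. \<forall>a b. (a, b) \<in> form_box m B \<longrightarrow> P B a b \<longrightarrow> Q B a b"
  shows "negligible_pairs m P"
  unfolding negligible_pairs_def
proof (rule landau_o.big_trans[OF _ assms(1)[unfolded negligible_pairs_def]])
  show "(\<lambda>B. real (card {(a, b). (a, b) \<in> form_box m B \<and> P B a b}))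
    \<in> O(\<lambda>B. real (card {(a, b). (a, b) \<in> form_box m B \<and> Q B a b}))"
  proof (rule landau_o.big_mono)
    show "\<forall>\<^sub>F B in at_top. norm (real (card {(a, b). (a, b) \<in> form_box m B \<and> P B a b}))
      \<le> norm (real (card {(a, b). (a, b) \<in> form_box m B \<and> Q B a b}))"
      using assms(2) by eventually_elim (auto intro!: card_mono)
  qed
qed

lemma negligible_pairs_disj:
  assumes "negligible_pairs m P" "negligible_pairs m Q"
  shows "negligible_pairs m (\<lambda>B a b. P B a b \<or> Q B a b)"
proof -
  have "(\<lambda>B. real (card {(a, b). (a, b) \<in> form_box m B \<and> (P B a b \<or> Q B a b)}))
    \<in> O(\<lambda>B. real (card {(a, b). (a, b) \<in> form_box m B \<and> P B a b}) +
      real (card {(a, b). (a, b) \<in> form_box m B \<and> Q B a b}))"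
  proof (rule landau_o.big_mono, rule always_eventually, rule allI)
    fix B
    have "{(a, b). (a, b) \<in> form_box m B \<and> (P B a b \<or> Q B a b)} =
      {(a, b). (a, b) \<in> form_box m B \<and> P B a b} \<union> {(a, b). (a, b) \<in> form_box m B \<and> Q B a b}"
      by auto
    then show "norm (real (card {(a, b). (a, b) \<in> form_box m B \<and> (P B a b \<or> Q B a b)}))
      \<le> norm (real (card {(a, b). (a, b) \<in> form_box m B \<and> P B a b}) +
        real (card {(a, b). (a, b) \<in> form_box m B \<and> Q B a b}))"
      by (simp add: card_Un_le flip: of_nat_add)
  qed
  also have "\<dots> \<subseteq> O(\<lambda>B. B ^ (m + 1) / sqrt (ln B))"
    using assms unfolding negligible_pairs_def by (intro landau_o.big_subsetI sum_in_bigo)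
  finally show ?thesis unfolding negligible_pairs_def .
qed

lemma negligible_pairs_Bex:
  assumes "finite I" "\<And>i. i \<in> I \<Longrightarrow> negligible_pairs m (P i)"
  shows "negligible_pairs m (\<lambda>B a b. \<exists>i\<in>I. P i B a b)"
  using assms
proof (induction I)
  case empty
  then show ?case by (simp add: negligible_pairs_def)
next
  case (insert i I)
  then have "negligible_pairs m (\<lambda>B a b. P i B a b \<or> (\<exists>i\<in>I. P i B a b))"
    by (intro negligible_pairs_disj) auto
  then show ?case by simp
qed

lemma negligible_pairsI:
  assumes "g \<in> O(\<lambda>B. 1 / sqrt (ln B))"
    "\<forall>\<^sub>F B in at_top. real (card {(a, b) \<in> form_box m B. P B a b}) \<le> B ^ (m + 1) * g B"
  shows "negligible_pairs m P"
proof -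
  have "(\<lambda>B. real (card {(a, b) \<in> form_box m B. P B a b})) \<in> O(\<lambda>B. B ^ (m + 1) * g B)"
    by (rule landau_o.big_mono, use assms(2) in eventually_elim) auto
  also have "(\<lambda>B. B ^ (m + 1) * g B) \<in> O(\<lambda>B. B ^ (m + 1) * (1 / sqrt (ln B)))"
    by (intro landau_o.big.mult_left assms(1))
  finally show ?thesis unfolding negligible_pairs_def by simp
qed

lemma card_pairs_le:
  fixes B N :: real
  assumes "B \<ge> 0" "\<And>b. \<bar>real_of_int b\<bar> \<le> B \<Longrightarrow> card {a. \<bar>real_of_int a\<bar> \<le> B ^ m \<and> Q a b} \<le> N"
  shows "card {(a, b) \<in> form_box m B. Q a b} \<le> (2 * B + 1) * N"
proof -
  have N0: "N \<ge> 0"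
    using assms(2)[of 0] assms(1) by (simp add: order_trans[OF of_nat_0_le_iff])
  let ?T = "{b::int. \<bar>real_of_int b\<bar> \<le> B}"
  have "{(a, b) \<in> form_box m B. Q a b} = (\<Union>b\<in>?T. (\<lambda>a. (a, b)) ` {a. \<bar>real_of_int a\<bar> \<le> B ^ m \<and> Q a b})"
    by (auto simp: form_box_def)
  then have "card {(a, b) \<in> form_box m B. Q a b} \<le> (\<Sum>b\<in>?T. card ((\<lambda>a. (a, b)) ` {a. \<bar>real_of_int a\<bar> \<le> B ^ m \<and> Q a b}))"
    by (simp only:) (rule card_UN_le[OF card_abs_le(1)[OF assms(1)]])
  also have "real \<dots> \<le> (\<Sum>b\<in>?T. N)"
    unfolding of_nat_sum
  proof (rule sum_mono)
    fix b :: int assume "b \<in> ?T"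
    then have "card {a. \<bar>real_of_int a\<bar> \<le> B ^ m \<and> Q a b} \<le> N"
      using assms(2) by auto
    moreover have "inj_on (\<lambda>a::int. (a, b)) X" for X by (auto intro: inj_onI)
    ultimately show "card ((\<lambda>a. (a, b)) ` {a. \<bar>real_of_int a\<bar> \<le> B ^ m \<and> Q a b}) \<le> N"
      by (simp add: card_image)
  qed
  also have "\<dots> \<le> (2 * B + 1) * N"
    using card_abs_le(2)[OF assms(1)] N0 by (simp add: mult_right_mono)
  finally show ?thesis by simp
qed

lemma card_residue_cover_le:
  fixes A :: real and n :: int
  assumes "A \<ge> 0" "n > 0" "finite R" "card R \<le> k" "\<And>a. Q a \<Longrightarrow> \<exists>y\<in>R. n dvd a - y"
  shows "card {a::int. \<bar>real_of_int a\<bar> \<le> A \<and> Q a} \<le> k * (2 * A / n + 1)"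
proof -
  let ?C = "\<lambda>y. {x::int. \<bar>real_of_int x\<bar> \<le> A \<and> n dvd x - y}"
  have sub: "{a::int. \<bar>real_of_int a\<bar> \<le> A \<and> Q a} \<subseteq> (\<Union>y\<in>R. ?C y)"
    using assms(5) by auto
  have "card {a::int. \<bar>real_of_int a\<bar> \<le> A \<and> Q a} \<le> card (\<Union>y\<in>R. ?C y)"
    using sub by (rule card_mono[rotated]) (use assms card_residue_class_le in auto)
  also have "\<dots> \<le> (\<Sum>y\<in>R. card (?C y))"
    by (rule card_UN_le[OF assms(3)])
  also have "real \<dots> \<le> (\<Sum>y\<in>R. 2 * A / n + 1)"
    unfolding of_nat_sum by (intro sum_mono card_residue_class_le assms)
  also have "\<dots> \<le> k * (2 * A / n + 1)"
    using assms by (simp add: mult_right_mono)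
  finally show ?thesis by simp
qed

section \<open>Values of a homogenized polynomial and the congruence classes where they are
  divisible\<close>

definition form_val :: "int poly \<Rightarrow> int \<Rightarrow> int \<Rightarrow> int" where
  "form_val f a y = (\<Sum>i\<le>degree f. coeff f i * a ^ i * y ^ (degree f - i))"

text \<open>The same form, read as a polynomial in the first argument for fixed \<open>y\<close>.
  Its degree and leading coefficient do not depend on \<open>y\<close>, even for
  \<open>y = 0\<close>, so the counting bounds for polynomials hold uniformly in
  \<open>b\<close>.\<close>

definition form_poly :: "int poly \<Rightarrow> int \<Rightarrow> int poly" where
  "form_poly f y = (\<Sum>i\<le>degree f. monom (coeff f i * y ^ (degree f - i)) i)"

lemma poly_form_poly: "poly (form_poly f y) a = form_val f a y"
  by (simp add: form_poly_def form_val_def poly_sum poly_monom mult_ac)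

lemma coeff_form_poly: "coeff (form_poly f y) i = coeff f i * y ^ (degree f - i)"
proof -
  have "coeff (form_poly f y) i = (\<Sum>j\<le>degree f. if j = i then coeff f j * y ^ (degree f - j) else 0)"
    by (simp add: form_poly_def coeff_sum)
  then show ?thesis
    by (auto simp: coeff_eq_0)
qed

lemma degree_form_poly [simp]: "degree (form_poly f y) = degree f"
proof (cases "f = 0")
  case False
  show ?thesis
  proof (rule antisym)
    show "degree (form_poly f y) \<le> degree f"
      by (rule degree_le) (simp add: coeff_form_poly coeff_eq_0)
    show "degree f \<le> degree (form_poly f y)"
      by (rule le_degree) (use False in \<open>simp add: coeff_form_poly\<close>)
  qed
qed (simp add: form_poly_def)

lemma form_val_cong:
  assumes "[y * y' = 1] (mod n)"
  shows "[form_val f a y * y' ^ degree f = poly f (a * y')] (mod n)"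
proof -
  have "form_val f a y * y' ^ degree f = (\<Sum>i\<le>degree f. coeff f i * (a * y') ^ i * (y * y') ^ (degree f - i))"
    unfolding form_val_def sum_distrib_right
  proof (rule sum.cong)
    fix i assume "i \<in> {..degree f}"
    then have "y' ^ degree f = y' ^ i * y' ^ (degree f - i)"
      by (simp flip: power_add)
    then show "coeff f i * a ^ i * y ^ (degree f - i) * y' ^ degree f =
      coeff f i * (a * y') ^ i * (y * y') ^ (degree f - i)"
      by (simp add: power_mult_distrib mult_ac)
  qed simp
  also have "[\<dots> = (\<Sum>i\<le>degree f. coeff f i * (a * y') ^ i * 1 ^ (degree f - i))] (mod n)"
    by (intro cong_sum cong_mult cong_pow assms cong_refl)
  finally show ?thesis by (simp add: poly_altdef)
qed

lemma form_val_dvd_imp_root: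
  assumes "n dvd form_val f a y" "coprime y n"
  obtains y' where "[y * y' = 1] (mod n)" "n dvd poly f (a * y')"
proof -
  obtain y' where y: "[y * y' = 1] (mod n)"
    using assms(2) cong_solve_coprime_int by blast
  moreover have "n dvd poly f (a * y')"
    using form_val_cong[OF y, of f a] assms(1) by (meson cong_dvd_iff dvd_mult2)
  ultimately show thesis using that by blast
qed

text \<open>For \<open>y\<close> invertible modulo p^2, a / y is a root of \<open>f\<close> modulo
  p^2. The set \<open>R\<close> does not depend on \<open>y\<close>, so for each \<open>r\<close>
  the pairs lie in one fixed lattice; the determinant argument for large primes uses this.\<close>

lemma form_val_square_class:
  assumes "prime p" "\<not> p dvd y" "\<And>x. p\<^sup>2 dvd poly f x \<Longrightarrow> \<exists>r\<in>R. p\<^sup>2 dvd x - r"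
    "p\<^sup>2 dvd form_val f a y"
  shows "\<exists>r\<in>R. p\<^sup>2 dvd a - r * y"
proof -
  have "coprime y (p\<^sup>2)"
    using assms(1,2) by (simp add: prime_imp_coprime coprime_commute)
  then obtain y' where y: "[y * y' = 1] (mod p\<^sup>2)" "p\<^sup>2 dvd poly f (a * y')"
    using form_val_dvd_imp_root assms(4) by blast
  then obtain r where r: "r \<in> R" "p\<^sup>2 dvd a * y' - r"
    using assms(3) by blast
  have "p\<^sup>2 dvd (a * y' - r) * y" "p\<^sup>2 dvd (y * y' - 1) * a"
    using r y(1) by (auto simp: cong_iff_dvd_diff)
  then have "p\<^sup>2 dvd (a * y' - r) * y - (y * y' - 1) * a"
    by (rule dvd_diff)
  then have "p\<^sup>2 dvd a - r * y" by (simp add: algebra_simps)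
  with r show ?thesis by blast
qed

section \<open>Zero coordinates, common divisors, squares of medium primes, small values\<close>

lemma negligible_pairs_zero:
  assumes "m \<ge> 1"
  shows "negligible_pairs m (\<lambda>B a b. a = 0 \<or> b = 0)"
proof (rule negligible_pairsI)
  show "(\<lambda>B::real. 6 / B) \<in> O(\<lambda>B. 1 / sqrt (ln B))" by real_asymp
  show "\<forall>\<^sub>F B in at_top. real (card {(a, b) \<in> form_box m B. a = 0 \<or> b = 0}) \<le> B ^ (m + 1) * (6 / B)"
    using eventually_ge_at_top[of 1]
  proof eventually_elim
    case (elim B)
    have Bm: "B \<le> B ^ m" using power_increasing[of 1 m B] assms elim by simp
    let ?X = "\<lambda>A. {a::int. \<bar>real_of_int a\<bar> \<le> A}"
    have "{(a, b) \<in> form_box m B. a = 0 \<or> b = 0} \<subseteq> Pair 0 ` ?X B \<union> (\<lambda>a. (a, 0)) ` ?X (B ^ m)"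
      by (auto simp: form_box_def)
    then have "card {(a, b) \<in> form_box m B. a = 0 \<or> b = 0} \<le> card (Pair 0 ` ?X B \<union> (\<lambda>a. (a, 0)) ` ?X (B ^ m) :: (int \<times> int) set)"
      using card_abs_le(1)[of B] card_abs_le(1)[of "B ^ m"] elim by (intro card_mono) auto
    also have "\<dots> \<le> card (Pair (0::int) ` ?X B) + card ((\<lambda>a. (a, 0::int)) ` ?X (B ^ m))"
      by (rule card_Un_le)
    also have "\<dots> \<le> card (?X B) + card (?X (B ^ m))"
      using card_abs_le(1)[of B] card_abs_le(1)[of "B ^ m"] elim
      by (intro add_mono card_image_le) auto
    also have "real \<dots> \<le> 6 * B ^ m"
      using card_abs_le(2)[of B] card_abs_le(2)[of "B ^ m"] elim Bm by simp
    finally show ?case using elim by (simp add: field_simps)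
  qed
qed

text \<open>Leaving out 0 removes the additive 1 from the count of a residue class; summed over all
  moduli up to \<open>B\<close>, that term would be too large.\<close>

lemma card_nonzero_multiples_le:
  fixes A :: real and n :: int
  assumes "A \<ge> 0" "n > 0"
  shows "card {x::int. x \<noteq> 0 \<and> \<bar>real_of_int x\<bar> \<le> A \<and> n dvd x} \<le> 2 * A / n"
proof -
  have e: "{x::int. \<bar>real_of_int x\<bar> \<le> A \<and> n dvd x - 0} =
    insert 0 {x::int. x \<noteq> 0 \<and> \<bar>real_of_int x\<bar> \<le> A \<and> n dvd x}"
    using assms by auto
  have "finite {x::int. x \<noteq> 0 \<and> \<bar>real_of_int x\<bar> \<le> A \<and> n dvd x}"
    using card_residue_class_le(1)[OF assms, of 0] unfolding e by simp
  then show ?thesis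
    using card_residue_class_le(2)[OF assms, of 0] unfolding e by simp
qed

text \<open>At most 4 B^(m+1) / n^2 pairs with nonzero coordinates are divisible by
  \<open>n\<close>, and the sum over n > t is O(1 / t). The threshold is left open, as both
  \<open>sqrt (ln B)\<close> and a power of \<open>B\<close> occur; divisors need not be prime, as
  one application takes \<open>n = gcd a b\<close>.\<close>

lemma negligible_pairs_common_divisor:
  assumes "(\<lambda>B. 1 / t B) \<in> O(\<lambda>B. 1 / sqrt (ln B))" "\<forall>\<^sub>F B in at_top. t B \<ge> 1"
  shows "negligible_pairs m (\<lambda>B a b. a \<noteq> 0 \<and> b \<noteq> 0 \<and> (\<exists>n. real_of_int n > t B \<and> n dvd a \<and> n dvd b))"
proof (rule negligible_pairsI)
  show "(\<lambda>B::real. 8 * (1 / t B)) \<in> O(\<lambda>B. 1 / sqrt (ln B))"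
    using assms(1) by (subst landau_o.big.cmult_in_iff) auto
  show "\<forall>\<^sub>F B in at_top. real (card {(a, b) \<in> form_box m B.
      a \<noteq> 0 \<and> b \<noteq> 0 \<and> (\<exists>n. real_of_int n > t B \<and> n dvd a \<and> n dvd b)}) \<le> B ^ (m + 1) * (8 * (1 / t B))"
    using assms(2) eventually_ge_at_top[of 1]
  proof eventually_elim
    case (elim B)
    define S where "S = {n::int. real_of_int n > t B \<and> real_of_int n \<le> B}"
    have finS: "finite S"
      by (rule finite_subset[of _ "{0..\<lfloor>B\<rfloor>}"]) (use elim in \<open>auto simp: S_def le_floor_iff\<close>)
    let ?X = "\<lambda>A n. {x::int. x \<noteq> 0 \<and> \<bar>real_of_int x\<bar> \<le> A \<and> n dvd x}"
    have finX: "finite (?X A n)" if "A \<ge> 0" for A n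
      by (rule finite_subset[OF _ card_abs_le(1)[OF that]]) auto
    let ?L = "{(a, b) \<in> form_box m B. a \<noteq> 0 \<and> b \<noteq> 0 \<and> (\<exists>n. real_of_int n > t B \<and> n dvd a \<and> n dvd b)}"
    have "?L \<subseteq> (\<Union>n\<in>S. ?X (B ^ m) n \<times> ?X B n)"
    proof safe
      fix a b n :: int assume *: "(a, b) \<in> form_box m B" "a \<noteq> 0" "b \<noteq> 0" "real_of_int n > t B" "n dvd a" "n dvd b"
      then have "\<bar>n\<bar> \<le> \<bar>b\<bar>" by (intro dvd_imp_le_int) auto
      then have "n \<in> S" using * by (auto simp: S_def form_box_def)
      then show "(a, b) \<in> (\<Union>n\<in>S. ?X (B ^ m) n \<times> ?X B n)"
        using * by (auto simp: form_box_def)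
    qed
    then have "card ?L \<le> card (\<Union>n\<in>S. ?X (B ^ m) n \<times> ?X B n)"
      using finS finX elim by (intro card_mono) auto
    also have "\<dots> \<le> (\<Sum>n\<in>S. card (?X (B ^ m) n \<times> ?X B n))"
      by (rule card_UN_le[OF finS])
    also have "real \<dots> \<le> (\<Sum>n\<in>S. (2 * B ^ m / n) * (2 * B / n))"
      unfolding of_nat_sum card_cartesian_product of_nat_mult
    proof (rule sum_mono)
      fix n assume "n \<in> S"
      then have "real_of_int n > 0" using elim by (auto simp: S_def)
      then have "n > 0" by simp
      then show "real (card (?X (B ^ m) n)) * real (card (?X B n)) \<le> (2 * B ^ m / n) * (2 * B / n)"
        using elim by (intro mult_mono card_nonzero_multiples_le) auto
    qed
    also have "\<dots> = 4 * B ^ (m + 1) * (\<Sum>n\<in>S. 1 / (real_of_int n)\<^sup>2)"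
      by (simp add: sum_distrib_left power2_eq_square mult_ac)
    also have "\<dots> \<le> 4 * B ^ (m + 1) * (2 / t B)"
      using elim finS by (intro mult_left_mono sum_inverse_squares_tail_le) (auto simp: S_def)
    finally show ?case by (simp add: mult_ac)
  qed
qed

text \<open>For fixed \<open>b\<close> and \<open>p\<close> at most k (2 A / p^2 + 1) values of
  \<open>a\<close> remain, where A = B^m. The first term sums to O(A / z) over p > z. The second
  counts the primes up to c A, which is O(A / ln B) by Chebyshev; this term prevents a range beyond
  multiples of \<open>A\<close>.\<close>

lemma negligible_pairs_square_divisor:
  fixes f U V :: "int poly"
  assumes "f \<noteq> 0" "U * f + V * pderiv f = [:D:]" "D \<noteq> 0" "m \<ge> 1" "c \<ge> 1"
  shows "negligible_pairs m (\<lambda>B a b. \<exists>p. prime p \<and> real_of_int p > sqrt (ln B) \<and>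
    real_of_int p \<le> c * B ^ m \<and> p\<^sup>2 dvd form_val f a (b ^ m) \<and> \<not> p dvd b)"
proof (rule negligible_pairsI)
  define k where "k = degree f"
  \<comment> \<open>The factor 3 comes from 2 B + 1 \<le> 3 B, the term with 4 from twice the tail
    bound 2 / z, and the rest is the prime count at c A divided by \<open>A\<close>.\<close>
  define g where "g B = 3 * k * (4 / sqrt (ln B) + c * (1 / sqrt B + 2 * ln 4 / ln B))" for B :: real
  show "g \<in> O(\<lambda>B. 1 / sqrt (ln B))"
    unfolding g_def by real_asymp
  have z: "filterlim (\<lambda>B::real. sqrt (ln B)) at_top at_top" by real_asymp
  \<comment> \<open>From here on a prime above \<open>z\<close> divides neither the leading
    coefficient nor \<open>D\<close>.\<close>
  have "\<forall>\<^sub>F B::real in at_top. sqrt (ln B) \<ge> max 1 (max \<bar>lead_coeff f\<bar> \<bar>D\<bar>)"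
    using z unfolding filterlim_at_top by blast
  then show "\<forall>\<^sub>F B in at_top. real (card {(a, b) \<in> form_box m B. \<exists>p. prime p \<and> real_of_int p > sqrt (ln B) \<and>
    real_of_int p \<le> c * B ^ m \<and> p\<^sup>2 dvd form_val f a (b ^ m) \<and> \<not> p dvd b}) \<le> B ^ (m + 1) * g B"
    using eventually_gt_at_top[of 1]
  proof eventually_elim
    case (elim B)
    define z where "z = sqrt (ln B)"
    have z: "z \<ge> 1" "\<bar>lead_coeff f\<bar> \<le> z" "\<bar>D\<bar> \<le> z" using elim(1) unfolding z_def by linarith+
    define S where "S = {p \<in> primes_upto (c * B ^ m). real_of_int p > z}"
    have finS: "finite S" unfolding S_def by simp
    have Bm: "B \<le> B ^ m" using power_increasing[of 1 m B] assms elim by simp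
    have Q: "card {a. \<bar>real_of_int a\<bar> \<le> B ^ m \<and> (p\<^sup>2 dvd form_val f a (b ^ m) \<and> \<not> p dvd b)} \<le> k * (2 * B ^ m / real_of_int (p\<^sup>2) + 1)"
      if p: "p \<in> S" for p b
    proof -
      have pp: "prime p" "real_of_int p > z" using p by (auto simp: S_def primes_upto_def)
      have nd: "\<not> p dvd x" if "x \<noteq> 0" "\<bar>real_of_int x\<bar> \<le> z" for x
      proof
        assume "p dvd x"
        then have "\<bar>p\<bar> \<le> \<bar>x\<bar>" using that by (intro dvd_imp_le_int) auto
        then show False using that pp by linarith
      qed
      have "\<not> p dvd lead_coeff f" "\<not> p dvd D"
        using nd[of "lead_coeff f"] nd[of D] z assms(1,3) by auto
      then obtain R where R: "finite R" "card R \<le> k" "\<And>x. p\<^sup>2 dvd poly f x \<Longrightarrow> \<exists>y\<in>R. p\<^sup>2 dvd x - y"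
        using prime_square_roots_cover[OF pp(1) _ assms(2)] unfolding k_def by blast
      show ?thesis
      proof (rule card_residue_cover_le[where R = "(\<lambda>r. r * b ^ m) ` R"])
        show "card ((\<lambda>r. r * b ^ m) ` R) \<le> k"
          using R card_image_le le_trans by blast
        fix a assume a: "p\<^sup>2 dvd form_val f a (b ^ m) \<and> \<not> p dvd b"
        then have "\<not> p dvd b ^ m" using pp(1) prime_dvd_power by blast
        then show "\<exists>y\<in>(\<lambda>r. r * b ^ m) ` R. p\<^sup>2 dvd a - y"
          using form_val_square_class[OF pp(1) _ R(3)] a by blast
      qed (use R(1) elim(2) prime_gt_0_int[OF pp(1)] in simp_all)
    qed
    have sumS: "(\<Sum>p\<in>S. k * (2 * B ^ m / real_of_int (p\<^sup>2) + 1)) \<le> B ^ m * g B / 3"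
    proof -
      have "(\<Sum>p\<in>S. k * (2 * B ^ m / real_of_int (p\<^sup>2) + 1)) = k * (2 * B ^ m * (\<Sum>p\<in>S. 1 / (real_of_int p)\<^sup>2) + card S)"
        by (simp add: sum_distrib_left sum.distrib algebra_simps)
      also have "\<dots> \<le> k * (2 * B ^ m * (2 / z) + B ^ m * (c * (1 / sqrt B + 2 * ln 4 / ln B)))"
      proof (intro mult_left_mono add_mono)
        show "(\<Sum>p\<in>S. 1 / (real_of_int p)\<^sup>2) \<le> 2 / z"
          using z finS by (intro sum_inverse_squares_tail_le) (auto simp: S_def)
        define y where "y = c * B ^ m"
        have y: "y \<ge> B" "y \<ge> 0" using Bm assms(5) elim mult_mono[of 1 c B "B ^ m"] by (auto simp: y_def)
        have "card S \<le> card (primes_upto y)"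
          by (intro card_mono) (auto simp: S_def y_def)
        also have "\<dots> \<le> sqrt y + 2 * ln 4 * y / ln y"
          using y elim by (intro card_primes_upto_le_log) auto
        also have "\<dots> = y * (1 / sqrt y + 2 * ln 4 / ln y)"
          using y(2) by (simp add: distrib_left real_div_sqrt mult_ac)
        also have "\<dots> \<le> y * (1 / sqrt B + 2 * ln 4 / ln B)"
          using y elim by (intro mult_left_mono add_mono divide_left_mono) auto
        finally show "real (card S) \<le> B ^ m * (c * (1 / sqrt B + 2 * ln 4 / ln B))"
          by (simp add: y_def mult_ac)
      qed (use elim(2) in simp_all)
      also have "\<dots> = B ^ m * g B / 3"
        by (simp add: g_def z_def algebra_simps)
      finally show ?thesis .
    qed
    have "card {(a, b) \<in> form_box m B. \<exists>p\<in>S. p\<^sup>2 dvd form_val f a (b ^ m) \<and> \<not> p dvd b} \<le> (2 * B + 1) * (B ^ m * g B / 3)"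
    proof (rule card_pairs_le)
      fix b :: int
      have "{a. \<bar>real_of_int a\<bar> \<le> B ^ m \<and> (\<exists>p\<in>S. p\<^sup>2 dvd form_val f a (b ^ m) \<and> \<not> p dvd b)} =
        (\<Union>p\<in>S. {a. \<bar>real_of_int a\<bar> \<le> B ^ m \<and> (p\<^sup>2 dvd form_val f a (b ^ m) \<and> \<not> p dvd b)})" by auto
      also have "card \<dots> \<le> (\<Sum>p\<in>S. card {a. \<bar>real_of_int a\<bar> \<le> B ^ m \<and> (p\<^sup>2 dvd form_val f a (b ^ m) \<and> \<not> p dvd b)})"
        by (rule card_UN_le[OF finS])
      also have "real \<dots> \<le> (\<Sum>p\<in>S. k * (2 * B ^ m / real_of_int (p\<^sup>2) + 1))"
        unfolding of_nat_sum by (rule sum_mono) (rule Q)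
      also note sumS
      finally show "card {a. \<bar>real_of_int a\<bar> \<le> B ^ m \<and> (\<exists>p\<in>S. p\<^sup>2 dvd form_val f a (b ^ m) \<and> \<not> p dvd b)} \<le> B ^ m * g B / 3"
        by simp
    qed (use elim(2) in simp)
    also have "\<dots> \<le> (3 * B) * (B ^ m * g B / 3)"
    proof (rule mult_right_mono)
      show "0 \<le> B ^ m * g B / 3"
        using elim(2) assms(5) by (simp add: g_def)
    qed (use elim(2) in simp)
    also have "{(a, b) \<in> form_box m B. \<exists>p\<in>S. p\<^sup>2 dvd form_val f a (b ^ m) \<and> \<not> p dvd b} =
      {(a, b) \<in> form_box m B. \<exists>p. prime p \<and> real_of_int p > sqrt (ln B) \<and>
    real_of_int p \<le> c * B ^ m \<and> p\<^sup>2 dvd form_val f a (b ^ m) \<and> \<not> p dvd b}"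
      by (auto simp: S_def z_def primes_upto_def)
    finally show ?case by (simp add: mult_ac)
  qed
qed

text \<open>For fixed \<open>b\<close> the value is a polynomial in \<open>a\<close> of degree
  \<open>k\<close> with fixed leading coefficient, so it is small only for O(A B^(-\<epsilon>/k) +
  1) integers \<open>a\<close>.\<close>

lemma negligible_pairs_small_value:
  fixes f :: "int poly"
  assumes "degree f \<ge> 1" "m \<ge> 1" "\<epsilon> > 0"
  shows "negligible_pairs m (\<lambda>B a b. \<bar>real_of_int (form_val f a (b ^ m))\<bar> \<le> B powr (real (m * degree f) - \<epsilon>))"
proof (rule negligible_pairsI)
  define k where "k = degree f"
  define g where "g B = 3 * k * (6 * B powr (-(\<epsilon> / k)) + 1 / B)" for B :: real
  have k: "k > 0" using assms by (simp add: k_def)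
  have "(\<lambda>B::real. 6 * B powr (-e) + 1 / B) \<in> O(\<lambda>B. 1 / sqrt (ln B))" if "e > 0" for e :: real
  proof (intro sum_in_bigo)
    show "(\<lambda>B::real. 6 * B powr (-e)) \<in> O(\<lambda>B. 1 / sqrt (ln B))"
      using that by real_asymp
    show "(\<lambda>B::real. 1 / B) \<in> O(\<lambda>B. 1 / sqrt (ln B))"
      by real_asymp
  qed
  from this[of "\<epsilon> / k"] show "g \<in> O(\<lambda>B. 1 / sqrt (ln B))"
    unfolding g_def using assms k by (subst landau_o.big.cmult_in_iff) auto
  show "\<forall>\<^sub>F B in at_top. real (card {(a, b) \<in> form_box m B.
      \<bar>real_of_int (form_val f a (b ^ m))\<bar> \<le> B powr (real (m * degree f) - \<epsilon>)}) \<le> B ^ (m + 1) * g B"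
    using eventually_gt_at_top[of 1]
  proof eventually_elim
    case (elim B)
    have Bm: "B \<le> B ^ m" using power_increasing[of 1 m B] assms elim by simp
    \<comment> \<open>The factor 3 gives s^k = 3^k T for the threshold \<open>T\<close> on the
      value, strictly more than the 2^k T required by the count of small values.\<close>
    define s where "s = 3 * (B ^ m * B powr (-(\<epsilon> / k)))"
    have s: "s > 0" using elim by (simp add: s_def)
    have sk: "s ^ k = 3 ^ k * B powr (m * k - \<epsilon>)"
      using k elim by (simp add: s_def power_mult_distrib powr_realpow[symmetric] powr_powr powr_diff powr_minus field_simps)
    have f0: "f \<noteq> 0" using assms by auto
    have cnt: "card {a. \<bar>real_of_int (form_val f a (b ^ m))\<bar> \<le> B powr (real (m * degree f) - \<epsilon>)} \<le> k * (2 * s + 1) \<and>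
        finite {a. \<bar>real_of_int (form_val f a (b ^ m))\<bar> \<le> B powr (real (m * degree f) - \<epsilon>)}" for b
    proof -
      have "2 ^ k * B powr (real (m * k) - \<epsilon>) < 1 * s ^ k"
        unfolding sk using k elim by (simp add: power_strict_mono)
      also have "\<dots> \<le> \<bar>lead_coeff f\<bar> * s ^ k"
      proof (rule mult_right_mono)
        have "\<bar>lead_coeff f\<bar> \<ge> 1" using f0 by (simp add: int_one_le_iff_zero_less)
        then show "1 \<le> real_of_int \<bar>lead_coeff f\<bar>" by linarith
      qed (use s in simp)
      finally show ?thesis
        using card_small_values_le[of "form_poly f (b ^ m)" "B powr (real (m * k) - \<epsilon>)" s] s
        by (simp add: poly_form_poly k_def coeff_form_poly)
    qed
    have "card {(a, b) \<in> form_box m B. \<bar>real_of_int (form_val f a (b ^ m))\<bar> \<le> B powr (real (m * degree f) - \<epsilon>)} \<le>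
        (2 * B + 1) * (k * (2 * s + 1))"
    proof (rule card_pairs_le)
      fix b :: int
      have "card {a. \<bar>real_of_int a\<bar> \<le> B ^ m \<and> \<bar>real_of_int (form_val f a (b ^ m))\<bar> \<le> B powr (real (m * degree f) - \<epsilon>)} \<le>
        card {a. \<bar>real_of_int (form_val f a (b ^ m))\<bar> \<le> B powr (real (m * degree f) - \<epsilon>)}"
        using cnt[of b] by (intro card_mono) auto
      then show "card {a. \<bar>real_of_int a\<bar> \<le> B ^ m \<and> \<bar>real_of_int (form_val f a (b ^ m))\<bar> \<le> B powr (real (m * degree f) - \<epsilon>)} \<le> k * (2 * s + 1)"
        using cnt[of b] by linarith
    qed (use elim in simp)
    also have "\<dots> \<le> (3 * B) * (k * (2 * s + B ^ m / B))"
    proof (intro mult_mono)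
      have "B / B \<le> B ^ m / B" using Bm elim by (intro divide_right_mono) auto
      then show "2 * s + 1 \<le> 2 * s + B ^ m / B" using elim by simp
    qed (use elim s in simp_all)
    also have "\<dots> = B ^ (m + 1) * g B"
      by (simp add: g_def s_def algebra_simps)
    finally show ?case .
  qed
qed

section \<open>The radical of the value of an irreducible form\<close>

text \<open>For \<open>n = 0\<close> the product is empty and equals 1, so pairs at which a factor
  vanishes fall below every threshold \<open>B powr \<tau>\<close> with \<tau> > 0 and B > 1 without
  being treated separately.\<close>

definition large_rad :: "real \<Rightarrow> int \<Rightarrow> int" where
  "large_rad y n = \<Prod>{p \<in> prime_factors n. real_of_int p > y}"

definition smooth_part :: "real \<Rightarrow> int \<Rightarrow> int" where
  "smooth_part y n = (\<Prod>p\<in>{p \<in> prime_factors n. real_of_int p \<le> y}. p ^ multiplicity p n)"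

lemma large_rad_pos: "large_rad y n > 0"
  unfolding large_rad_def by (intro prod_pos) (auto dest: in_prime_factors_imp_prime prime_gt_0_int)

lemma prime_le_large_rad:
  assumes "p \<in> prime_factors n" "real_of_int p > y"
  shows "p \<le> large_rad y n"
proof (rule zdvd_imp_le)
  show "p dvd large_rad y n"
    unfolding large_rad_def using assms by (intro dvd_prodI[of _ _ "\<lambda>p. p", simplified]) auto
qed (rule large_rad_pos)

lemma smooth_part_mult_large_rad:
  assumes "n \<noteq> 0" "\<And>p. prime p \<Longrightarrow> real_of_int p > y \<Longrightarrow> \<not> p\<^sup>2 dvd n"
  shows "smooth_part y n * large_rad y n = \<bar>n\<bar>"
proof -
  have "large_rad y n = (\<Prod>p\<in>{p \<in> prime_factors n. real_of_int p > y}. p ^ multiplicity p n)"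
    unfolding large_rad_def
  proof (rule prod.cong)
    fix p assume p: "p \<in> {p \<in> prime_factors n. real_of_int p > y}"
    have "multiplicity p n \<ge> 1"
      using p assms(1) by (simp add: prime_factors_multiplicity)
    moreover have "\<not> multiplicity p n \<ge> 2"
      using assms(2)[of p] p multiplicity_dvd'[of 2 p n] by (auto dest: in_prime_factors_imp_prime)
    ultimately have "multiplicity p n = 1" by linarith
    then show "p = p ^ multiplicity p n" by simp
  qed simp
  then have "smooth_part y n * large_rad y n = (\<Prod>p\<in>{p \<in> prime_factors n. real_of_int p \<le> y} \<union> {p \<in> prime_factors n. real_of_int p > y}. p ^ multiplicity p n)"
    unfolding smooth_part_def by (simp only:) (rule prod.union_disjoint[symmetric], auto)
  also have "{p \<in> prime_factors n. real_of_int p \<le> y} \<union> {p \<in> prime_factors n. real_of_int p > y} = prime_factors n"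
    by auto
  also have "(\<Prod>p\<in>prime_factors n. p ^ multiplicity p n) = \<bar>n\<bar>"
    using prod_prime_factors[OF assms(1)] by simp
  finally show ?thesis .
qed

lemma smooth_part_le:
  fixes M y :: real
  assumes "M \<ge> 1" "y \<ge> 0" "\<And>p. p \<in> prime_factors n \<Longrightarrow> real_of_int p \<le> y \<Longrightarrow> real_of_int p ^ multiplicity p n \<le> M"
  shows "smooth_part y n \<le> M powr y"
proof -
  let ?S = "{p \<in> prime_factors n. real_of_int p \<le> y}"
  have sub: "?S \<subseteq> primes_upto y" by (auto simp: primes_upto_def)
  have "real_of_int (smooth_part y n) = (\<Prod>p\<in>?S. real_of_int p ^ multiplicity p n)"
    by (simp add: smooth_part_def)
  also have "\<dots> \<le> (\<Prod>p\<in>?S. M)"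
    using assms(3) by (intro prod_mono) (auto dest!: in_prime_factors_imp_prime prime_ge_0_int)
  also have "\<dots> = M powr card ?S" using assms(1) by (simp add: powr_realpow)
  also have "\<dots> \<le> M powr y"
  proof (rule powr_mono)
    have "card ?S \<le> card (primes_upto y)" using sub by (rule card_mono[rotated]) simp
    then show "card ?S \<le> y" using card_primes_upto_le[OF assms(2)] by linarith
  qed (rule assms)
  finally show ?thesis .
qed

section \<open>Values with a large smooth part\<close>

lemma ex_power_between:
  fixes x Q :: real
  assumes "x > 1" "Q \<ge> 1"
  shows "\<exists>s. x ^ s \<le> Q \<and> Q < x ^ Suc s"
proof -
  have ex: "\<exists>s. Q < x ^ Suc s"
    using real_arch_pow[OF assms(1), of Q] assms(1) by (metis less_trans power_strict_increasing lessI)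
  define s where "s = (LEAST s. Q < x ^ Suc s)"
  have "Q < x ^ Suc s" unfolding s_def using ex by (rule LeastI_ex)
  moreover have "x ^ s \<le> Q"
  proof (cases s)
    case 0
    then show ?thesis using assms(2) by simp
  next
    case (Suc t)
    then have "\<not> Q < x ^ Suc t"
      using not_less_Least[of t "\<lambda>s. Q < x ^ Suc s"] by (simp add: s_def)
    then show ?thesis using Suc by simp
  qed
  ultimately show ?thesis by blast
qed

text \<open>If the smooth part is too large, one of its prime power components is, and then p^(r + k
  s) divides the value, where \<open>s\<close> is the largest exponent with p^s \<le> Q. This
  confines \<open>a\<close> to at most \<open>k\<close> classes modulo p^(s+1) > Q. With Q = exp (e
  z) the proportion lost, summed over at most \<open>z\<close> primes, is of order z (1 / Q + 1 /
  B), far below 1 / z.\<close>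

lemma negligible_pairs_large_smooth_part:
  fixes f :: "int poly"
  assumes "degree f \<ge> 1" "m \<ge> 1" "\<epsilon> > 0"
  shows "negligible_pairs m (\<lambda>B a b. form_val f a (b ^ m) \<noteq> 0 \<and>
    real_of_int (smooth_part (sqrt (ln B)) (form_val f a (b ^ m))) > B powr \<epsilon>)"
proof (rule negligible_pairsI)
  define k where "k = degree f"
  have k: "k > 0" using assms by (simp add: k_def)
  \<comment> \<open>The factors Q^k of at most \<open>z\<close> primes multiply to exp (e k z^2),
    which is \<open>B powr (\<epsilon> / 2)\<close>; the other half of \<epsilon> is left for the
    factors z^r.\<close>
  define e where "e = \<epsilon> / (2 * k)"
  have e: "e > 0" using assms k by (simp add: e_def)
  \<comment> \<open>With this exponent p^r \<ge> 2^r > r = |lead_coeff f|, so no prime has its r-th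
    power dividing the leading coefficient.\<close>
  define r where "r = nat \<bar>lead_coeff f\<bar>"
  have f0: "f \<noteq> 0" using assms by auto
  have r: "r \<ge> 1" using f0 by (simp add: r_def Suc_le_eq)
  define g where "g B = 3 * k * (sqrt (ln B) * (2 * exp (- (e * sqrt (ln B))) + 1 / B))" for B :: real
  have "(\<lambda>B. sqrt (ln B) * (2 * exp (- (e * sqrt (ln B))) + 1 / B)) \<in> O(\<lambda>B. 1 / sqrt (ln B))"
    unfolding distrib_left
  proof (intro sum_in_bigo)
    show "(\<lambda>B. sqrt (ln B) * (2 * exp (- (e * sqrt (ln B))))) \<in> O(\<lambda>B. 1 / sqrt (ln B))"
      using e by real_asymp
    show "(\<lambda>B. sqrt (ln B) * (1 / B)) \<in> O(\<lambda>B. 1 / sqrt (ln B))" by real_asymp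
  qed
  then show "g \<in> O(\<lambda>B. 1 / sqrt (ln B))"
    unfolding g_def using k by (subst landau_o.big.cmult_in_iff) auto
  have zlim: "filterlim (\<lambda>B::real. sqrt (ln B)) at_top at_top" by real_asymp
  have "\<forall>\<^sub>F z::real in at_top. x * ln z \<le> \<epsilon> / 2 * z" if "x > 0" for x
    using that assms(3) by real_asymp
  from this[of r] have "\<forall>\<^sub>F z::real in at_top. r * ln z \<le> \<epsilon> / 2 * z" using r by simp
  from eventually_compose_filterlim[OF this zlim]
  have ev1: "\<forall>\<^sub>F B in at_top. r * ln (sqrt (ln B)) \<le> \<epsilon> / 2 * sqrt (ln B)" .
  have ev2: "\<forall>\<^sub>F B::real in at_top. sqrt (ln B) \<ge> 1" by real_asymp
  show "\<forall>\<^sub>F B in at_top. real (card {(a, b) \<in> form_box m B. form_val f a (b ^ m) \<noteq> 0 \<and>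
    real_of_int (smooth_part (sqrt (ln B)) (form_val f a (b ^ m))) > B powr \<epsilon>}) \<le> B ^ (m + 1) * g B"
    using ev1 ev2 eventually_gt_at_top[of 1]
  proof eventually_elim
    case (elim B)
    define z where "z = sqrt (ln B)"
    have z1: "z \<ge> 1" using elim by (simp add: z_def)
    have Bm: "B \<le> B ^ m" using power_increasing[of 1 m B] assms elim by simp
    define Q where "Q = exp (e * z)"
    have Q1: "Q \<ge> 1" using e z1 by (simp add: Q_def)
    \<comment> \<open>If no \<open>p ^ (r + k * s p)\<close> with \<open>p \<le> z\<close> divides a value, each of its at most \<open>z\<close> prime power
      components below \<open>z\<close> is at most \<open>M = z ^ r * Q ^ k\<close>, and \<open>M powr z \<le> B powr \<epsilon>\<close>.\<close>
    define s where "s p = (SOME s. real_of_int p ^ s \<le> Q \<and> Q < real_of_int p ^ Suc s)" for p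
    have s: "real_of_int p ^ s p \<le> Q" "Q < real_of_int p ^ Suc (s p)" if "prime p" for p
    proof -
      have "real_of_int p > 1" using that prime_gt_1_int by auto
      from ex_power_between[OF this Q1]
      show "real_of_int p ^ s p \<le> Q" "Q < real_of_int p ^ Suc (s p)"
        unfolding s_def by (metis (mono_tags, lifting) someI_ex)+
    qed
    define M where "M = z ^ r * Q ^ k"
    have M1: "M \<ge> 1" using z1 Q1 mult_mono[of 1 "z ^ r" 1 "Q ^ k"] by (simp add: M_def)
    have Mz: "M powr z \<le> B powr \<epsilon>"
    proof -
      have "ln M = r * ln z + k * (e * z)"
        using z1 by (simp add: M_def Q_def ln_mult ln_realpow)
      also have "k * (e * z) = \<epsilon> / 2 * z" using k by (simp add: e_def)
      finally have "ln M \<le> \<epsilon> * z" using elim(1) by (simp add: z_def)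
      then have "z * ln M \<le> z * (\<epsilon> * z)" using z1 by (intro mult_left_mono) auto
      also have "z * (\<epsilon> * z) = \<epsilon> * z\<^sup>2" by (simp add: power2_eq_square)
      also have "z\<^sup>2 = ln B" using elim by (simp add: z_def)
      finally show ?thesis using M1 elim by (simp add: powr_def)
    qed
    have imp: "\<exists>p\<in>primes_upto z. p ^ (r + k * s p) dvd n"
      if n: "n \<noteq> 0" "real_of_int (smooth_part z n) > B powr \<epsilon>" for n
    proof (rule ccontr)
      assume *: "\<not> ?thesis"
      have "smooth_part z n \<le> M powr z"
      proof (rule smooth_part_le)
        fix p assume p: "p \<in> prime_factors n" "real_of_int p \<le> z"
        then have pp: "prime p" by auto
        then have p1: "real_of_int p > 1" using prime_gt_1_int by auto
        have "\<not> p ^ (r + k * s p) dvd n" using * p pp by (auto simp: primes_upto_def)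
        then have "multiplicity p n \<le> r + k * s p"
          using multiplicity_dvd'[of "r + k * s p" p n] by linarith
        then have "real_of_int p ^ multiplicity p n \<le> real_of_int p ^ (r + k * s p)"
          using p1 by (intro power_increasing) auto
        also have "\<dots> = real_of_int p ^ r * (real_of_int p ^ s p) ^ k"
          by (simp add: power_add power_mult[symmetric] mult.commute)
        also have "\<dots> \<le> z ^ r * Q ^ k"
          using p p1 s(1)[OF pp] z1 by (intro mult_mono power_mono) auto
        finally show "real_of_int p ^ multiplicity p n \<le> M" by (simp add: M_def)
      qed (use M1 z1 in auto)
      with Mz n show False by linarith
    qed
    have cnt: "card {a. \<bar>real_of_int a\<bar> \<le> B ^ m \<and> p ^ (r + k * s p) dvd form_val f a (b ^ m)} \<le> k * (2 * B ^ m / Q + 1)"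
      if p: "prime p" for p b
    proof -
      have p1: "p > 1" using p by (rule prime_gt_1_int)
      have "\<not> p ^ r dvd lead_coeff f"
      proof
        assume "p ^ r dvd lead_coeff f"
        then have "p ^ r \<le> \<bar>lead_coeff f\<bar>"
          using f0 p1 dvd_imp_le_int[of "lead_coeff f" "p ^ r"] by simp
        moreover have "int r < 2 ^ r" by (simp add: of_nat_less_two_power)
        moreover have "(2::int) ^ r \<le> p ^ r" using p1 by (intro power_mono) auto
        ultimately show False by (simp add: r_def)
      qed
      then obtain R where R: "finite R" "card R \<le> k"
        "\<And>x. p ^ (r + k * s p) dvd form_val f x (b ^ m) \<Longrightarrow> \<exists>y\<in>R. p ^ Suc (s p) dvd x - y"
        using prime_power_roots_cover[OF p, of r "form_poly f (b ^ m)" "s p"]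
        by (simp add: poly_form_poly k_def coeff_form_poly) blast
      have "card {a. \<bar>real_of_int a\<bar> \<le> B ^ m \<and> p ^ (r + k * s p) dvd form_val f a (b ^ m)} \<le> k * (2 * B ^ m / real_of_int (p ^ Suc (s p)) + 1)"
        using elim p1 by (intro card_residue_cover_le[OF _ _ R]) auto
      also have "\<dots> \<le> k * (2 * B ^ m / Q + 1)"
      proof (intro mult_left_mono add_mono divide_left_mono)
        show "Q \<le> real_of_int (p ^ Suc (s p))" using s(2)[OF p] by simp
      qed (use elim Q1 p1 in auto)
      finally show ?thesis .
    qed
    have "{(a, b) \<in> form_box m B. form_val f a (b ^ m) \<noteq> 0 \<and> real_of_int (smooth_part z (form_val f a (b ^ m))) > B powr \<epsilon>}
      \<subseteq> {(a, b) \<in> form_box m B. \<exists>p\<in>primes_upto z. p ^ (r + k * s p) dvd form_val f a (b ^ m)}"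
      using imp by auto
    then have "card {(a, b) \<in> form_box m B. form_val f a (b ^ m) \<noteq> 0 \<and> real_of_int (smooth_part z (form_val f a (b ^ m))) > B powr \<epsilon>}
      \<le> card {(a, b) \<in> form_box m B. \<exists>p\<in>primes_upto z. p ^ (r + k * s p) dvd form_val f a (b ^ m)}"
      by (intro card_mono) auto
    also have "real \<dots> \<le> (2 * B + 1) * (z * (k * (2 * B ^ m / Q + 1)))"
    proof (rule card_pairs_le)
      fix b :: int
      have "{a. \<bar>real_of_int a\<bar> \<le> B ^ m \<and> (\<exists>p\<in>primes_upto z. p ^ (r + k * s p) dvd form_val f a (b ^ m))} =
        (\<Union>p\<in>primes_upto z. {a. \<bar>real_of_int a\<bar> \<le> B ^ m \<and> p ^ (r + k * s p) dvd form_val f a (b ^ m)})" by auto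
      also have "card \<dots> \<le> (\<Sum>p\<in>primes_upto z. card {a. \<bar>real_of_int a\<bar> \<le> B ^ m \<and> p ^ (r + k * s p) dvd form_val f a (b ^ m)})"
        by (rule card_UN_le) simp
      also have "real \<dots> \<le> (\<Sum>p\<in>primes_upto z. k * (2 * B ^ m / Q + 1))"
        unfolding of_nat_sum by (intro sum_mono cnt) (simp add: primes_upto_def)
      also have "\<dots> = card (primes_upto z) * (k * (2 * B ^ m / Q + 1))" by simp
      also have "\<dots> \<le> z * (k * (2 * B ^ m / Q + 1))"
        using z1 Q1 elim(3) by (intro mult_right_mono card_primes_upto_le) auto
      finally show "card {a. \<bar>real_of_int a\<bar> \<le> B ^ m \<and> (\<exists>p\<in>primes_upto z. p ^ (r + k * s p) dvd form_val f a (b ^ m))}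
        \<le> z * (k * (2 * B ^ m / Q + 1))" by simp
    qed (use elim in simp)
    also have "\<dots> \<le> (3 * B) * (z * (k * (2 * B ^ m / Q + B ^ m / B)))"
    proof (intro mult_mono)
      have "B / B \<le> B ^ m / B" using Bm elim(3) by (intro divide_right_mono) auto
      then show "2 * B ^ m / Q + 1 \<le> 2 * B ^ m / Q + B ^ m / B" using elim(3) by simp
    qed (use elim(3) z1 Q1 in simp_all)
    also have "\<dots> = B ^ (m + 1) * g B"
      by (simp add: g_def z_def Q_def algebra_simps exp_minus divide_inverse)
    finally show ?case by (simp add: z_def)
  qed
qed

text \<open>The points are integer multiples of one primitive vector. Normalizing it to have
  positive second coordinate, the multiplier of (a, b) is \<open>sgn b * gcd a b\<close>, so the map
  to the multiplier is injective with values in [-T, T].\<close>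

lemma card_collinear_le:
  fixes T :: real and X :: "(int \<times> int) set"
  assumes "\<And>a b a' b'. (a, b) \<in> X \<Longrightarrow> (a', b') \<in> X \<Longrightarrow> a * b' = a' * b"
    "\<And>a b. (a, b) \<in> X \<Longrightarrow> b \<noteq> 0 \<and> real_of_int (gcd a b) \<le> T" "T \<ge> 0"
  shows "card X \<le> 2 * T + 1"
proof -
  let ?h = "\<lambda>(a, b). sgn b * gcd a b :: int"
  have "inj_on ?h X"
  proof (rule inj_onI, clarify)
    fix a b a' b' assume *: "(a, b) \<in> X" "(a', b') \<in> X" "sgn b * gcd a b = sgn b' * gcd a' b'"
    have b: "b \<noteq> 0" "b' \<noteq> 0" using assms(2) * by auto
    have g: "gcd a b > 0" "gcd a' b' > 0" using b by auto
    have "gcd a b = gcd a' b'"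
      using arg_cong[OF *(3), of abs] b by (simp add: abs_mult abs_sgn_eq)
    then have sg: "sgn b = sgn b'" using *(3) g by auto
    have "\<bar>b'\<bar> * gcd a b = gcd (b' * a) (b' * b)" by (simp add: gcd_mult_distrib_int)
    also have "b' * a = b * a'" using assms(1)[OF *(1,2)] by (simp add: mult.commute)
    also have "gcd (b * a') (b' * b) = \<bar>b\<bar> * gcd a' b'" by (simp add: gcd_mult_distrib_int mult.commute)
    finally have "\<bar>b'\<bar> = \<bar>b\<bar>" using \<open>gcd a b = gcd a' b'\<close> g by auto
    then have "b = b'" using sg by (metis abs_sgn mult_sgn_abs)
    moreover from this have "a = a'" using assms(1)[OF *(1,2)] b by simp
    ultimately show "a = a' \<and> b = b'" by simp
  qed
  moreover have "?h ` X \<subseteq> {x. \<bar>real_of_int x\<bar> \<le> T}"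
  proof safe
    fix a b assume "(a, b) \<in> X"
    then have "b \<noteq> 0" "real_of_int (gcd a b) \<le> T" using assms(2) by auto
    moreover have "\<bar>sgn b * gcd a b\<bar> = gcd a b"
      using \<open>b \<noteq> 0\<close> by (simp add: abs_mult abs_sgn_eq)
    ultimately show "\<bar>real_of_int (sgn b * gcd a b)\<bar> \<le> T" by (metis of_int_abs)
  qed
  ultimately have "card X \<le> card {x::int. \<bar>real_of_int x\<bar> \<le> T}"
    using card_abs_le(1)[OF assms(3)] by (metis card_inj_on_le)
  then show ?thesis using card_abs_le(2)[OF assms(3)] by linarith
qed

text \<open>For \<open>m = 1\<close> the congruence a \<equiv> r b modulo p^2 is linear in the pair,
  so determinants can be used. With T = B^(\<eta>/2), pairs whose gcd exceeds \<open>T\<close> are a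
  proportion O(1 / T). The others number O(T) for each class, and the at most B^(2-\<eta>) primes,
  counted trivially, leave O(B^(2-\<eta>/2)) pairs.\<close>

lemma negligible_pairs_square_divisor_large:
  fixes f U V :: "int poly"
  assumes "f \<noteq> 0" "U * f + V * pderiv f = [:D:]" "D \<noteq> 0" "\<eta> > 0"
  shows "negligible_pairs 1 (\<lambda>B a b. a \<noteq> 0 \<and> b \<noteq> 0 \<and> (\<exists>p. prime p \<and> real_of_int p > 2 * B \<and>
    real_of_int p \<le> B powr (2 - \<eta>) \<and> p\<^sup>2 dvd form_val f a b))"
proof -
  define k where "k = degree f"
  define T where "T B = B powr (\<eta> / 2)" for B :: real
  let ?P = "\<lambda>B a b. a \<noteq> 0 \<and> b \<noteq> 0 \<and> (\<exists>n. real_of_int n > T B \<and> n dvd a \<and> n dvd b)"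
  let ?Q = "\<lambda>B a b. b \<noteq> 0 \<and> real_of_int (gcd a b) \<le> T B \<and> (\<exists>p. prime p \<and> real_of_int p > 2 * B \<and>
    real_of_int p \<le> B powr (2 - \<eta>) \<and> p\<^sup>2 dvd form_val f a b)"
  have T1: "\<forall>\<^sub>F B in at_top. T B \<ge> 1"
    using eventually_ge_at_top[of 1]
    by eventually_elim (use assms(4) in \<open>simp add: T_def ge_one_powr_ge_zero\<close>)
  have "negligible_pairs 1 ?P"
  proof (rule negligible_pairs_common_divisor[OF _ T1])
    have "(\<lambda>B::real. 1 / B powr e) \<in> O(\<lambda>B. 1 / sqrt (ln B))" if "e > 0" for e :: real
      using that by real_asymp
    from this[of "\<eta> / 2"] show "(\<lambda>B. 1 / T B) \<in> O(\<lambda>B. 1 / sqrt (ln B))"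
      using assms(4) by (simp add: T_def)
  qed
  moreover have "negligible_pairs 1 ?Q"
  proof (rule negligible_pairsI)
    define g where "g B = 3 * k * B powr (- (\<eta> / 2))" for B :: real
    have "(\<lambda>B::real. x * B powr (-e)) \<in> O(\<lambda>B. 1 / sqrt (ln B))" if "e > 0" for e x :: real
      using that by real_asymp
    from this[of "\<eta> / 2" "3 * k"] show "g \<in> O(\<lambda>B. 1 / sqrt (ln B))"
      using assms(4) by (simp add: g_def[abs_def])
    have ev: "\<forall>\<^sub>F B::real in at_top. B \<ge> max 1 (max \<bar>lead_coeff f\<bar> \<bar>D\<bar>)"
      by (rule eventually_ge_at_top)
    show "\<forall>\<^sub>F B in at_top. real (card {(a, b) \<in> form_box 1 B. ?Q B a b}) \<le> B ^ (1 + 1) * g B"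
      using ev T1
    proof eventually_elim
      case (elim B)
      have B: "B \<ge> 1" "\<bar>lead_coeff f\<bar> \<le> B" "\<bar>D\<bar> \<le> B" using elim(1) by linarith+
      define S where "S = {p \<in> primes_upto (B powr (2 - \<eta>)). real_of_int p > 2 * B}"
      have finS: "finite S" by (simp add: S_def)
      define X where "X p = {(a, b) \<in> form_box 1 B. b \<noteq> 0 \<and> real_of_int (gcd a b) \<le> T B \<and> p\<^sup>2 dvd form_val f a b}" for p
      have cX: "card (X p) \<le> k * (2 * T B + 1)" if p: "p \<in> S" for p
      proof -
        have pp: "prime p" "real_of_int p > 2 * B" using p by (auto simp: S_def primes_upto_def)
        have nd: "\<not> p dvd x" if "x \<noteq> 0" "\<bar>real_of_int x\<bar> \<le> B" for x
        proof
          assume "p dvd x"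
          then have "\<bar>p\<bar> \<le> \<bar>x\<bar>" using that by (intro dvd_imp_le_int) auto
          then show False using that pp B by linarith
        qed
        have "\<not> p dvd lead_coeff f" "\<not> p dvd D"
          using nd[of "lead_coeff f"] nd[of D] B assms(1,3) by auto
        then obtain R where R: "finite R" "card R \<le> k" "\<And>x. p\<^sup>2 dvd poly f x \<Longrightarrow> \<exists>y\<in>R. p\<^sup>2 dvd x - y"
          using prime_square_roots_cover[OF pp(1) _ assms(2)] unfolding k_def by blast
        define Y where "Y r = {(a, b) \<in> X p. p\<^sup>2 dvd a - r * b}" for r
        \<comment> \<open>\<open>p\<^sup>2\<close> divides the determinant \<open>a * b' - a' * b\<close> of two points of \<open>Y r\<close>, which is at most
          \<open>2 * B\<^sup>2 < p\<^sup>2\<close>; so the points are collinear.\<close>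
        have Y: "card (Y r) \<le> 2 * T B + 1" for r
        proof (rule card_collinear_le)
          fix a b a' b' assume *: "(a, b) \<in> Y r" "(a', b') \<in> Y r"
          then have bd: "\<bar>real_of_int a\<bar> \<le> B" "\<bar>real_of_int b\<bar> \<le> B" "\<bar>real_of_int a'\<bar> \<le> B" "\<bar>real_of_int b'\<bar> \<le> B"
            by (auto simp: Y_def X_def form_box_def)
          have "p\<^sup>2 dvd (a - r * b) * b' - (a' - r * b') * b"
            using * by (intro dvd_diff) (auto simp: Y_def)
          then have "p\<^sup>2 dvd a * b' - a' * b" by (simp add: algebra_simps)
          moreover have "\<bar>a * b' - a' * b\<bar> < p\<^sup>2"
          proof -
            have "\<bar>real_of_int (a * b' - a' * b)\<bar> \<le> \<bar>real_of_int a\<bar> * \<bar>real_of_int b'\<bar> + \<bar>real_of_int a'\<bar> * \<bar>real_of_int b\<bar>"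
              by (simp add: abs_mult[symmetric])
            also have "\<dots> \<le> B * B + B * B" using bd B by (intro add_mono mult_mono) auto
            also have "\<dots> < (2 * B) * (2 * B)" using B by simp
            also have "\<dots> \<le> real_of_int p * real_of_int p" using pp B by (intro mult_mono) auto
            finally have "real_of_int \<bar>a * b' - a' * b\<bar> < real_of_int (p\<^sup>2)"
              by (simp add: power2_eq_square)
            then show ?thesis by linarith
          qed
          ultimately show "a * b' = a' * b"
            using dvd_imp_le_int[of "a * b' - a' * b" "p\<^sup>2"] by fastforce
        qed (use elim(2) in \<open>auto simp: Y_def X_def\<close>)
        have finX: "finite (X p)"
          by (rule finite_subset[of _ "form_box 1 B"]) (auto simp: X_def)
        have "X p \<subseteq> (\<Union>r\<in>R. Y r)"
        proof safe
          fix a b assume ab: "(a, b) \<in> X p"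
          then have "b \<noteq> 0" "\<bar>real_of_int b\<bar> \<le> B" by (auto simp: X_def form_box_def)
          then have "\<not> p dvd b" by (rule nd)
          then have "\<exists>r\<in>R. p\<^sup>2 dvd a - r * b"
            using form_val_square_class[OF pp(1) _ R(3)] ab by (auto simp: X_def)
          then show "(a, b) \<in> (\<Union>r\<in>R. Y r)" using ab by (auto simp: Y_def)
        qed
        then have "card (X p) \<le> card (\<Union>r\<in>R. Y r)"
          using finX R(1) by (intro card_mono) (auto simp: Y_def intro: finite_subset[OF _ finX])
        also have "\<dots> \<le> (\<Sum>r\<in>R. card (Y r))" by (rule card_UN_le[OF R(1)])
        also have "real \<dots> \<le> (\<Sum>r\<in>R. 2 * T B + 1)"
          unfolding of_nat_sum by (intro sum_mono Y)
        also have "\<dots> \<le> k * (2 * T B + 1)"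
          using R(2) elim(2) by (simp add: mult_right_mono)
        finally show ?thesis by simp
      qed
      have "{(a, b) \<in> form_box 1 B. ?Q B a b} = (\<Union>p\<in>S. X p)"
        by (auto simp: S_def X_def primes_upto_def)
      then have "card {(a, b) \<in> form_box 1 B. ?Q B a b} \<le> (\<Sum>p\<in>S. card (X p))"
        by (simp only:) (rule card_UN_le[OF finS])
      also have "real \<dots> \<le> (\<Sum>p\<in>S. k * (2 * T B + 1))"
        unfolding of_nat_sum by (intro sum_mono cX)
      also have "\<dots> = card S * (k * (2 * T B + 1))" by simp
      also have "\<dots> \<le> B powr (2 - \<eta>) * (k * (3 * T B))"
      proof (intro mult_mono)
        have "card S \<le> card (primes_upto (B powr (2 - \<eta>)))"
          by (intro card_mono) (auto simp: S_def)
        then show "card S \<le> B powr (2 - \<eta>)"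
          using card_primes_upto_le[of "B powr (2 - \<eta>)"] by simp
      qed (use elim(2) in auto)
      also have "\<dots> = 3 * k * B powr (2 - \<eta> + \<eta> / 2)"
        unfolding powr_add T_def by simp
      also have "2 - \<eta> + \<eta> / 2 = 2 + - (\<eta> / 2)" by simp
      also have "3 * k * B powr (2 + - (\<eta> / 2)) = B ^ (1 + 1) * g B"
        using B(1) unfolding powr_add g_def by (simp add: power2_eq_square)
      finally show ?case by simp
    qed
  qed
  ultimately have "negligible_pairs 1 (\<lambda>B a b. ?P B a b \<or> ?Q B a b)"
    by (rule negligible_pairs_disj)
  then show ?thesis
  proof (rule negligible_pairs_mono, intro always_eventually allI impI)
    fix B :: real and a b :: int
    assume "a \<noteq> 0 \<and> b \<noteq> 0 \<and> (\<exists>p. prime p \<and> real_of_int p > 2 * B \<and>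
      real_of_int p \<le> B powr (2 - \<eta>) \<and> p\<^sup>2 dvd form_val f a b)"
    then show "?P B a b \<or> ?Q B a b"
      by (cases "real_of_int (gcd a b) \<le> T B") (auto intro!: exI[of _ "gcd a b"])
  qed
qed

lemma abs_form_val_le:
  fixes A :: real
  assumes "\<bar>real_of_int a\<bar> \<le> A" "\<bar>real_of_int y\<bar> \<le> A"
  shows "\<bar>real_of_int (form_val f a y)\<bar> \<le> (\<Sum>i\<le>degree f. \<bar>real_of_int (coeff f i)\<bar>) * A ^ degree f"
proof -
  have "\<bar>real_of_int (form_val f a y)\<bar> \<le> (\<Sum>i\<le>degree f. \<bar>real_of_int (coeff f i * a ^ i * y ^ (degree f - i))\<bar>)"
    unfolding form_val_def of_int_sum by (rule sum_abs)
  also have "\<dots> \<le> (\<Sum>i\<le>degree f. \<bar>real_of_int (coeff f i)\<bar> * A ^ degree f)"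
  proof (rule sum_mono)
    fix i assume i: "i \<in> {..degree f}"
    have "\<bar>real_of_int a\<bar> ^ i * \<bar>real_of_int y\<bar> ^ (degree f - i) \<le> A ^ i * A ^ (degree f - i)"
      using assms by (intro mult_mono power_mono) auto
    also have "\<dots> = A ^ degree f" using i by (simp flip: power_add)
    finally show "\<bar>real_of_int (coeff f i * a ^ i * y ^ (degree f - i))\<bar> \<le> \<bar>real_of_int (coeff f i)\<bar> * A ^ degree f"
      by (simp add: abs_mult power_abs mult.assoc mult_left_mono)
  qed
  finally show ?thesis by (simp add: sum_distrib_right)
qed

text \<open>Modulo a prime dividing \<open>y\<close> only the leading term of the form survives.
  This turns a prime shared by the value and \<open>b\<close> into a common divisor of
  \<open>a\<close> and \<open>b\<close>.\<close>

lemma prime_dvd_form_val_imp_dvd: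
  assumes "prime p" "p dvd form_val f a y" "p dvd y" "\<not> p dvd lead_coeff f" "degree f \<ge> 1"
  shows "p dvd a"
proof -
  have "form_val f a y = lead_coeff f * a ^ degree f + (\<Sum>i<degree f. coeff f i * a ^ i * y ^ (degree f - i))"
    by (simp add: form_val_def lessThan_Suc_atMost[symmetric])
  moreover have "p dvd (\<Sum>i<degree f. coeff f i * a ^ i * y ^ (degree f - i))"
    using assms(3) by (intro dvd_sum dvd_mult) (auto intro: dvd_trans[OF _ dvd_power])
  ultimately have "p dvd lead_coeff f * a ^ degree f"
    using assms(2) by (metis dvd_add_left_iff)
  then show ?thesis
    using assms(1,4) prime_dvd_mult_iff prime_dvd_power by blast
qed

text \<open>The three bounds on \<tau> belong to three ways of obtaining a large radical. The first
  serves values that have no square prime divisor above \<open>z\<close>. The other two serve values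
  with a square divisor p^2: they make the single prime \<open>p\<close>, above B^m or above
  B^(2-\<eta>), reach \<open>B powr \<tau>\<close>. In degree 3 with \<open>m = 1\<close>, and in
  degree at most 2, no such \<open>p\<close> survives.\<close>

lemma negligible_pairs_small_large_rad:
  fixes f U V :: "int poly" and \<tau> :: real
  assumes cert: "U * f + V * pderiv f = [:D:]" "D \<noteq> 0"
    and k1: "degree f \<ge> 1" and m1: "m \<ge> 1"
    and \<tau>: "\<tau> < m * degree f" "degree f \<ge> 3 \<Longrightarrow> m \<ge> 2 \<Longrightarrow> \<tau> \<le> m" "degree f \<ge> 4 \<Longrightarrow> m = 1 \<Longrightarrow> \<tau> < 2"
  shows "negligible_pairs m (\<lambda>B a b. large_rad (sqrt (ln B)) (form_val f a (b ^ m)) < B powr \<tau>)"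
proof -
  define k where "k = degree f"
  have f0: "f \<noteq> 0" using k1 by auto
  \<comment> \<open>Then m k - \<epsilon> = \<tau> + \<epsilon>: a value above
    \<open>B powr (m * k - \<epsilon>)\<close> cannot be the product of a smooth part at most
    \<open>B powr \<epsilon>\<close> and a squarefree part below
    \<open>B powr \<tau>\<close>.\<close>
  define \<epsilon> where "\<epsilon> = (m * k - \<tau>) / 2"
  have \<epsilon>: "\<epsilon> > 0" using \<tau>(1) by (simp add: \<epsilon>_def k_def)
  define C where "C = (\<Sum>i\<le>degree f. \<bar>real_of_int (coeff f i)\<bar>)"
  have C1: "C \<ge> 1"
  proof -
    have "\<bar>lead_coeff f\<bar> \<ge> 1" using f0 by (simp add: int_one_le_iff_zero_less)
    then have "1 \<le> \<bar>real_of_int (lead_coeff f)\<bar>" by linarith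
    also have "\<dots> \<le> C" unfolding C_def by (rule member_le_sum) auto
    finally show ?thesis .
  qed
  \<comment> \<open>For k \<ge> 4 this makes 2 - \<eta> equal to \<tau>. For k = 3 the value 1/4
    gives p^2 > B^(7/2), more than C B^3 once C < sqrt B.\<close>
  define \<eta> where "\<eta> = (if k \<ge> 4 \<and> m = 1 then 2 - \<tau> else 1 / 4)"
  have \<eta>: "\<eta> > 0" using \<tau>(3) by (simp add: \<eta>_def k_def)
  define E1 where "E1 B a b \<longleftrightarrow> a = 0 \<or> b = 0" for B :: real and a b :: int
  define E2 where "E2 B a b \<longleftrightarrow> a \<noteq> 0 \<and> b \<noteq> 0 \<and> (\<exists>n. real_of_int n > sqrt (ln B) \<and> n dvd a \<and> n dvd b)" for B :: real and a b :: int
  \<comment> \<open>Primes beyond (C + 1) A have p^2 > C A^2, impossible for a divisor of a value of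
    degree at most 2; for \<open>m = 1\<close> they also exceed 2 B, where \<open>E6\<close> takes
    over.\<close>
  define E3 where "E3 B a b \<longleftrightarrow> (\<exists>p. prime p \<and> real_of_int p > sqrt (ln B) \<and>
    real_of_int p \<le> (C + 1) * B ^ m \<and> p\<^sup>2 dvd form_val f a (b ^ m) \<and> \<not> p dvd b)" for B :: real and a b :: int
  define E4 where "E4 B a b \<longleftrightarrow> \<bar>real_of_int (form_val f a (b ^ m))\<bar> \<le> B powr (real (m * degree f) - \<epsilon>)" for B a b
  define E5 where "E5 B a b \<longleftrightarrow> form_val f a (b ^ m) \<noteq> 0 \<and>
    real_of_int (smooth_part (sqrt (ln B)) (form_val f a (b ^ m))) > B powr \<epsilon>" for B a b
  define E6 where "E6 B a b \<longleftrightarrow> m = 1 \<and> a \<noteq> 0 \<and> b \<noteq> 0 \<and> (\<exists>p. prime p \<and> real_of_int p > 2 * B \<and>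
    real_of_int p \<le> B powr (2 - \<eta>) \<and> p\<^sup>2 dvd form_val f a b)" for B :: real and a b :: int
  have "negligible_pairs m E1"
    unfolding E1_def using m1 by (rule negligible_pairs_zero)
  moreover have "negligible_pairs m E2"
    unfolding E2_def by (rule negligible_pairs_common_divisor) real_asymp+
  moreover have "negligible_pairs m E3"
    unfolding E3_def by (rule negligible_pairs_square_divisor[OF f0 cert m1]) (use C1 in simp)
  moreover have "negligible_pairs m E4"
    unfolding E4_def by (rule negligible_pairs_small_value[OF k1 m1 \<epsilon>])
  moreover have "negligible_pairs m E5"
    unfolding E5_def by (rule negligible_pairs_large_smooth_part[OF k1 m1 \<epsilon>])
  moreover have "negligible_pairs m E6"
  proof (cases "m = 1")
    case True
    then show ?thesis
      unfolding E6_def using negligible_pairs_square_divisor_large[OF f0 cert \<eta>] by simp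
  next
    case False
    then show ?thesis by (simp add: E6_def negligible_pairs_def)
  qed
  ultimately have "negligible_pairs m (\<lambda>B a b. E1 B a b \<or> E2 B a b \<or> E3 B a b \<or> E4 B a b \<or> E5 B a b \<or> E6 B a b)"
    by (intro negligible_pairs_disj)
  then show ?thesis
  proof (rule negligible_pairs_mono)
    have ev1: "\<forall>\<^sub>F B in at_top. sqrt (ln B) \<ge> \<bar>lead_coeff f\<bar>"
    proof -
      have "filterlim (\<lambda>B::real. sqrt (ln B)) at_top at_top" by real_asymp
      then show ?thesis unfolding filterlim_at_top by blast
    qed
    have ev2: "\<forall>\<^sub>F B::real in at_top. C < sqrt B" by real_asymp
    show "\<forall>\<^sub>F B in at_top. \<forall>a b. (a, b) \<in> form_box m B \<longrightarrow>
      large_rad (sqrt (ln B)) (form_val f a (b ^ m)) < B powr \<tau> \<longrightarrow>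
      E1 B a b \<or> E2 B a b \<or> E3 B a b \<or> E4 B a b \<or> E5 B a b \<or> E6 B a b"
      using ev1 ev2 eventually_gt_at_top[of 1]
    proof eventually_elim
      case (elim B)
      define z where "z = sqrt (ln B)"
      show ?case
      proof (intro allI impI, rule ccontr)
        fix a b assume ab: "(a, b) \<in> form_box m B"
          and small: "large_rad (sqrt (ln B)) (form_val f a (b ^ m)) < B powr \<tau>"
          and good: "\<not> (E1 B a b \<or> E2 B a b \<or> E3 B a b \<or> E4 B a b \<or> E5 B a b \<or> E6 B a b)"
        define G where "G = form_val f a (b ^ m)"
        have a0: "a \<noteq> 0" and b0: "b \<noteq> 0" using good by (auto simp: E1_def)
        have Gbig: "\<bar>real_of_int G\<bar> > B powr (m * k - \<epsilon>)"
          using good by (simp add: E4_def G_def k_def)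
        then have G0: "G \<noteq> 0" using powr_ge_zero[of B "m * k - \<epsilon>"] by linarith
        have Gle: "\<bar>real_of_int G\<bar> \<le> C * (B ^ m) ^ k"
        proof -
          have "\<bar>real_of_int (b ^ m)\<bar> \<le> B ^ m"
            using ab by (simp add: form_box_def power_abs power_mono)
          with ab show ?thesis
            unfolding G_def C_def k_def by (intro abs_form_val_le) (auto simp: form_box_def)
        qed
        have lr: "real_of_int (large_rad z G) < B powr \<tau>"
          using small by (simp add: G_def z_def)
        show False
        proof (cases "\<exists>p. prime p \<and> real_of_int p > z \<and> p\<^sup>2 dvd G")
          case False
          then have eq: "smooth_part z G * large_rad z G = \<bar>G\<bar>"
            using smooth_part_mult_large_rad[OF G0] by blast
          have sm: "real_of_int (smooth_part z G) \<le> B powr \<epsilon>"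
            using good G0 by (auto simp: E5_def G_def z_def)
          have "B powr (m * k - \<epsilon>) < real_of_int (smooth_part z G) * real_of_int (large_rad z G)"
            using Gbig eq by (metis of_int_abs of_int_mult)
          also have "\<dots> \<le> B powr \<epsilon> * B powr \<tau>"
            using sm lr large_rad_pos[of z G] by (intro mult_mono) auto
          also have "\<dots> = B powr (m * k - \<epsilon>)"
            unfolding powr_add[symmetric] by (simp add: \<epsilon>_def field_simps)
          finally show False by simp
        next
          case True
          then obtain p where p: "prime p" "real_of_int p > z" "p\<^sup>2 dvd G" by blast
          have pG: "p dvd G" using p(3) by (meson dvd_power dvd_trans pos2)
          have npb: "\<not> p dvd b"
          proof
            assume pb: "p dvd b"
            have "\<not> p dvd lead_coeff f"
            proof
              assume "p dvd lead_coeff f"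
              then have "\<bar>p\<bar> \<le> \<bar>lead_coeff f\<bar>" using f0 by (intro dvd_imp_le_int) auto
              then show False using p(2) elim(1) unfolding z_def by linarith
            qed
            moreover have "p dvd b ^ m" using pb m1 by (meson dvd_power dvd_trans less_le_trans zero_less_one)
            ultimately have "p dvd a"
              using prime_dvd_form_val_imp_dvd[OF p(1) _ _ _ k1] pG by (simp add: G_def)
            then have "E2 B a b" using a0 b0 p pb by (auto simp: E2_def z_def)
            then show False using good by blast
          qed
          have pA: "real_of_int p > (C + 1) * B ^ m"
            using good p npb by (force simp: E3_def G_def z_def)
          have p2: "(real_of_int p)\<^sup>2 \<le> C * (B ^ m) ^ k"
          proof -
            have "\<bar>p\<^sup>2\<bar> \<le> \<bar>G\<bar>" using p(3) G0 by (intro dvd_imp_le_int)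
            then have "real_of_int \<bar>p\<^sup>2\<bar> \<le> real_of_int \<bar>G\<bar>" by (simp only: of_int_le_iff)
            then show ?thesis using Gle by simp
          qed
          have plr: "real_of_int p \<le> large_rad z G"
            using prime_le_large_rad[of p G z] p pG G0 by (simp add: prime_factors_dvd)
          have Bm: "B ^ m \<ge> B" using power_increasing[of 1 m B] m1 elim(3) by simp
          consider "k \<le> 2" | "k \<ge> 3" "m \<ge> 2" | "k \<ge> 3" "m = 1" using m1 by linarith
          then show False
          proof cases
            case 1
            have "C * (B ^ m) ^ k \<le> C * (B ^ m) ^ 2"
              using 1 C1 Bm elim(3) by (intro mult_left_mono power_increasing) auto
            also have "\<dots> < (C + 1)\<^sup>2 * (B ^ m)\<^sup>2"
            proof (rule mult_strict_right_mono)
              have "C * (C + 1) \<ge> 0" using C1 by simp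
              then have "C < C + 1 + C * (C + 1)" by linarith
              then show "C < (C + 1)\<^sup>2" by (simp add: power2_eq_square algebra_simps)
            qed (use elim(3) in simp)
            also have "\<dots> = ((C + 1) * B ^ m)\<^sup>2" by (simp add: power_mult_distrib)
            also have "\<dots> \<le> (real_of_int p)\<^sup>2"
              using pA C1 elim(3) by (intro power_mono) auto
            finally show False using p2 by simp
          next
            case 2
            have "B powr \<tau> \<le> B powr m"
              using 2 \<tau>(2) elim(3) by (simp add: k_def powr_mono)
            also have "\<dots> = 1 * B ^ m" using elim(3) by (simp add: powr_realpow)
            also have "\<dots> \<le> (C + 1) * B ^ m" using C1 elim(3) by (intro mult_right_mono) auto
            finally show False using pA plr lr by linarith
          next
            case 3
            have "2 * B \<le> (C + 1) * B" using C1 elim(3) by (intro mult_right_mono) auto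
            then have "real_of_int p > 2 * B" using pA 3 by simp
            then have pbig: "real_of_int p > B powr (2 - \<eta>)"
              using good p a0 b0 3 by (force simp: E6_def G_def)
            show False
            proof (cases "k \<ge> 4")
              case True
              then have "B powr (2 - \<eta>) = B powr \<tau>" using 3 by (simp add: \<eta>_def)
              then show False using pbig plr lr by linarith
            next
              case False
              then have k3: "k = 3" using 3 by simp
              have "C * (B ^ m) ^ k < sqrt B * B ^ 3"
                unfolding k3 using 3 elim by (simp add: mult_strict_right_mono)
              also have "\<dots> = B powr (7 / 2)"
                using elim(3) powr_add[of B "1 / 2" 3] by (simp add: powr_half_sqrt)
              also have "\<dots> = (B powr (2 - \<eta>))\<^sup>2"
                using elim(3) False k3 by (simp add: \<eta>_def power2_eq_square flip: powr_add)
              also have "\<dots> \<le> (real_of_int p)\<^sup>2"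
                using pbig by (intro power_mono) auto
              finally show False using p2 by simp
            qed
          qed
        qed
      qed
    qed
  qed
qed

section \<open>Homogenization\<close>

text \<open>Homogenization in a prescribed degree, with the power of \<open>y\<close> in the outer
  variable. The prescribed degree makes it additive and, when the degrees fit, multiplicative. It is
  polymorphic because it is applied over the integers for values and over the rationals for
  divisibility.\<close>

definition homogenization :: "nat \<Rightarrow> 'a::comm_semiring_1 poly \<Rightarrow> 'a poly poly" where
  "homogenization n g = (\<Sum>i\<le>n. monom (monom (coeff g i) i) (n - i))"

lemma coeff_homogenization:
  "coeff (coeff (homogenization n g) j) i = (if i + j = n then coeff g i else 0)"
proof -
  have "coeff (coeff (homogenization n g) j) i = (\<Sum>l\<le>n. if n - l = j \<and> l = i then coeff g l else 0)"
    unfolding homogenization_def coeff_sum by (intro sum.cong) auto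
  also have "\<dots> = (\<Sum>l\<le>n. if l = i then if i + j = n then coeff g i else 0 else 0)"
    by (intro sum.cong) auto
  finally show ?thesis by auto
qed

lemma homogenization_sum: "homogenization n (sum g I) = (\<Sum>i\<in>I. homogenization n (g i))"
  by (intro poly_eqI) (simp add: coeff_homogenization coeff_sum)

lemma homogenization_monom:
  "l \<le> n \<Longrightarrow> homogenization n (monom c l) = monom (monom c l) (n - l)"
  by (intro poly_eqI) (auto simp: coeff_homogenization)

lemma homogenization_mult:
  fixes g h :: "'a::comm_ring_1 poly"
  assumes "degree g \<le> n" "degree h \<le> m"
  shows "homogenization (n + m) (g * h) = homogenization n g * homogenization m h"
proof -
  have e: "p = (\<Sum>i\<le>N. monom (coeff p i) i)" if "degree p \<le> N" for p :: "'a poly" and N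
    using that by (intro poly_eqI) (auto simp: coeff_sum coeff_eq_0)
  have "g * h = (\<Sum>i\<le>n. \<Sum>j\<le>m. monom (coeff g i * coeff h j) (i + j))"
    by (subst e[OF assms(1)], subst e[OF assms(2)]) (simp add: sum_product mult_monom)
  then have "homogenization (n + m) (g * h) =
    (\<Sum>i\<le>n. \<Sum>j\<le>m. homogenization (n + m) (monom (coeff g i * coeff h j) (i + j)))"
    by (simp add: homogenization_sum)
  also have "\<dots> = (\<Sum>i\<le>n. \<Sum>j\<le>m. monom (monom (coeff g i) i) (n - i) * monom (monom (coeff h j) j) (m - j))"
    by (intro sum.cong) (auto simp: homogenization_monom mult_monom)
  finally show ?thesis
    by (simp add: homogenization_def sum_product)
qed

lemma coeff_dehomogenization:
  assumes "\<And>i j. coeff (coeff F j) i \<noteq> 0 \<Longrightarrow> i + j = n"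
  shows "coeff (poly F 1) i = (if i \<le> n then coeff (coeff F (n - i)) i else 0)"
proof -
  have "coeff (poly F 1) i = (\<Sum>j\<le>degree F. coeff (coeff F j) i)"
    by (simp add: poly_altdef coeff_sum)
  also have "\<dots> = (\<Sum>j\<le>degree F. if j = n - i then if i \<le> n then coeff (coeff F (n - i)) i else 0 else 0)"
  proof (intro sum.cong)
    fix j
    show "coeff (coeff F j) i = (if j = n - i then if i \<le> n then coeff (coeff F (n - i)) i else 0 else 0)"
      using assms[of j i] by (cases "coeff (coeff F j) i = 0") (auto split: if_splits)
  qed simp
  also have "\<dots> = (if i \<le> n then coeff (coeff F (n - i)) i else 0)"
    by (auto simp: coeff_eq_0)
  finally show ?thesis .
qed

lemma homogenization_dehomogenization:
  assumes "\<And>i j. coeff (coeff F j) i \<noteq> 0 \<Longrightarrow> i + j = n"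
  shows "homogenization n (poly F 1) = F"
proof (intro poly_eqI)
  fix i j
  show "coeff (coeff (homogenization n (poly F 1)) j) i = coeff (coeff F j) i"
    using assms[of j i] coeff_dehomogenization[of F n i] assms by (auto simp: coeff_homogenization)
qed

lemma is_unit_homogenization_imp:
  fixes g :: "'a::field poly"
  assumes "homogenization (degree g) g dvd 1" 
  shows "degree g = 0"
proof (cases "g = 0")
  case False
  obtain c where c: "homogenization (degree g) g = [:c:]" "c dvd 1"
    using assms is_unit_poly_iff by blast
  obtain c' where c': "c = [:c':]" using c(2) is_unit_poly_iff by blast
  have "coeff (coeff (homogenization (degree g) g) 0) (degree g) \<noteq> 0"
    using False by (simp add: coeff_homogenization)
  then show ?thesis unfolding c(1) c' by (cases "degree g") auto
qed simp

text \<open>Over a field degrees add, so a factorization g = u v homogenizes factor by factor; a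
  factor whose homogenization is a unit has degree 0. A constant \<open>g\<close> would itself
  homogenize to zero or a unit.\<close>

lemma irreducible_dehomogenization:
  fixes g :: "'a::field poly"
  assumes "irreducible (homogenization (degree g) g)"
  shows "irreducible g" "degree g \<ge> 1"
proof -
  show deg: "degree g \<ge> 1"
  proof (rule ccontr)
    assume "\<not> ?thesis"
    then have d0: "degree g = 0" by simp
    then obtain c where c: "g = [:c:]" using degree_eq_zeroE by metis
    have "homogenization (degree g) g = [:[:c:]:]"
      by (intro poly_eqI) (simp add: coeff_homogenization c coeff_pCons split: nat.split)
    moreover have "c \<noteq> 0"
      using assms calculation by (auto simp: irreducible_def)
    ultimately show False
      using assms by (auto simp: irreducible_def dvd_field_iff is_unit_const_poly_iff)
  qed
  show "irreducible g"
  proof (rule irreducibleI)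
    show "g \<noteq> 0" using deg by auto
    show "\<not> g dvd 1" using deg by (auto simp: is_unit_poly_iff)
  next
    fix u v assume uv: "g = u * v"
    have nz: "u \<noteq> 0" "v \<noteq> 0" using uv deg by auto
    have "homogenization (degree g) g = homogenization (degree u) u * homogenization (degree v) v"
      using uv nz by (simp add: degree_mult_eq homogenization_mult)
    then have "homogenization (degree u) u dvd 1 \<or> homogenization (degree v) v dvd 1"
      using assms irreducibleD by blast
    then have "degree u = 0 \<or> degree v = 0"
      using is_unit_homogenization_imp[of u] is_unit_homogenization_imp[of v] by argo
    then show "u dvd 1 \<or> v dvd 1" using nz by (simp add: is_unit_iff_degree)
  qed
qed

lemma coprime_dehomogenization:
  fixes g h :: "'a::field_gcd poly"
  assumes "coprime (homogenization (degree g) g) (homogenization (degree h) h)" "g \<noteq> 0" "h \<noteq> 0"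
  shows "coprime g h"
proof (rule coprimeI)
  fix c assume c: "c dvd g" "c dvd h"
  have "homogenization (degree c) c dvd homogenization (degree p) p" if p: "c dvd p" "p \<noteq> 0" for p
  proof -
    obtain u where u: "p = c * u" using p(1) by (elim dvdE)
    then show ?thesis using p(2) by (auto simp: degree_mult_eq homogenization_mult)
  qed
  then have "homogenization (degree c) c dvd 1"
    using assms c by (meson coprime_common_divisor)
  then have "degree c = 0" by (rule is_unit_homogenization_imp)
  moreover have "c \<noteq> 0" using c assms by auto
  ultimately show "c dvd 1" by (simp add: is_unit_iff_degree)
qed

section \<open>Integer Bezout certificates\<close>

lemma rat_poly_clear_denominators:
  fixes p :: "rat poly"
  shows "\<exists>c q. c \<noteq> 0 \<and> smult (of_int c) p = map_poly of_int (q :: int poly)"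
proof (induction p)
  case 0
  then show ?case by (intro exI[of _ 1] exI[of _ 0]) simp
next
  case (pCons a p)
  then obtain c q where q: "c \<noteq> 0" "smult (of_int c) p = map_poly of_int (q :: int poly)" by blast
  obtain s t where st: "a = of_int s / of_int t" "t > 0"
    by (metis Fract_of_int_quotient Rat_cases)
  have "smult (of_int (t * c)) (pCons a p) = map_poly of_int (pCons (c * s) (smult t q))"
  proof (intro poly_eqI)
    fix n
    have "of_int c * coeff p i = of_int (coeff q i)" for i
      using arg_cong[OF q(2), of "\<lambda>x. coeff x i"] by (simp add: coeff_map_poly)
    then show "coeff (smult (of_int (t * c)) (pCons a p)) n = coeff (map_poly of_int (pCons (c * s) (smult t q))) n"
      using st by (cases n) (simp_all add: coeff_map_poly mult_ac)
  qed
  moreover have "t * c \<noteq> 0" using st q by simp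
  ultimately show ?case by blast
qed

lemma of_int_poly_add:
  "map_poly of_int (p + q) = map_poly of_int p + (map_poly of_int q :: 'a::ring_1 poly)"
  by (intro poly_eqI) (simp add: coeff_map_poly)

lemma of_int_poly_mult:
  "map_poly of_int (p * q) = map_poly of_int p * (map_poly of_int q :: 'a::comm_ring_1 poly)"
  by (intro poly_eqI) (simp add: coeff_map_poly coeff_mult)

lemma of_int_poly_inject:
  fixes p q :: "int poly"
  assumes "map_poly (of_int :: int \<Rightarrow> 'a::ring_char_0) p = map_poly of_int q"
  shows "p = q"
proof (intro poly_eqI)
  fix n show "coeff p n = coeff q n"
    using arg_cong[OF assms, of "\<lambda>x. coeff x n"] by (simp add: coeff_map_poly)
qed

text \<open>Bezout over the rationals with denominators cleared. The constant \<open>D\<close> is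
  what matters: a prime dividing f(x) and g(x) at the same integer \<open>x\<close> divides
  \<open>D\<close>, so large primes are never shared.\<close>

lemma int_poly_bezout_certificate:
  fixes f g :: "int poly"
  assumes "coprime (map_poly of_int f :: rat poly) (map_poly of_int g)"
  obtains U V D where "U * f + V * g = [:D:]" "D \<noteq> 0"
proof -
  let ?f = "map_poly of_int f :: rat poly" and ?g = "map_poly of_int g :: rat poly"
  have "\<exists>u v. u * ?f + v * ?g = 1"
    using bezout_coefficients_fst_snd[of ?f ?g] assms by (metis coprime_iff_gcd_eq_1)
  then obtain u v where uv: "u * ?f + v * ?g = 1" by blast
  obtain c q where c: "c \<noteq> 0" "smult (of_int c) u = map_poly of_int (q :: int poly)"
    using rat_poly_clear_denominators by blast
  obtain d r where d: "d \<noteq> 0" "smult (of_int d) v = map_poly of_int (r :: int poly)"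
    using rat_poly_clear_denominators by blast
  have "map_poly of_int (smult d q * f + smult c r * g) = (map_poly of_int [:c * d:] :: rat poly)"
  proof -
    have sm: "map_poly of_int (smult x p) = smult (of_int x) (map_poly of_int p :: rat poly)" for x p
      by (intro poly_eqI) (simp add: coeff_map_poly)
    have "map_poly of_int (smult d q * f + smult c r * g) =
      smult (of_int d) (smult (of_int c) u) * ?f + smult (of_int c) (smult (of_int d) v) * ?g"
      by (simp add: of_int_poly_add of_int_poly_mult sm c d)
    also have "\<dots> = smult (of_int (c * d)) (u * ?f + v * ?g)"
      by (simp add: smult_add_right mult_ac)
    also have "\<dots> = map_poly of_int [:c * d:]"
      by (simp add: uv map_poly_pCons)
    finally show ?thesis .
  qed
  then have "smult d q * f + smult c r * g = [:c * d:]"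
    by (rule of_int_poly_inject)
  moreover have "c * d \<noteq> 0" using c d by simp
  ultimately show thesis using that by blast
qed

lemma degree_of_int_poly [simp]:
  "degree (map_poly of_int p :: 'a::ring_char_0 poly) = degree p"
  by (rule degree_map_poly) auto

text \<open>In characteristic 0 the derivative of a nonconstant polynomial is nonzero and of smaller
  degree, so an irreducible polynomial is coprime to it.\<close>

lemma int_poly_squarefree_certificate:
  fixes f :: "int poly"
  assumes "irreducible (map_poly of_int f :: rat poly)" "degree f \<ge> 1"
  obtains U V D where "U * f + V * pderiv f = [:D:]" "D \<noteq> 0"
proof -
  let ?f = "map_poly of_int f :: rat poly"
  have pd: "map_poly of_int (pderiv f) = pderiv ?f"
    by (intro poly_eqI) (simp add: coeff_map_poly coeff_pderiv)
  have "coprime ?f (pderiv ?f)"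
  proof (rule prime_elem_imp_coprime)
    show "prime_elem ?f" using assms(1) by (rule irreducible_imp_prime_elem)
    show "\<not> ?f dvd pderiv ?f"
    proof
      assume "?f dvd pderiv ?f"
      moreover have "pderiv ?f \<noteq> 0" using assms(2) by (simp add: pderiv_eq_0_iff)
      ultimately have "degree ?f \<le> degree (pderiv ?f)" by (rule dvd_imp_degree_le)
      then show False using assms(2) by (simp add: degree_pderiv)
    qed
  qed
  then show thesis
    using int_poly_bezout_certificate[of f "pderiv f"] that unfolding pd by blast
qed

section \<open>Transfer between integer and rational forms\<close>

lemma coeff_over_rat [simp]: "coeff (coeff (over_rat F) j) i = of_int (coeff (coeff F j) i)"
  by (simp add: over_rat_def coeff_map_poly)

lemma coeff_over_rat_eq: "coeff (over_rat F) j = map_poly of_int (coeff F j)"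
  by (simp add: over_rat_def coeff_map_poly)

lemma degree_over_rat: "degree (over_rat F) = degree F"
  unfolding over_rat_def by (rule degree_map_poly) (auto simp: poly_eq_iff coeff_map_poly)

lemma poly_of_int_poly: "poly (map_poly of_int p) (of_int x :: 'a::{comm_ring_1,ring_char_0}) = of_int (poly p x)"
  by (simp add: poly_altdef coeff_map_poly)

lemma poly_over_rat: "poly (over_rat F) (map_poly of_int p) = map_poly of_int (poly F p)"
proof -
  have pw: "map_poly of_int (p ^ n) = (map_poly of_int p :: rat poly) ^ n" for n
    by (induction n) (simp_all add: of_int_poly_mult)
  have sm: "map_poly of_int (sum g S) = (\<Sum>i\<in>S. map_poly of_int (g i) :: rat poly)" for g :: "nat \<Rightarrow> int poly" and S
    by (intro poly_eqI) (simp add: coeff_map_poly coeff_sum)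
  show ?thesis
    by (simp add: poly_altdef degree_over_rat coeff_over_rat_eq pw sm of_int_poly_mult)
qed

lemma eval_over_rat: "poly (poly (over_rat F) [:of_int b:]) (of_int a) = of_int (eval_xy F a b)"
  using poly_over_rat[of F "[:b:]"] by (simp add: eval_xy_def poly_of_int_poly map_poly_pCons)

section \<open>The factor y\<close>

lemma card_abs_ge: "B \<ge> 1 \<Longrightarrow> B \<le> real (card {b::int. \<bar>real_of_int b\<bar> \<le> B})"
proof -
  assume B: "B \<ge> 1"
  have *: "{b::int. \<bar>real_of_int b\<bar> \<le> B} = {-\<lfloor>B\<rfloor>..\<lfloor>B\<rfloor>}"
  proof safe
    fix b :: int
    show "b \<in> {-\<lfloor>B\<rfloor>..\<lfloor>B\<rfloor>}" if "\<bar>real_of_int b\<bar> \<le> B"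
      using that by (simp add: le_floor_iff abs_le_iff) linarith
    show "\<bar>real_of_int b\<bar> \<le> B" if "b \<in> {-\<lfloor>B\<rfloor>..\<lfloor>B\<rfloor>}"
      using that by (simp add: le_floor_iff abs_le_iff) linarith
  qed
  have "B < \<lfloor>B\<rfloor> + 1" by linarith
  moreover have "real_of_int \<lfloor>B\<rfloor> \<ge> 1" using B by simp
  ultimately have "B \<le> 2 * real_of_int \<lfloor>B\<rfloor> + 1" by linarith
  with * B show ?thesis by simp
qed

text \<open>The condition concerns \<open>b\<close> alone. With the coordinates exchanged it is the
  case \<open>m = 1\<close>, f = x of the bound for one factor, with certificate 0 * x + 1 * 1 = 1.
  There each exceptional integer is counted at least \<open>B\<close> times, here at most 3 B^m
  times, hence the factor 3 B^m / B.\<close>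

lemma negligible_pairs_small_large_rad_snd:
  fixes \<tau> :: real
  assumes "\<tau> < 1"
  shows "negligible_pairs m (\<lambda>B a b. large_rad (sqrt (ln B)) b < B powr \<tau>)"
proof -
  have "negligible_pairs 1 (\<lambda>B a b. large_rad (sqrt (ln B)) (form_val [:0, 1:] a (b ^ 1)) < B powr \<tau>)"
    by (rule negligible_pairs_small_large_rad[where U = 0 and V = 1 and D = 1])
      (use assms in \<open>auto simp: pderiv_pCons one_pCons\<close>)
  then have n1: "negligible_pairs 1 (\<lambda>B a b. large_rad (sqrt (ln B)) a < B powr \<tau>)"
    by (simp add: form_val_def)
  define N where "N B = {b. \<bar>real_of_int b\<bar> \<le> B \<and> large_rad (sqrt (ln B)) b < B powr \<tau>}" for B
  have "(\<lambda>B. real (card {(a, b) \<in> form_box m B. large_rad (sqrt (ln B)) b < B powr \<tau>}))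
    \<in> O(\<lambda>B. 3 * B ^ m / B * real (card {(a, b) \<in> form_box 1 B. large_rad (sqrt (ln B)) a < B powr \<tau>}))"
  proof (rule landau_o.big_mono)
    show "\<forall>\<^sub>F B in at_top. norm (real (card {(a, b) \<in> form_box m B. large_rad (sqrt (ln B)) b < B powr \<tau>}))
      \<le> norm (3 * B ^ m / B * real (card {(a, b) \<in> form_box 1 B. large_rad (sqrt (ln B)) a < B powr \<tau>}))"
      using eventually_ge_at_top[of 1]
    proof eventually_elim
      case (elim B)
      have "{(a, b) \<in> form_box m B. large_rad (sqrt (ln B)) b < B powr \<tau>} = {a. \<bar>real_of_int a\<bar> \<le> B ^ m} \<times> N B"
        by (auto simp: form_box_def N_def)
      then have "real (card {(a, b) \<in> form_box m B. large_rad (sqrt (ln B)) b < B powr \<tau>}) =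
        card {a::int. \<bar>real_of_int a\<bar> \<le> B ^ m} * real (card (N B))"
        by (simp only: card_cartesian_product of_nat_mult)
      also have "\<dots> \<le> (3 * B ^ m) * real (card (N B))"
      proof (rule mult_right_mono)
        have "1 \<le> B ^ m" using elim by simp
        then show "card {a::int. \<bar>real_of_int a\<bar> \<le> B ^ m} \<le> 3 * B ^ m"
          using card_abs_le(2)[of "B ^ m"] by linarith
      qed simp
      also have "\<dots> = 3 * B ^ m / B * (real (card (N B)) * B)" using elim by simp
      also have "\<dots> \<le> 3 * B ^ m / B * (real (card (N B)) * real (card {b::int. \<bar>real_of_int b\<bar> \<le> B}))"
        using elim card_abs_ge[OF elim] by (intro mult_left_mono) auto
      also have "real (card (N B)) * real (card {b::int. \<bar>real_of_int b\<bar> \<le> B}) = real (card (N B \<times> {b::int. \<bar>real_of_int b\<bar> \<le> B}))"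
        by (simp only: card_cartesian_product of_nat_mult)
      also have "N B \<times> {b::int. \<bar>real_of_int b\<bar> \<le> B} = {(a, b) \<in> form_box 1 B. large_rad (sqrt (ln B)) a < B powr \<tau>}"
        by (auto simp: form_box_def N_def)
      finally show ?case using elim by simp
    qed
  qed
  also have "(\<lambda>B. 3 * B ^ m / B * real (card {(a, b) \<in> form_box 1 B. large_rad (sqrt (ln B)) a < B powr \<tau>}))
    \<in> O(\<lambda>B. 3 * B ^ m / B * (B ^ (1 + 1) / sqrt (ln B)))"
    using n1 unfolding negligible_pairs_def by (rule landau_o.big.mult_left)
  also have "(\<lambda>B. 3 * B ^ m / B * (B ^ (1 + 1) / sqrt (ln B))) \<in> O(\<lambda>B::real. B ^ (m + 1) / sqrt (ln B))"
  proof (rule landau_o.bigI[where c = 3])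
    show "\<forall>\<^sub>F B::real in at_top. norm (3 * B ^ m / B * (B ^ (1 + 1) / sqrt (ln B))) \<le> 3 * norm (B ^ (m + 1) / sqrt (ln B))"
      using eventually_gt_at_top[of 1] by eventually_elim (simp add: mult_ac)
  qed simp
  finally show ?thesis unfolding negligible_pairs_def .
qed

section \<open>The factors of a form\<close>

text \<open>\<open>form_val\<close> homogenizes in the degree of its own polynomial. The degree
  condition, which says that \<open>y\<close> does not divide \<open>F\<close>, makes this the
  degree of the form.\<close>

lemma eval_xy_eq_form_val:
  assumes "binary_form k F" "degree (poly F 1) = k"
  shows "eval_xy F a y = form_val (poly F 1) a y"
proof -
  have F: "homogenization k (poly F 1) = F"
    using assms(1) by (intro homogenization_dehomogenization) (simp add: binary_form_def)
  have "eval_xy F a y = poly (poly (homogenization k (poly F 1)) [:y:]) a"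
    by (simp add: eval_xy_def F)
  also have "\<dots> = (\<Sum>i\<le>k. coeff (poly F 1) i * a ^ i * y ^ (k - i))"
    by (simp add: homogenization_def poly_sum poly_monom poly_power)
  finally show ?thesis by (simp add: form_val_def assms(2))
qed

lemma total_degree_binary_form:
  assumes "binary_form k F"
  shows "total_degree F = k"
proof -
  obtain j where "coeff F j \<noteq> 0"
    using assms unfolding binary_form_def by (metis leading_coeff_neq_0)
  then obtain i where ij: "coeff (coeff F j) i \<noteq> 0"
    by (metis leading_coeff_neq_0)
  have "{i + j | i j. coeff (coeff F j) i \<noteq> 0} = {k}"
    using assms ij unfolding binary_form_def by fastforce
  then show ?thesis by (simp add: total_degree_def)
qed

lemma over_rat_var_y: "over_rat var_y = [:0, 1:]"
  by (simp add: over_rat_def var_y_def map_poly_pCons)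

text \<open>If the coefficient of x^k vanished, \<open>y\<close> would divide the factor, against
  coprimality with F_0 = y; so setting y = 1 preserves the degree. If \<open>x\<close> divides the
  factor, irreducibility leaves only a constant cofactor: the special case in \<open>weight\<close>
  concerns linear factors only.\<close>

lemma form_factorization_factor:
  assumes "form_factorization F c0 \<psi> Fs e" "i \<in> {1..\<psi>}"
  defines "f \<equiv> poly (Fs i) 1"
  shows "degree f \<ge> 1" "total_degree (Fs i) = degree f"
    "\<And>a y. eval_xy (Fs i) a y = form_val f a y"
    "irreducible (map_poly of_int f :: rat poly)"
    "over_rat (Fs i) = homogenization (degree f) (map_poly of_int f)"
    "var_x dvd Fs i \<Longrightarrow> degree f = 1"
proof -
  obtain k where k: "binary_form k (Fs i)" and irr: "irreducible (over_rat (Fs i))"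
    using assms(1,2) unfolding form_factorization_def by auto
  have cop: "coprime (over_rat (Fs i)) [:0, 1:]"
    using assms(1,2) over_rat_var_y unfolding form_factorization_def by (metis atLeastAtMost_iff not_one_le_zero le0)
  have hom: "coeff (coeff (Fs i) j) l \<noteq> 0 \<Longrightarrow> l + j = k" for j l
    using k by (simp add: binary_form_def)
  note cf = coeff_dehomogenization[of "Fs i" k, OF hom, folded f_def]
  have "coeff f k \<noteq> 0"
  proof
    assume "coeff f k = 0"
    then have "coeff (coeff (Fs i) 0) k = 0" by (simp add: cf)
    then have "coeff (Fs i) 0 = 0"
      using hom[of 0] by (intro poly_eqI) (metis add_0_right coeff_0)
    then have "coeff (over_rat (Fs i)) 0 = 0" by (simp add: coeff_over_rat_eq)
    then have "[:0, 1:] dvd over_rat (Fs i)"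
      using poly_eq_0_iff_dvd[of "over_rat (Fs i)" 0] by (simp add: poly_0_coeff_0)
    then have "[:0, 1:] dvd (1 :: rat poly poly)"
      using cop by (meson coprime_common_divisor dvd_refl)
    then show False by (auto simp: is_unit_poly_iff)
  qed
  moreover have "degree f \<le> k" by (rule degree_le) (simp add: cf)
  ultimately have deg: "degree f = k" by (simp add: le_degree le_antisym)
  show td: "total_degree (Fs i) = degree f"
    using total_degree_binary_form[OF k] deg by simp
  show "\<And>a y. eval_xy (Fs i) a y = form_val f a y"
    using eval_xy_eq_form_val[OF k] deg by (simp add: f_def)
  show h: "over_rat (Fs i) = homogenization (degree f) (map_poly of_int f)"
  proof (intro poly_eqI)
    fix j l
    show "coeff (coeff (over_rat (Fs i)) j) l = coeff (coeff (homogenization (degree f) (map_poly of_int f)) j) l"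
      using hom[of j l] cf[of l] by (auto simp: coeff_homogenization coeff_map_poly deg)
  qed
  have irr': "irreducible (homogenization (degree (map_poly of_int f :: rat poly)) (map_poly of_int f :: rat poly))"
    using irr h by simp
  show irrf: "irreducible (map_poly of_int f :: rat poly)" and deg1: "degree f \<ge> 1"
    using irreducible_dehomogenization[OF irr'] by simp_all
  show "degree f = 1" if v: "var_x dvd Fs i"
  proof -
    obtain u where "Fs i = var_x * u" using v by (elim dvdE)
    then have "f = [:0, 1:] * poly u 1" by (simp add: f_def var_x_def)
    then have fx: "map_poly of_int f = [:0, 1:] * (map_poly of_int (poly u 1) :: rat poly)"
      by (simp add: of_int_poly_mult map_poly_pCons)
    have "\<not> [:0, 1:] dvd (1 :: rat poly)" by (auto simp: is_unit_poly_iff)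
    then have "(map_poly of_int (poly u 1) :: rat poly) dvd 1"
      using irreducibleD[OF irrf fx] by blast
    then have "degree (map_poly of_int (poly u 1) :: rat poly) = 0"
      by (metis is_unit_poly_iff degree_pCons_0)
    moreover have "(map_poly of_int (poly u 1) :: rat poly) \<noteq> 0"
      using fx irrf by auto
    ultimately have "degree (map_poly of_int f :: rat poly) = 1"
      unfolding fx by (subst degree_mult_eq) auto
    then show ?thesis by simp
  qed
qed

lemma form_factorization_bezout:
  assumes "form_factorization F c0 \<psi> Fs e" "i \<in> {1..\<psi>}" "j \<in> {1..\<psi>}" "i \<noteq> j"
  shows "\<exists>U V D. U * poly (Fs i) 1 + V * poly (Fs j) 1 = [:D:] \<and> D \<noteq> 0"
proof -
  note fi = form_factorization_factor[OF assms(1,2)]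
  note fj = form_factorization_factor[OF assms(1,3)]
  have "coprime (over_rat (Fs i)) (over_rat (Fs j))"
    using assms unfolding form_factorization_def by auto
  then have "coprime (map_poly of_int (poly (Fs i) 1) :: rat poly) (map_poly of_int (poly (Fs j) 1))"
    using fi(4) fj(4) unfolding fi(5) fj(5)
    by (intro coprime_dehomogenization) (auto simp: irreducible_def)
  then show ?thesis using int_poly_bezout_certificate by metis
qed

text \<open>The rational constant \<open>c0\<close> is split into numerator and denominator so that
  divisibility can be discussed among integers.\<close>

lemma form_factorization_eval:
  assumes "form_factorization F c0 \<psi> Fs e"
  shows "snd (quotient_of c0) * eval_xy F a y = fst (quotient_of c0) * (\<Prod>i\<le>\<psi>. eval_xy (Fs i) a y ^ e i)"
proof -
  let ?ev = "\<lambda>G :: rat poly poly. poly (poly G [:of_int y:]) (of_int a)"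
  have "?ev (over_rat F) = c0 * (\<Prod>i\<le>\<psi>. ?ev (over_rat (Fs i)) ^ e i)"
    using assms unfolding form_factorization_def by (simp add: poly_prod poly_power)
  then have "of_int (eval_xy F a y) = c0 * of_int (\<Prod>i\<le>\<psi>. eval_xy (Fs i) a y ^ e i)"
    by (simp add: eval_over_rat)
  moreover obtain s t where st: "quotient_of c0 = (s, t)" by (cases "quotient_of c0")
  moreover have "c0 = of_int s / of_int t" "t > 0"
    using st by (simp_all add: quotient_of_div quotient_of_denom_pos)
  ultimately have "(of_int (t * eval_xy F a y) :: rat) = of_int (s * (\<Prod>i\<le>\<psi>. eval_xy (Fs i) a y ^ e i))"
    by simp
  then show ?thesis using st by (simp only: of_int_eq_iff fst_conv snd_conv)
qed

section \<open>Radicals, the factors that occur, and the upper bound\<close>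

lemma rad_pos: "rad n \<ge> 1"
proof -
  have "rad n > 0" unfolding rad_def by (intro prod_pos) (auto dest: in_prime_factors_imp_prime prime_gt_0_int)
  then show ?thesis by simp
qed

lemma prod_primes_le:
  assumes "finite S" "T \<subseteq> S" "\<And>p. p \<in> S \<Longrightarrow> prime (p :: int)"
  shows "\<Prod>T \<le> \<Prod>S"
proof (rule prod_mono2[OF assms(1,2)])
  show "1 \<le> p" if "p \<in> S - T" for p
    using that assms(3)[of p] by (auto dest: prime_ge_1_int)
  show "0 \<le> p" if "p \<in> T" for p
    using that assms(2) assms(3)[of p] by (auto dest: prime_ge_0_int)
qed

lemma rad_le_abs:
  assumes "n \<noteq> 0"
  shows "rad n \<le> \<bar>n\<bar>"
proof -
  have "rad n \<le> (\<Prod>p\<in>prime_factors n. p ^ multiplicity p n)"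
    unfolding rad_def
  proof (intro prod_mono conjI)
    fix p assume p: "p \<in> prime_factors n"
    then have "p \<ge> 1" "multiplicity p n \<ge> 1"
      using assms by (auto simp: prime_factors_multiplicity dest!: prime_ge_1_int)
    then show "0 \<le> p" "p \<le> p ^ multiplicity p n" by (auto intro: self_le_power)
  qed
  also have "\<dots> = \<bar>n\<bar>" using prod_prime_factors[OF assms] by simp
  finally show ?thesis .
qed

text \<open>The indices \<open>i\<close> with \<open>\<delta>\<^sub>i \<noteq> 0\<close>.\<close>

definition proper_factors :: "nat \<Rightarrow> (nat \<Rightarrow> nat) \<Rightarrow> nat set" where
  "proper_factors \<psi> e = {i. i \<le> \<psi> \<and> (i \<ge> 1 \<or> e 0 \<ge> 1)}"

text \<open>For \<open>i = 0\<close> the value \<open>b\<close> stands in for \<open>F\<^sub>0(a, b^m) = b^m\<close>, which has the same prime factors.\<close>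

definition factor_val :: "nat \<Rightarrow> (nat \<Rightarrow> int poly poly) \<Rightarrow> nat \<Rightarrow> int \<Rightarrow> int \<Rightarrow> int" where
  "factor_val m Fs i a b = (if i = 0 then b else form_val (poly (Fs i) 1) a (b ^ m))"

lemma finite_proper_factors [simp]: "finite (proper_factors \<psi> e)"
  by (simp add: proper_factors_def)

lemma proper_factors_exponent:
  assumes "form_factorization F c0 \<psi> Fs e" "i \<in> proper_factors \<psi> e"
  shows "e i \<ge> 1"
  using assms by (cases "i = 0") (auto simp: proper_factors_def form_factorization_def)

lemma form_factorization_const_ne_0:
  assumes "form_factorization F c0 \<psi> Fs e" "binary_form d F"
  shows "c0 \<noteq> 0"
proof
  assume "c0 = 0"
  then have "over_rat F = 0" using assms(1) by (simp add: form_factorization_def)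
  then have "F = 0"
    by (intro poly_eqI) (metis coeff_0 coeff_over_rat of_int_eq_0_iff)
  then show False using assms(2) by (simp add: binary_form_def)
qed

text \<open>A form of degree at least 1 is not constant. This keeps the denominator of
  \<open>kappa\<close> positive.\<close>

lemma proper_factors_nonempty:
  assumes "form_factorization F c0 \<psi> Fs e" "binary_form d F" "d \<ge> 1"
  shows "proper_factors \<psi> e \<noteq> {}"
proof
  assume "proper_factors \<psi> e = {}"
  then have "0 \<notin> proper_factors \<psi> e" "\<psi> \<notin> proper_factors \<psi> e" by auto
  then have "\<psi> = 0" "e 0 = 0" by (auto simp: proper_factors_def)
  then have F: "over_rat F = [:[:c0:]:]" using assms(1) by (simp add: form_factorization_def)
  obtain j where "coeff F j \<noteq> 0"
    using assms(2) unfolding binary_form_def by (metis leading_coeff_neq_0)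
  then obtain i where ij: "coeff (coeff F j) i \<noteq> 0"
    by (metis leading_coeff_neq_0)
  then have "i + j = d" using assms(2) by (simp add: binary_form_def)
  then have "i \<noteq> 0 \<or> j \<noteq> 0" using assms(3) by auto
  then have "coeff (coeff (over_rat F) j) i = 0"
    unfolding F by (cases i; cases j) auto
  then show False using ij by simp
qed

lemma form_factorization_eval_var_y:
  assumes "form_factorization F c0 \<psi> Fs e"
  shows "eval_xy (Fs 0) a y = y"
  using assms by (simp add: form_factorization_def eval_xy_def var_y_def)

lemma factor_val_eq_0_iff:
  assumes "form_factorization F c0 \<psi> Fs e" "m \<ge> 1" "i \<le> \<psi>"
  shows "factor_val m Fs i a b = 0 \<longleftrightarrow> eval_xy (Fs i) a (b ^ m) = 0"
  using assms form_factorization_eval_var_y[OF assms(1)] form_factorization_factor(3)[OF assms(1), of i]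
  by (cases "i = 0") (auto simp: factor_val_def)

lemma prime_dvd_factor_val_iff:
  assumes "form_factorization F c0 \<psi> Fs e" "m \<ge> 1" "i \<le> \<psi>" "prime p"
  shows "p dvd factor_val m Fs i a b \<longleftrightarrow> p dvd eval_xy (Fs i) a (b ^ m)"
  using assms form_factorization_eval_var_y[OF assms(1)] form_factorization_factor(3)[OF assms(1), of i]
  by (cases "i = 0") (auto simp: factor_val_def prime_dvd_power_iff)

lemma eval_eq_0_iff:
  assumes "form_factorization F c0 \<psi> Fs e" "binary_form d F" "m \<ge> 1"
  shows "eval_xy F a (b ^ m) = 0 \<longleftrightarrow> (\<exists>i\<in>proper_factors \<psi> e. factor_val m Fs i a b = 0)"
proof -
  have s: "fst (quotient_of c0) \<noteq> 0"
    using form_factorization_const_ne_0[OF assms(1,2)]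
    by (metis fst_conv of_int_0 div_0 quotient_of_div surj_pair prod.collapse)
  have t: "snd (quotient_of c0) \<noteq> 0" using quotient_of_denom_pos'[of c0] by simp
  have "eval_xy F a (b ^ m) = 0 \<longleftrightarrow> (\<Prod>i\<le>\<psi>. eval_xy (Fs i) a (b ^ m) ^ e i) = 0"
    using form_factorization_eval[OF assms(1), of a "b ^ m"] s t by (metis mult_eq_0_iff)
  also have "\<dots> \<longleftrightarrow> (\<exists>i\<le>\<psi>. eval_xy (Fs i) a (b ^ m) = 0 \<and> e i \<noteq> 0)"
    by auto
  also have "\<dots> \<longleftrightarrow> (\<exists>i\<in>proper_factors \<psi> e. factor_val m Fs i a b = 0)"
  proof -
    have "i \<in> proper_factors \<psi> e \<longleftrightarrow> i \<le> \<psi> \<and> e i \<noteq> 0" for i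
      using proper_factors_exponent[OF assms(1), of i] by (cases "i = 0") (auto simp: proper_factors_def)
    then show ?thesis using factor_val_eq_0_iff[OF assms(1,3)] by auto
  qed
  finally show ?thesis .
qed

lemma delta_eq:
  assumes "form_factorization F c0 \<psi> Fs e" "i \<in> proper_factors \<psi> e"
  shows "delta m Fs e i = (if i = 0 then 1 else real (m * degree (poly (Fs i) 1)))"
  using assms form_factorization_factor(2)[OF assms(1), of i] by (auto simp: delta_def proper_factors_def)

lemma sum_proper_factors:
  assumes "e 0 = 0 \<Longrightarrow> g 0 = (0::real)"
  shows "(\<Sum>i\<le>\<psi>. g i) = (\<Sum>i\<in>proper_factors \<psi> e. g i)"
proof (rule sum.mono_neutral_right)
  show "\<forall>i\<in>{..\<psi>} - proper_factors \<psi> e. g i = 0"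
  proof
    fix i assume "i \<in> {..\<psi>} - proper_factors \<psi> e"
    then have "i = 0" "e 0 = 0" by (auto simp: proper_factors_def)
    then show "g i = 0" using assms by simp
  qed
qed (auto simp: proper_factors_def)

text \<open>Radicals ignore multiplicities: every prime of the value divides the numerator of
  \<open>c0\<close> or one of the distinct factors, so the radical is at most the absolute value of
  their product, whatever the exponents \<open>e i\<close>.\<close>

lemma rad_upper_bound:
  assumes fac: "form_factorization F c0 \<psi> Fs e" and F: "binary_form d F" and m: "m \<ge> 1"
  shows "\<exists>C\<ge>1. \<forall>B a b. B \<ge> 1 \<longrightarrow> (a, b) \<in> form_box m B \<longrightarrow>
    real_of_int (rad (eval_xy F a (b ^ m))) \<le> C * B powr (\<Sum>i\<le>\<psi>. delta m Fs e i)"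
proof -
  define I where "I = proper_factors \<psi> e"
  define s where "s = fst (quotient_of c0)"
  have finI: "finite I" by (simp add: I_def)
  define K where "K i = 1 + (\<Sum>l\<le>degree (poly (Fs i) 1). \<bar>real_of_int (coeff (poly (Fs i) 1) l)\<bar>)" for i
  have K: "K i \<ge> 1" for i by (simp add: K_def sum_nonneg)
  define C where "C = (1 + \<bar>real_of_int s\<bar>) * (\<Prod>i\<in>I. K i)"
  have prodK: "(\<Prod>i\<in>I. K i) \<ge> 1" using K by (intro prod_ge_1) auto
  have C: "C \<ge> 1" using prodK mult_mono[of 1 "1 + \<bar>real_of_int s\<bar>" 1 "\<Prod>i\<in>I. K i"] by (simp add: C_def)
  have sumI: "(\<Sum>i\<le>\<psi>. delta m Fs e i) = (\<Sum>i\<in>I. delta m Fs e i)"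
    unfolding I_def by (rule sum_proper_factors) (simp add: delta_def)
  have "real_of_int (rad (eval_xy F a (b ^ m))) \<le> C * B powr (\<Sum>i\<le>\<psi>. delta m Fs e i)"
    if B: "B \<ge> 1" and ab: "(a, b) \<in> form_box m B" for B a b
  proof (cases "eval_xy F a (b ^ m) = 0")
    case True
    \<comment> \<open>A vanishing value has radical 1, so it suffices that both factors of the bound
      are at least 1.\<close>
    have "B powr (\<Sum>i\<le>\<psi>. delta m Fs e i) \<ge> 1"
      using B by (intro ge_one_powr_ge_zero sum_nonneg) (auto simp: delta_def)
    then have "1 * 1 \<le> C * B powr (\<Sum>i\<le>\<psi>. delta m Fs e i)"
      using C by (intro mult_mono) auto
    then show ?thesis using True by (simp add: rad_def)
  next
    case False
    let ?n = "eval_xy F a (b ^ m)" and ?v = "\<lambda>i. factor_val m Fs i a b"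
    define N where "N = s * (\<Prod>i\<in>I. ?v i)"
    have s0: "s \<noteq> 0"
      using form_factorization_const_ne_0[OF fac F] unfolding s_def
      by (metis fst_conv of_int_0 div_0 quotient_of_div surj_pair prod.collapse)
    have "N \<noteq> 0"
      using False eval_eq_0_iff[OF fac F m] s0 finI by (simp add: N_def I_def)
    have "prime_factors ?n \<subseteq> prime_factors N"
    proof
      fix p assume p: "p \<in> prime_factors ?n"
      then have pp: "prime p" and "p dvd ?n" by auto
      then have "p dvd s * (\<Prod>i\<le>\<psi>. eval_xy (Fs i) a (b ^ m) ^ e i)"
        using form_factorization_eval[OF fac, of a "b ^ m"] by (metis dvd_mult s_def)
      then have "p dvd s \<or> (\<exists>i\<le>\<psi>. p dvd eval_xy (Fs i) a (b ^ m) ^ e i)"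
        using pp by (auto simp: prime_dvd_mult_iff prime_dvd_prod_iff)
      then have "p dvd N"
      proof (elim disjE exE conjE)
        fix i assume i: "i \<le> \<psi>" "p dvd eval_xy (Fs i) a (b ^ m) ^ e i"
        then have "p dvd ?v i"
          using prime_dvd_factor_val_iff[OF fac m i(1) pp] prime_dvd_power[OF pp] by blast
        moreover have "e i \<noteq> 0"
          using i pp by (intro notI) (auto dest: not_prime_unit)
        then have "i \<in> I" using i by (cases "i = 0") (auto simp: I_def proper_factors_def)
        ultimately show "p dvd N"
          unfolding N_def using finI by (meson dvd_mult dvd_prodI dvd_trans)
      qed (simp add: N_def)
      then show "p \<in> prime_factors N" using pp \<open>N \<noteq> 0\<close> by (simp add: prime_factors_dvd)
    qed
    then have "rad ?n \<le> rad N"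
      unfolding rad_def by (intro prod_primes_le) auto
    also have "\<dots> \<le> \<bar>N\<bar>" by (rule rad_le_abs) fact
    finally have "real_of_int (rad ?n) \<le> real_of_int \<bar>N\<bar>" by (simp only: of_int_le_iff)
    also have "\<dots> = \<bar>real_of_int s\<bar> * (\<Prod>i\<in>I. \<bar>real_of_int (?v i)\<bar>)"
      by (simp add: N_def abs_mult abs_prod)
    also have "\<dots> \<le> (1 + \<bar>real_of_int s\<bar>) * (\<Prod>i\<in>I. K i * B powr delta m Fs e i)"
    proof (intro mult_mono prod_mono conjI)
      fix i assume i: "i \<in> I"
      have ab': "\<bar>real_of_int a\<bar> \<le> B ^ m" "\<bar>real_of_int b\<bar> \<le> B" "\<bar>real_of_int (b ^ m)\<bar> \<le> B ^ m"
        using ab by (auto simp: form_box_def power_abs power_mono)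
      show "\<bar>real_of_int (?v i)\<bar> \<le> K i * B powr delta m Fs e i"
      proof (cases "i = 0")
        case True
        have "B * 1 \<le> B * K 0" using K B by (intro mult_left_mono) auto
        then have "\<bar>real_of_int b\<bar> \<le> K 0 * B"
          using ab'(2) by (simp only: mult.commute mult_1)
        then show ?thesis
          using True B i delta_eq[OF fac, of 0 m] by (simp add: factor_val_def I_def)
      next
        case False
        let ?f = "poly (Fs i) 1"
        have "\<bar>real_of_int (?v i)\<bar> \<le> (\<Sum>l\<le>degree ?f. \<bar>real_of_int (coeff ?f l)\<bar>) * (B ^ m) ^ degree ?f"
          using False abs_form_val_le[OF ab'(1,3)] by (simp add: factor_val_def)
        also have "\<dots> \<le> K i * (B ^ m) ^ degree ?f"
          using B by (intro mult_right_mono) (auto simp: K_def)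
        also have "(B ^ m) ^ degree ?f = B powr delta m Fs e i"
          using False i B delta_eq[OF fac, of i m] by (simp add: I_def powr_powr flip: powr_realpow)
        finally show ?thesis .
      qed
    qed (auto intro: prod_nonneg)
    also have "\<dots> = C * B powr (\<Sum>i\<in>I. delta m Fs e i)"
      using B by (simp add: C_def prod.distrib powr_sum finI mult.assoc)
    finally show ?thesis by (simp add: sumI)
  qed
  with C show ?thesis by blast
qed

section \<open>The lower bound for the radical outside a negligible set\<close>

lemma weight_ge_1: "weight m Fs e i \<ge> 1"
  by (simp add: weight_def)

lemma negligible_pairs_factor:
  assumes fac: "form_factorization F c0 \<psi> Fs e" and m: "m \<ge> 1" and i: "i \<in> proper_factors \<psi> e"
    and \<tau>: "\<tau> < delta m Fs e i / weight m Fs e i"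
  shows "negligible_pairs m (\<lambda>B a b. large_rad (sqrt (ln B)) (factor_val m Fs i a b) < B powr \<tau>)"
proof (cases "i = 0")
  case True
  have "delta m Fs e i / weight m Fs e i \<le> 1"
    using delta_eq[OF fac i, of m] weight_ge_1[of m Fs e i] True by simp
  then show ?thesis
    using negligible_pairs_small_large_rad_snd[of \<tau> m] \<tau> True by (simp add: factor_val_def)
next
  case False
  then have i': "i \<in> {1..\<psi>}" using i by (auto simp: proper_factors_def)
  let ?f = "poly (Fs i) 1"
  define k where "k = degree ?f"
  note f = form_factorization_factor[OF fac i']
  define w where "w = weight m Fs e i"
  have dl: "delta m Fs e i = m * k" using delta_eq[OF fac i] False by (simp add: k_def)
  have \<tau>': "\<tau> < m * k / w" using \<tau> by (simp add: dl w_def)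
  have w1: "w \<ge> 1" unfolding w_def by (rule weight_ge_1)
  have mk: "real (m * k) / w \<le> m * k"
    using w1 divide_left_mono[of 1 w "real (m * k)"] by simp
  \<comment> \<open>For k \<ge> 2 the variable \<open>x\<close> does not divide the factor, so the
    weight is the maximum in its definition.\<close>
  have w2: "real (m * k) - 2 \<le> w" if "k \<ge> 2"
    using f(6) that dl by (auto simp: w_def weight_def k_def)
  obtain U V D where cert: "U * ?f + V * pderiv ?f = [:D:]" "D \<noteq> 0"
    using int_poly_squarefree_certificate[OF f(4,1)] by blast
  have "negligible_pairs m (\<lambda>B a b. large_rad (sqrt (ln B)) (form_val ?f a (b ^ m)) < B powr \<tau>)"
  proof (rule negligible_pairs_small_large_rad[OF cert f(1) m])
    show "\<tau> < real (m * degree ?f)" using \<tau>' mk by (simp add: k_def)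
    show "\<tau> \<le> real m" if "degree ?f \<ge> 3" "m \<ge> 2"
    proof -
      have k3: "k \<ge> 3" using that by (simp add: k_def)
      \<comment> \<open>After division by \<open>m\<close> this is k + 2 \<le> m k; it yields
        \<delta> / w \<le> m, so one prime above B^m is enough.\<close>
      have "real (m * k) \<le> m * (m * k - 2)"
      proof -
        have "(m - 1) * k \<ge> 1 * 3" using k3 that by (intro mult_mono) auto
        then have "k + 2 \<le> m * k" using that(2) by (simp add: diff_mult_distrib)
        then have "m * k \<le> m * (m * k - 2)" by (intro mult_left_mono) auto
        then show ?thesis using \<open>k + 2 \<le> m * k\<close> by (metis of_nat_le_iff)
      qed
      have "2 * 3 \<le> m * k" using k3 that by (intro mult_mono) auto
      then have "real m * real (m * k - 2) = real m * (real (m * k) - 2)" by (simp add: of_nat_diff)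
      also have "\<dots> \<le> real m * w" using w2 k3 by (intro mult_left_mono) auto
      finally have "real (m * k) \<le> m * w" using \<open>real (m * k) \<le> m * (m * k - 2)\<close> by simp
      then have "real (m * k) / w \<le> m" using w1 by (simp add: divide_le_eq)
      then show ?thesis using \<tau>' by linarith
    qed
    show "\<tau> < 2" if "degree ?f \<ge> 4" "m = 1"
    proof -
      have "real k \<le> 2 * w" using w2 that by (simp add: k_def)
      then have "real (m * k) / w \<le> 2" using w1 that by (simp add: divide_le_eq)
      then show ?thesis using \<tau>' by linarith
    qed
  qed
  then show ?thesis using False by (simp add: factor_val_def)
qed

text \<open>The primes above \<open>z\<close> of different factors are disjoint. Off the divisors of
  \<open>b\<close>, a shared prime would give a common root a / b^m of two dehomogenized factors and
  so divide their Bezout constant; a prime of \<open>b\<close> dividing another factor would divide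
  \<open>a\<close> as well.\<close>

lemma rad_ge_prod_large_rad:
  fixes z :: real
  assumes fac: "form_factorization F c0 \<psi> Fs e" and F: "binary_form d F" and m: "m \<ge> 1"
    and den: "snd (quotient_of c0) \<le> z"
    and lc: "\<And>i. i \<in> {1..\<psi>} \<Longrightarrow> \<bar>real_of_int (lead_coeff (poly (Fs i) 1))\<bar> \<le> z"
    and bez: "\<And>i j. i \<in> {1..\<psi>} \<Longrightarrow> j \<in> {1..\<psi>} \<Longrightarrow> i \<noteq> j \<Longrightarrow>
      \<exists>U V. U * poly (Fs i) 1 + V * poly (Fs j) 1 = [:J i j:] \<and> J i j \<noteq> 0 \<and> \<bar>real_of_int (J i j)\<bar> \<le> z"
    and cop: "\<And>p. real_of_int p > z \<Longrightarrow> p dvd a \<Longrightarrow> p dvd b \<Longrightarrow> False"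
    and nz: "\<And>i. i \<in> proper_factors \<psi> e \<Longrightarrow> factor_val m Fs i a b \<noteq> 0"
  shows "(\<Prod>i\<in>proper_factors \<psi> e. large_rad z (factor_val m Fs i a b)) \<le> rad (eval_xy F a (b ^ m))"
proof -
  define I where "I = proper_factors \<psi> e"
  let ?n = "eval_xy F a (b ^ m)" and ?v = "\<lambda>i. factor_val m Fs i a b"
  define P where "P i = {p \<in> prime_factors (?v i). real_of_int p > z}" for i
  have nd: "\<not> p dvd x" if "real_of_int p > z" "x \<noteq> 0" "\<bar>real_of_int x\<bar> \<le> z" for p x :: int
  proof
    assume "p dvd x"
    then have "\<bar>p\<bar> \<le> \<bar>x\<bar>" using that by (intro dvd_imp_le_int) auto
    then show False using that by linarith
  qed
  have n0: "?n \<noteq> 0" using eval_eq_0_iff[OF fac F m] nz by blast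
  have pos: "i \<in> {1..\<psi>}" if "i \<in> I" "i \<noteq> 0" for i
    using that by (auto simp: I_def proper_factors_def)
  have npb: "\<not> p dvd b" if "p \<in> P i" "i \<in> I" "i \<noteq> 0" for p i
  proof
    assume pb: "p dvd b"
    let ?f = "poly (Fs i) 1"
    note f = form_factorization_factor[OF fac pos[OF that(2,3)]]
    have p: "prime p" "real_of_int p > z" "p dvd form_val ?f a (b ^ m)"
      using that by (auto simp: P_def factor_val_def)
    have "lead_coeff ?f \<noteq> 0" using f(1) by auto
    then have "\<not> p dvd lead_coeff ?f"
      using nd[OF p(2), of "lead_coeff ?f"] lc[OF pos[OF that(2,3)]] by simp
    moreover have "p dvd b ^ m" using pb m by (meson dvd_power dvd_trans less_le_trans zero_less_one)
    ultimately have "p dvd a"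
      using prime_dvd_form_val_imp_dvd[OF p(1,3) _ _ f(1)] by blast
    then show False using cop p(2) pb by blast
  qed
  have disj: "P i \<inter> P j = {}" if ij: "i \<in> I" "j \<in> I" "i \<noteq> j" for i j
  proof (rule ccontr)
    assume "P i \<inter> P j \<noteq> {}"
    then obtain p where p: "p \<in> P i" "p \<in> P j" by blast
    then have pp: "prime p" "real_of_int p > z" by (auto simp: P_def)
    \<comment> \<open>At least one of the two indices is nonzero, so \<open>npb\<close> applies to
      it. This in turn excludes index 0 for the other, since the primes in \<open>P 0\<close> divide
      \<open>b\<close>.\<close>
    have nb: "\<not> p dvd b" using npb p ij by metis
    have i0: "i \<noteq> 0" "j \<noteq> 0" using nb p by (metis (no_types, lifting) P_def factor_val_def in_prime_factors_imp_dvd mem_Collect_eq)+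
    have "coprime (b ^ m) p"
      using prime_imp_coprime[OF pp(1) nb] by (simp add: coprime_commute)
    then obtain y where y: "[b ^ m * y = 1] (mod p)"
      using cong_solve_coprime_int by blast
    have root: "p dvd poly f (a * y)" if "p dvd form_val f a (b ^ m)" for f
      using form_val_cong[OF y, of f a] that by (meson cong_dvd_iff dvd_mult2)
    have r: "p dvd poly (poly (Fs i) 1) (a * y)" "p dvd poly (poly (Fs j) 1) (a * y)"
      using p i0 by (auto intro!: root simp: P_def factor_val_def)
    obtain U V where UV: "U * poly (Fs i) 1 + V * poly (Fs j) 1 = [:J i j:]" "J i j \<noteq> 0" "\<bar>real_of_int (J i j)\<bar> \<le> z"
      using bez[OF pos[OF ij(1) i0(1)] pos[OF ij(2) i0(2)] ij(3)] by blast
    have "p dvd poly (U * poly (Fs i) 1 + V * poly (Fs j) 1) (a * y)"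
      unfolding poly_add poly_mult using r by (intro dvd_add dvd_mult)
    then have "p dvd J i j" unfolding UV(1) by simp
    then show False using nd[OF pp(2) UV(2)] UV(3) by simp
  qed
  have sub: "(\<Union>i\<in>I. P i) \<subseteq> prime_factors ?n"
  proof safe
    fix i p assume i: "i \<in> I" and p: "p \<in> P i"
    then have pp: "prime p" "real_of_int p > z" "p dvd ?v i" by (auto simp: P_def)
    have i': "i \<le> \<psi>" using i by (simp add: I_def proper_factors_def)
    have "p dvd eval_xy (Fs i) a (b ^ m)"
      using prime_dvd_factor_val_iff[OF fac m i' pp(1)] pp(3) by blast
    then have "p dvd eval_xy (Fs i) a (b ^ m) ^ e i"
      using proper_factors_exponent[OF fac] i by (metis I_def dvd_power dvd_trans less_le_trans zero_less_one)
    then have "p dvd (\<Prod>i\<le>\<psi>. eval_xy (Fs i) a (b ^ m) ^ e i)"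
      using i' by (meson dvd_prodI dvd_trans finite_atMost atMost_iff)
    then have "p dvd snd (quotient_of c0) * ?n"
      using form_factorization_eval[OF fac, of a "b ^ m"] by (metis dvd_mult)
    \<comment> \<open>Only primes of the denominator of \<open>c0\<close> can be cancelled from the
      product of the factors, and they are at most \<open>z\<close>.\<close>
    moreover have "\<not> p dvd snd (quotient_of c0)"
      using quotient_of_denom_pos'[of c0] den by (intro nd pp) auto
    ultimately have "p dvd ?n" using pp(1) by (simp add: prime_dvd_mult_iff)
    then show "p \<in> prime_factors ?n" using pp(1) n0 by (simp add: prime_factors_dvd)
  qed
  have "(\<Prod>i\<in>I. large_rad z (?v i)) = (\<Prod>i\<in>I. \<Prod>(P i))"
    by (simp add: large_rad_def P_def)
  also have "\<dots> = \<Prod>(\<Union>i\<in>I. P i)"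
    by (rule prod.UNION_disjoint[symmetric]) (use disj in \<open>auto simp: I_def P_def\<close>)
  also have "\<dots> \<le> rad ?n"
    unfolding rad_def using sub by (intro prod_primes_le) auto
  finally show ?thesis by (simp add: I_def)
qed

lemma sum_delta_div_weight_pos:
  assumes "form_factorization F c0 \<psi> Fs e" "binary_form d F" "d \<ge> 1" "m \<ge> 1"
  shows "(\<Sum>i\<le>\<psi>. delta m Fs e i / weight m Fs e i) > 0"
proof -
  have "(\<Sum>i\<le>\<psi>. delta m Fs e i / weight m Fs e i) = (\<Sum>i\<in>proper_factors \<psi> e. delta m Fs e i / weight m Fs e i)"
    by (rule sum_proper_factors) (simp add: delta_def)
  also have "\<dots> > 0"
  proof (rule sum_pos)
    fix i assume i: "i \<in> proper_factors \<psi> e"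
    have "delta m Fs e i > 0"
      using delta_eq[OF assms(1) i] assms(4) form_factorization_factor(1)[OF assms(1), of i] i
      by (cases "i = 0") (auto simp: proper_factors_def)
    then show "delta m Fs e i / weight m Fs e i > 0"
      using weight_ge_1[of m Fs e i] by simp
  qed (use proper_factors_nonempty[OF assms(1-3)] in auto)
  finally show ?thesis .
qed

lemma negligible_pairs_small_rad:
  assumes fac: "form_factorization F c0 \<psi> Fs e" and F: "binary_form d F" and d: "d \<ge> 1" and m: "m \<ge> 1"
    and \<beta>: "\<beta> > kappa m d \<psi> Fs e"
  shows "negligible_pairs m (\<lambda>B a b. real_of_int (rad (eval_xy F a (b ^ m))) powr \<beta> \<le> B powr real (m * d))"
proof -
  define I where "I = proper_factors \<psi> e"
  define S where "S = (\<Sum>i\<le>\<psi>. delta m Fs e i / weight m Fs e i)"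
  have S0: "S > 0" unfolding S_def by (rule sum_delta_div_weight_pos[OF fac F d m])
  have SI: "S = (\<Sum>i\<in>I. delta m Fs e i / weight m Fs e i)"
    unfolding S_def I_def by (rule sum_proper_factors) (simp add: delta_def)
  have \<beta>S: "m * d < \<beta> * S"
    using \<beta> S0 by (simp add: kappa_def S_def divide_less_eq)
  have "\<beta> > 0"
  proof -
    have "0 \<le> kappa m d \<psi> Fs e" using S0 by (simp add: kappa_def S_def)
    then show ?thesis using \<beta> by linarith
  qed
  \<comment> \<open>The midpoint of m d / (\<beta> S) and 1: below 1, so each \<tau>_i stays under
    \<delta>_i / w_i, and large enough that the \<beta>-th power of B^(\<theta> S) still exceeds
    B^(m d).\<close>
  define \<theta> where "\<theta> = (1 + m * d / (\<beta> * S)) / 2"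
  have md: "m * d / (\<beta> * S) < 1" "m * d / (\<beta> * S) \<ge> 0"
    using \<beta>S \<open>\<beta> > 0\<close> S0 by (simp_all add: divide_less_eq)
  have \<theta>: "\<theta> < 1" "\<theta> > 0" using md by (simp_all add: \<theta>_def)
  have "\<theta> * (\<beta> * S) = (\<beta> * S + m * d) / 2"
    using \<open>\<beta> > 0\<close> S0 by (simp add: \<theta>_def field_simps)
  then have \<theta>S: "m * d < \<theta> * S * \<beta>"
    using \<beta>S by (simp add: mult_ac)
  define \<tau> where "\<tau> i = \<theta> * (delta m Fs e i / weight m Fs e i)" for i
  have \<tau>: "0 < \<tau> i" "\<tau> i < delta m Fs e i / weight m Fs e i" if "i \<in> I" for i
  proof -
    have "delta m Fs e i > 0"
      using that delta_eq[OF fac, of i m] m form_factorization_factor(1)[OF fac, of i]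
      by (cases "i = 0") (auto simp: I_def proper_factors_def)
    then have *: "delta m Fs e i / weight m Fs e i > 0"
      using weight_ge_1[of m Fs e i] by simp
    show "0 < \<tau> i" unfolding \<tau>_def using \<theta>(2) * by (rule mult_pos_pos)
    show "\<tau> i < delta m Fs e i / weight m Fs e i"
      unfolding \<tau>_def using mult_strict_right_mono[OF \<theta>(1) *] by simp
  qed
  have "\<exists>J. \<forall>i j. i \<in> {1..\<psi>} \<longrightarrow> j \<in> {1..\<psi>} \<longrightarrow> i \<noteq> j \<longrightarrow>
      (\<exists>U V. U * poly (Fs i) 1 + V * poly (Fs j) 1 = [:J i j:] \<and> J i j \<noteq> 0)"
    using form_factorization_bezout[OF fac] by metis
  then obtain J where J: "\<And>i j. i \<in> {1..\<psi>} \<Longrightarrow> j \<in> {1..\<psi>} \<Longrightarrow> i \<noteq> j \<Longrightarrow>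
      \<exists>U V. U * poly (Fs i) 1 + V * poly (Fs j) 1 = [:J i j:] \<and> J i j \<noteq> 0" by blast
  \<comment> \<open>One bound for all constants of the form that primes above \<open>z\<close> must
    not divide; the choice function \<open>J\<close> fixes the Bezout constants before
    \<open>B\<close> grows.\<close>
  define L where "L = real_of_int (snd (quotient_of c0)) + (\<Sum>i\<in>{1..\<psi>}. real_of_int \<bar>lead_coeff (poly (Fs i) 1)\<bar>)
    + (\<Sum>(i, j)\<in>{1..\<psi>} \<times> {1..\<psi>}. real_of_int \<bar>J i j\<bar>)"
  have den0: "snd (quotient_of c0) > 0" by (rule quotient_of_denom_pos')
  have L1: "real_of_int (snd (quotient_of c0)) \<le> L"
    unfolding L_def by (simp add: sum_nonneg case_prod_beta)
  have L2: "real_of_int \<bar>lead_coeff (poly (Fs i) 1)\<bar> \<le> L" if "i \<in> {1..\<psi>}" for i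
  proof -
    have "real_of_int \<bar>lead_coeff (poly (Fs i) 1)\<bar> \<le> (\<Sum>i\<in>{1..\<psi>}. real_of_int \<bar>lead_coeff (poly (Fs i) 1)\<bar>)"
      using that by (intro member_le_sum) auto
    moreover have "(\<Sum>(i, j)\<in>{1..\<psi>} \<times> {1..\<psi>}. real_of_int \<bar>J i j\<bar>) \<ge> 0"
      by (simp add: sum_nonneg case_prod_beta)
    ultimately show ?thesis using den0 unfolding L_def by linarith
  qed
  have L3: "real_of_int \<bar>J i j\<bar> \<le> L" if "i \<in> {1..\<psi>}" "j \<in> {1..\<psi>}" for i j
  proof -
    have "(case (i, j) of (i, j) \<Rightarrow> real_of_int \<bar>J i j\<bar>) \<le> (\<Sum>(i, j)\<in>{1..\<psi>} \<times> {1..\<psi>}. real_of_int \<bar>J i j\<bar>)"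
      using that by (intro member_le_sum) auto
    moreover have "(\<Sum>i\<in>{1..\<psi>}. real_of_int \<bar>lead_coeff (poly (Fs i) 1)\<bar>) \<ge> 0"
      by (simp add: sum_nonneg)
    moreover have "real_of_int (snd (quotient_of c0)) > 0" using den0 by simp
    ultimately show ?thesis unfolding L_def prod.case by linarith
  qed
  let ?z = "\<lambda>B::real. sqrt (ln B)"
  let ?Z = "\<lambda>(B::real) a b. a = 0 \<or> b = (0::int)"
  let ?D = "\<lambda>B a b. a \<noteq> 0 \<and> b \<noteq> 0 \<and> (\<exists>n. real_of_int n > ?z B \<and> n dvd a \<and> n dvd b)"
  let ?R = "\<lambda>B a b. \<exists>i\<in>I. large_rad (?z B) (factor_val m Fs i a b) < B powr \<tau> i"
  have "negligible_pairs m (\<lambda>B a b. ?Z B a b \<or> ?D B a b \<or> ?R B a b)"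
  proof (rule negligible_pairs_disj[OF _ negligible_pairs_disj])
    show "negligible_pairs m ?Z" using m by (rule negligible_pairs_zero)
    show "negligible_pairs m ?D" by (rule negligible_pairs_common_divisor) real_asymp+
    show "negligible_pairs m ?R"
      by (rule negligible_pairs_Bex) (use \<tau> in \<open>auto simp: I_def intro!: negligible_pairs_factor[OF fac m]\<close>)
  qed
  then show ?thesis
  proof (rule negligible_pairs_mono)
    have "filterlim (\<lambda>B::real. sqrt (ln B)) at_top at_top" by real_asymp
    then have "\<forall>\<^sub>F B in at_top. ?z B \<ge> L" unfolding filterlim_at_top by blast
    then show "\<forall>\<^sub>F B in at_top. \<forall>a b. (a, b) \<in> form_box m B \<longrightarrow>
        real_of_int (rad (eval_xy F a (b ^ m))) powr \<beta> \<le> B powr real (m * d) \<longrightarrow> ?Z B a b \<or> ?D B a b \<or> ?R B a b"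
      using eventually_gt_at_top[of 1]
    proof eventually_elim
      case (elim B)
      show ?case
      proof (intro allI impI, rule ccontr)
        fix a b assume small: "real_of_int (rad (eval_xy F a (b ^ m))) powr \<beta> \<le> B powr real (m * d)"
          and good: "\<not> (?Z B a b \<or> ?D B a b \<or> ?R B a b)"
        have big: "B powr \<tau> i \<le> large_rad (?z B) (factor_val m Fs i a b)" if "i \<in> I" for i
          using good that by (auto simp: not_less)
        have nz: "factor_val m Fs i a b \<noteq> 0" if "i \<in> I" for i
        proof
          assume "factor_val m Fs i a b = 0"
          then have "B powr \<tau> i \<le> 1" using big[OF that] by (simp add: large_rad_def)
          moreover have "B powr \<tau> i > 1" using \<tau>(1)[OF that] elim(2) by simp
          ultimately show False by simp
        qed
        have "(\<Prod>i\<in>I. large_rad (?z B) (factor_val m Fs i a b)) \<le> rad (eval_xy F a (b ^ m))"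
          unfolding I_def
        proof (rule rad_ge_prod_large_rad[OF fac F m])
          show "snd (quotient_of c0) \<le> ?z B" using L1 elim(1) by linarith
          show "\<bar>real_of_int (lead_coeff (poly (Fs i) 1))\<bar> \<le> ?z B" if "i \<in> {1..\<psi>}" for i
            using L2[OF that] elim(1) by linarith
          show "\<exists>U V. U * poly (Fs i) 1 + V * poly (Fs j) 1 = [:J i j:] \<and> J i j \<noteq> 0 \<and> \<bar>real_of_int (J i j)\<bar> \<le> ?z B"
            if ij: "i \<in> {1..\<psi>}" "j \<in> {1..\<psi>}" "i \<noteq> j" for i j
          proof -
            have "\<bar>real_of_int (J i j)\<bar> \<le> ?z B" using L3[OF ij(1,2)] elim(1) by linarith
            then show ?thesis using J[OF ij] by blast
          qed
          show False if "real_of_int p > ?z B" "p dvd a" "p dvd b" for p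
            using good that by blast
        qed (use nz in \<open>auto simp: I_def\<close>)
        then have "real_of_int (\<Prod>i\<in>I. large_rad (?z B) (factor_val m Fs i a b)) \<le> real_of_int (rad (eval_xy F a (b ^ m)))"
          by (simp only: of_int_le_iff)
        moreover have "(\<Prod>i\<in>I. B powr \<tau> i) \<le> real_of_int (\<Prod>i\<in>I. large_rad (?z B) (factor_val m Fs i a b))"
          unfolding of_int_prod using big by (intro prod_mono) auto
        moreover have "(\<Prod>i\<in>I. B powr \<tau> i) = B powr (\<theta> * S)"
          using elim(2) by (simp add: SI \<tau>_def sum_distrib_left powr_sum I_def)
        ultimately have "B powr (\<theta> * S) \<le> real_of_int (rad (eval_xy F a (b ^ m)))" by linarith
        then have "(B powr (\<theta> * S)) powr \<beta> \<le> real_of_int (rad (eval_xy F a (b ^ m))) powr \<beta>"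
          using \<open>\<beta> > 0\<close> by (intro powr_mono2) auto
        then have "B powr (\<theta> * S * \<beta>) \<le> B powr (m * d)"
          using small by (simp add: powr_powr)
        then show False using \<theta>S elim(2) by simp
      qed
    qed
  qed
qed

section \<open>From \<open>B\<close> back to \<open>X\<close>\<close>

lemma form_box_powr:
  assumes "X \<ge> 1" "d \<ge> 1" "m \<ge> 1"
  defines "B \<equiv> X powr (1 / real (m * d))"
  shows "B \<ge> 1" "B ^ m = X powr (1 / real d)" "B powr real (m * d) = X"
    "B ^ (m + 1) = X powr (real (m + 1) / real (m * d))" "ln B = ln X / real (m * d)"
proof -
  have md: "real m > 0" "real d > 0" "real (m * d) > 0" using assms by auto
  show B: "B \<ge> 1" unfolding B_def using assms by (simp add: ge_one_powr_ge_zero)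
  have pw: "B ^ n = X powr (real n / real (m * d))" for n
    using B assms(1) by (simp add: B_def powr_powr flip: powr_realpow)
  show "B ^ m = X powr (1 / real d)" unfolding pw using md by simp
  show "B powr real (m * d) = X" unfolding B_def powr_powr using md assms(1) by simp
  show "B ^ (m + 1) = X powr (real (m + 1) / real (m * d))" by (rule pw)
  show "ln B = ln X / real (m * d)" unfolding B_def using assms(1) by (simp add: ln_powr)
qed

text \<open>(6/5)^6 = 2.985984 is just below 3, and ln (6/5) \<ge> 1/6. This makes ln (ln X)
  positive and bounded away from 0 for X \<ge> 3.\<close>

lemma ln_3_gt_1: "ln 3 > (1::real)"
proof -
  have "ln (5 / 6) \<le> (5 / 6 :: real) - 1" by (rule ln_le_minus_one) simp
  moreover have "ln (6 / 5 :: real) = - ln (5 / 6)" by (simp add: ln_div)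
  ultimately have "1 \<le> 6 * ln (6 / 5 :: real)" by simp
  also have "\<dots> = ln ((6 / 5) ^ 6)" by (subst ln_realpow) auto
  also have "\<dots> < ln (3 :: real)" by (subst ln_less_cancel_iff) (simp_all add: power_divide)
  finally show ?thesis .
qed

text \<open>The asymptotic bound holds only for large \<open>B\<close>. For \<open>B\<close> below
  \<open>B1\<close> the trivial count of the box suffices, as ln X is bounded there by M ln B1.
  Since (ln (ln X))^2 is at least the constant \<open>l\<close> on the whole range, it can be
  inserted at the price of 1 / l.\<close>

lemma negligible_pairs_imp_card_bound:
  assumes neg: "negligible_pairs m P" and d: "d \<ge> 1" and m: "m \<ge> 1"
  shows "\<exists>C. \<forall>X\<ge>3. 1 / X powr (real (m + 1) / real (m * d)) *
    real (card {(a, b) \<in> form_box m (X powr (1 / real (m * d))). P (X powr (1 / real (m * d))) a b})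
    \<le> C * ((ln (ln X))\<^sup>2 / (ln X) powr (1 / 2))"
proof -
  obtain c where c: "c > 0" "\<forall>\<^sub>F B in at_top. norm (real (card {(a, b) \<in> form_box m B. P B a b}))
      \<le> c * norm (B ^ (m + 1) / sqrt (ln B))"
    using neg unfolding negligible_pairs_def by (elim landau_o.bigE)
  then obtain B0 where B0: "\<And>B. B \<ge> B0 \<Longrightarrow> real (card {(a, b) \<in> form_box m B. P B a b})
      \<le> c * \<bar>B ^ (m + 1) / sqrt (ln B)\<bar>"
    unfolding eventually_at_top_linorder by auto
  define B1 where "B1 = max B0 2"
  define M where "M = real (m * d)"
  have "1 \<le> m * d" using d m by simp
  then have M: "M \<ge> 1" unfolding M_def by linarith
  define K where "K = sqrt (M * ln B1)"
  define l where "l = (ln (ln 3 :: real))\<^sup>2"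
  have "ln 3 > (1::real)" by (rule ln_3_gt_1)
  then have ll3: "ln (ln 3) > (0::real)" by simp
  then have l0: "l > 0" by (simp add: l_def)
  have K0: "K \<ge> 0" using M by (simp add: K_def B1_def)
  define C where "C = (c * sqrt M + 9 * K) / l"
  have "1 / X powr (real (m + 1) / real (m * d)) *
    real (card {(a, b) \<in> form_box m (X powr (1 / real (m * d))). P (X powr (1 / real (m * d))) a b})
    \<le> C * ((ln (ln X))\<^sup>2 / (ln X) powr (1 / 2))" if X: "X \<ge> 3" for X
  proof -
    define B where "B = X powr (1 / real (m * d))"
    have X1: "X \<ge> 1" using X by simp
    note B = form_box_powr[OF X1 d m, folded B_def]
    let ?N = "real (card {(a, b) \<in> form_box m B. P B a b})"
    have "ln 3 \<le> ln X" using X by simp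
    then have lnX: "ln X > 1" using ln_3_gt_1 by linarith
    then have lnB: "ln B > 0" using B(5) M by (simp add: M_def)
    have sq: "sqrt (ln X) > 0" using lnX by simp
    have "?N / B ^ (m + 1) \<le> (c * sqrt M + 9 * K) / sqrt (ln X)"
    proof (cases "B \<ge> B1")
      case True
      have "?N \<le> c * \<bar>B ^ (m + 1) / sqrt (ln B)\<bar>" by (rule B0) (use True in \<open>simp add: B1_def\<close>)
      also have "\<bar>B ^ (m + 1) / sqrt (ln B)\<bar> = B ^ (m + 1) / sqrt (ln B)"
        using B(1) lnB by (intro abs_of_nonneg) auto
      finally have "?N / B ^ (m + 1) \<le> c / sqrt (ln B)"
        using B(1) by (simp add: divide_le_eq mult_ac)
      also have "\<dots> = c * sqrt M / sqrt (ln X)"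
        unfolding B(5) M_def[symmetric] by (simp add: real_sqrt_divide)
      also have "\<dots> \<le> (c * sqrt M + 9 * K) / sqrt (ln X)"
        using K0 sq by (intro divide_right_mono) auto
      finally show ?thesis .
    next
      case False
      have "?N \<le> real (card (form_box m B))" by (intro of_nat_mono card_mono) auto
      also have "\<dots> \<le> 9 * B ^ (m + 1)" using B(1) by (rule card_form_box_le)
      finally have "?N / B ^ (m + 1) \<le> 9" using B(1) by (simp add: divide_le_eq)
      also have "9 \<le> 9 * K / sqrt (ln X)"
      proof -
        have "ln B \<le> ln B1" using False B(1) by (intro ln_mono) auto
        then have "ln X \<le> M * ln B1" using M unfolding B(5) M_def[symmetric] by (simp add: divide_le_eq mult.commute)
        then have "sqrt (ln X) \<le> K" unfolding K_def by simp
        then show ?thesis using sq by (simp add: le_divide_eq)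
      qed
      also have "\<dots> \<le> (c * sqrt M + 9 * K) / sqrt (ln X)"
        using c(1) M sq by (intro divide_right_mono) auto
      finally show ?thesis .
    qed
    also have "\<dots> = C * (l / sqrt (ln X))"
      using l0 by (simp add: C_def)
    also have "\<dots> \<le> C * ((ln (ln X))\<^sup>2 / sqrt (ln X))"
    proof (intro mult_left_mono divide_right_mono)
      have "ln 3 \<le> ln X" using X by simp
      then have "ln (ln 3) \<le> ln (ln X)" using ln_3_gt_1 X by (intro ln_mono) auto
      then show "l \<le> (ln (ln X))\<^sup>2" unfolding l_def using ll3 by (intro power_mono) auto
      show "C \<ge> 0" using c(1) M K0 l0 by (simp add: C_def)
    qed (use sq in simp)
    finally show ?thesis
      unfolding B(4)[symmetric] B_def[symmetric] using lnX by (simp add: powr_half_sqrt)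
  qed
  then show ?thesis by blast
qed

theorem theorem3p3:
  fixes F :: "int poly poly" and d m :: nat
  assumes "binary_form d F" and "d \<ge> 1" and "m \<ge> 1"
  shows "(\<forall>\<beta>::real. \<exists>C::real. \<forall>c0 \<psi> Fs e.
            form_factorization F c0 \<psi> Fs e \<and> \<beta> > kappa m d \<psi> Fs e \<longrightarrow>
            (\<forall>X::real. X \<ge> 3 \<longrightarrow>
              1 / X powr (real (m + 1) / real (m * d)) *
                real (card {(a :: int, b :: int).
                   \<bar>real_of_int a\<bar> \<le> X powr (1 / real d) \<and>
                   \<bar>real_of_int b\<bar> \<le> X powr (1 / real (m * d)) \<and>
                   real_of_int (rad (eval_xy F a (b ^ m))) powr \<beta> \<le> X})
              \<le> C * ((ln (ln X))\<^sup>2 / (ln X) powr (1 / 2)))) \<and>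
         (\<exists>C::real. \<forall>c0 \<psi> Fs e. form_factorization F c0 \<psi> Fs e \<longrightarrow>
            (\<forall>X::real. X \<ge> 3 \<longrightarrow> (\<forall>a b :: int.
               \<bar>real_of_int a\<bar> \<le> X powr (1 / real d) \<and>
               \<bar>real_of_int b\<bar> \<le> X powr (1 / real (m * d)) \<longrightarrow>
               real_of_int (rad (eval_xy F a (b ^ m))) powr (lambda m d \<psi> Fs e) \<le> C * X)))"
proof (intro conjI allI)
  fix \<beta> :: real
  show "\<exists>C::real. \<forall>c0 \<psi> Fs e.
            form_factorization F c0 \<psi> Fs e \<and> \<beta> > kappa m d \<psi> Fs e \<longrightarrow>
            (\<forall>X::real. X \<ge> 3 \<longrightarrow>
              1 / X powr (real (m + 1) / real (m * d)) *
                real (card {(a :: int, b :: int).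
                   \<bar>real_of_int a\<bar> \<le> X powr (1 / real d) \<and>
                   \<bar>real_of_int b\<bar> \<le> X powr (1 / real (m * d)) \<and>
                   real_of_int (rad (eval_xy F a (b ^ m))) powr \<beta> \<le> X})
              \<le> C * ((ln (ln X))\<^sup>2 / (ln X) powr (1 / 2)))"
  proof (cases "\<exists>c0 \<psi> Fs e. form_factorization F c0 \<psi> Fs e \<and> \<beta> > kappa m d \<psi> Fs e")
    case True
    \<comment> \<open>The count does not depend on the factorization, so one factorization with \<open>\<kappa> < \<beta>\<close> provides \<open>C\<close>.\<close>
    then obtain c0 \<psi> Fs e where fac: "form_factorization F c0 \<psi> Fs e" and \<beta>: "\<beta> > kappa m d \<psi> Fs e" by blast
    let ?P = "\<lambda>B a b. real_of_int (rad (eval_xy F a (b ^ m))) powr \<beta> \<le> B powr real (m * d)"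
    obtain C where C: "\<And>X. X \<ge> 3 \<Longrightarrow> 1 / X powr (real (m + 1) / real (m * d)) *
      real (card {(a, b) \<in> form_box m (X powr (1 / real (m * d))). ?P (X powr (1 / real (m * d))) a b})
      \<le> C * ((ln (ln X))\<^sup>2 / (ln X) powr (1 / 2))"
      using negligible_pairs_imp_card_bound[OF negligible_pairs_small_rad[OF fac assms \<beta>] assms(2,3)] by blast
    have "{(a, b) \<in> form_box m (X powr (1 / real (m * d))). ?P (X powr (1 / real (m * d))) a b} =
      {(a, b). \<bar>real_of_int a\<bar> \<le> X powr (1 / real d) \<and> \<bar>real_of_int b\<bar> \<le> X powr (1 / real (m * d)) \<and>
        real_of_int (rad (eval_xy F a (b ^ m))) powr \<beta> \<le> X}" if "X \<ge> 3" for X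
      using form_box_powr(2,3)[of X d m] that assms(2,3) unfolding form_box_def by auto
    with C show ?thesis by (intro exI[of _ C]) auto
  qed blast
next
  \<comment> \<open>A natural number version of the sum of the \<delta>_i, so that a factorization
    with the least sum exists.\<close>
  define s where "s \<psi> Fs e = (if e 0 \<ge> 1 then 1 else 0) + (\<Sum>i\<in>{1..\<psi>}. m * total_degree (Fs i))"
    for \<psi> and Fs :: "nat \<Rightarrow> int poly poly" and e :: "nat \<Rightarrow> nat"
  have s: "(\<Sum>i\<le>\<psi>. delta m Fs e i) = real (s \<psi> Fs e)" for \<psi> Fs e
  proof -
    have "{..\<psi>} = insert 0 {1..\<psi>}" by auto
    then have "(\<Sum>i\<le>\<psi>. delta m Fs e i) = delta m Fs e 0 + (\<Sum>i\<in>{1..\<psi>}. delta m Fs e i)"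
      by (simp only:) simp
    also have "(\<Sum>i\<in>{1..\<psi>}. delta m Fs e i) = (\<Sum>i\<in>{1..\<psi>}. real (m * total_degree (Fs i)))"
      by (intro sum.cong) (auto simp: delta_def)
    finally show ?thesis by (simp add: s_def delta_def)
  qed
  show "\<exists>C::real. \<forall>c0 \<psi> Fs e. form_factorization F c0 \<psi> Fs e \<longrightarrow>
            (\<forall>X::real. X \<ge> 3 \<longrightarrow> (\<forall>a b :: int.
               \<bar>real_of_int a\<bar> \<le> X powr (1 / real d) \<and>
               \<bar>real_of_int b\<bar> \<le> X powr (1 / real (m * d)) \<longrightarrow>
               real_of_int (rad (eval_xy F a (b ^ m))) powr (lambda m d \<psi> Fs e) \<le> C * X))"
  proof (cases "\<exists>n c0 \<psi> Fs e. form_factorization F c0 \<psi> Fs e \<and> s \<psi> Fs e = n")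
    case True
    \<comment> \<open>A factorization with minimal \<open>\<Sum>\<delta>\<^sub>i\<close> has the largest \<open>\<lambda>\<close>; its bound serves all others.\<close>
    define n where "n = (LEAST n. \<exists>c0 \<psi> Fs e. form_factorization F c0 \<psi> Fs e \<and> s \<psi> Fs e = n)"
    obtain c0 \<psi> Fs e where fac: "form_factorization F c0 \<psi> Fs e" and n: "s \<psi> Fs e = n"
      unfolding n_def using LeastI_ex[OF True] by blast
    have least: "n \<le> s \<psi>' Fs' e'" if "form_factorization F c0' \<psi>' Fs' e'" for c0' \<psi>' Fs' e'
      unfolding n_def using that by (intro Least_le) blast
    obtain C where C: "C \<ge> 1" "\<And>B a b. B \<ge> 1 \<Longrightarrow> (a, b) \<in> form_box m B \<Longrightarrow>
      real_of_int (rad (eval_xy F a (b ^ m))) \<le> C * B powr real n"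
      using rad_upper_bound[OF fac assms(1,3)] unfolding s n by blast
    have "real_of_int (rad (eval_xy F a (b ^ m))) powr (lambda m d \<psi>' Fs' e') \<le> C powr real (m * d) * X"
      if fac': "form_factorization F c0' \<psi>' Fs' e'" and X: "X \<ge> 3"
        and ab: "\<bar>real_of_int a\<bar> \<le> X powr (1 / real d)" "\<bar>real_of_int b\<bar> \<le> X powr (1 / real (m * d))"
      for c0' \<psi>' Fs' e' X a b
    proof -
      define n' where "n' = s \<psi>' Fs' e'"
      have lam: "lambda m d \<psi>' Fs' e' = real (m * d) / real n'" by (simp add: lambda_def s n'_def)
      have X1: "X \<ge> 1" using X by simp
      define B where "B = X powr (1 / real (m * d))"
      note B = form_box_powr[OF X1 assms(2,3), folded B_def]
      have "(a, b) \<in> form_box m B" using ab B(2) by (simp add: form_box_def B_def)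
      then have le: "real_of_int (rad (eval_xy F a (b ^ m))) \<le> C * B powr real n"
        using C(2) B(1) by blast
      have r1: "real_of_int (rad (eval_xy F a (b ^ m))) \<ge> 1" using rad_pos by simp
      show ?thesis
      proof (cases "n' = 0")
        case True
        \<comment> \<open>Here division by 0 makes \<open>lambda\<close> equal to 0, and the
          left-hand side is 1.\<close>
        have "1 * 1 \<le> C powr real (m * d) * X"
          using C(1) X1 by (intro mult_mono ge_one_powr_ge_zero) auto
        then show ?thesis using True r1 by (simp add: lam)
      next
        case False
        have lam0: "lambda m d \<psi>' Fs' e' \<ge> 0" by (simp add: lam)
        have "B powr real n \<le> B powr real n'"
          using least[OF fac'] B(1) by (intro powr_mono) (auto simp: n'_def)
        then have "C * B powr real n \<le> C * B powr real n'" using C(1) by (intro mult_left_mono) auto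
        then have "real_of_int (rad (eval_xy F a (b ^ m))) powr lambda m d \<psi>' Fs' e' \<le> (C * B powr real n') powr lambda m d \<psi>' Fs' e'"
          using le r1 lam0 by (intro powr_mono2) auto
        also have "\<dots> = C powr lambda m d \<psi>' Fs' e' * B powr (real n' * lambda m d \<psi>' Fs' e')"
          using C(1) by (simp add: powr_mult powr_powr)
        also have "real n' * lambda m d \<psi>' Fs' e' = real (m * d)" using False by (simp add: lam)
        also have "B powr real (m * d) = X" by (rule B(3))
        also have "C powr lambda m d \<psi>' Fs' e' * X \<le> C powr real (m * d) * X"
        proof (intro mult_right_mono powr_mono)
          \<comment> \<open>This bounds \<open>lambda\<close> by m d for every factorization, which
            removes the last dependence of the constant on the factorization.\<close>
          have "real n' \<ge> 1" using False by simp
          then show "lambda m d \<psi>' Fs' e' \<le> real (m * d)"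
            unfolding lam using divide_left_mono[of 1 "real n'" "real (m * d)"] by simp
        qed (use C(1) X1 in auto)
        finally show ?thesis .
      qed
    qed
    then show ?thesis by blast
  qed blast
qed

end
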